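(* Let $n$ be even, $t\ge 1$, and $\varepsilon\in[0,1/4]$. Let $\Pi$ be any two-party quantum communication protocol for the Augmented Index function $f_n$ (with read-only input registers and no intermediate measurements) in which Alice sends the first message and the players alternate, for a total of $t$ messages. If $\Pi$ makes error at most $\varepsilon$ on the uniform distribution $\mu$ over inputs, then \[ 2\left[ \frac{\mathrm{QIC}_{\mu_0}^{A}(\Pi)}{n} \right]^{1/2} + \left[ 2\cdot \mathrm{QIC}_{\mu_0}^{B}(\Pi) \right]^{1/2} \;\geq\; \frac{1-4\varepsilon}{4\sqrt{\kappa\, t}}, \] where $\kappa = \frac{\ln 2}{2}$ and $\mu_0$ is the uniform distribution over $f_n^{-1}(0)$.
   Context: Augmented Index: Alice holds $x\in\{0,1\}^n$; Bob holds $k\in[n]$, $b\in\{0,1\}$ and the prefix $x[1,k-1]$; $f_n = x_k\oplus b$. $\mu$ is the uniform distribution on $\{0,1\}^n\times[n]\times\{0,1\}$ and $\mu_0$ is $\mu$ conditioned on $b=x_k$. Quantum protocol model (Yao): initial state $|x\rangle\otimes|\Phi\rangle\otimes|\text{Bob's input}\rangle$, where $|\Phi\rangle$ is an input-independent, possibly entangled, state of Alice's and Bob's workspaces; in each round the sending player applies a unitary to her/his workspace controlled by her/his input (input registers are only read, never modified) and then sends some workspace qubits to the other player; after the $t$-th message the recipient measures her/his workspace to produce the output. Convention for inputs: Alice's input is held in a register, and Bob is given $k,b$ together with read-only access to the first $k-1$ qubits of Alice's input register (under $\mu_0$, read-only access to its first $k$ qubits), i.e., Bob's unitaries are controlled by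 that part of the register. Error at most $\varepsilon$ on $\mu$ means the output differs from $f_n$ with probability at most $\varepsilon$ when the inputs are drawn from $\mu$. For the information costs, initialize Alice's input register to the uniform superposition $\hat X = 2^{-n/2}\sum_{x\in\{0,1\}^n}|x\rangle$ and give Bob a uniformly random index $K\in[n]$ with read-only access to the first $K$ qubits of this register (corresponding to $\mu_0$). Let $P_i^0$ and $Q_i^0$ denote Alice's and Bob's workspace states immediately after the $i$-th message, and let $X$ denote the classical random variable obtained by measuring the input register in the computational basis (so $X$ is uniform and $X[1,K]$ is its length-$K$ prefix). Define $\mathrm{QIC}^{A}_{\mu_0}(\Pi) = \sum_{\text{odd } i\in[t]} \mathrm{I}(X : Q_i^0 \mid X[1,K])$ and $\mathrm{QIC}^{B}_{\mu_0}(\Pi) = \sum_{\text{even } i\in[t]} \mathrm{I}(K : \hat X P_i^0)$, where $\mathrm{I}$ is quantum (von Neumann) mutual information, conditional mutual information given classical registers being the average of mutual informations over the values of the condition, and $\hat X P_i^0$ denotes the joint state of the input register and Alice's workspace. *)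

theory Defs
  imports
    "HOL-Library.Countable_Set"
    "Jordan_Normal_Form.Char_Poly"
begin

section \<open>Operators on finite-dimensional spaces with labelled bases\<close>

text \<open>
  For a finite set \<open>B\<close> of basis labels, a vector of the Hilbert space \<open>\<complex>\<^sup>B\<close> is a function on labels
  and an operator is its kernel \<open>U a b = \<langle>a|U|b\<rangle>\<close>; only values at labels in \<open>B\<close> matter. Composite
  systems carry pairs of labels, so that no encoding of labels by numbers is needed for tensor
  products and partial traces.
\<close>

type_synonym 'b oper = "'b \<Rightarrow> 'b \<Rightarrow> complex"

definition oprod :: "'b set \<Rightarrow> 'b oper \<Rightarrow> 'b oper \<Rightarrow> 'b oper" where
  "oprod B U V = (\<lambda>a c. \<Sum>b\<in>B. U a b * V b c)"

definition adj :: "'b oper \<Rightarrow> 'b oper" where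
  "adj U = (\<lambda>a b. cnj (U b a))"

definition otrace :: "'b set \<Rightarrow> 'b oper \<Rightarrow> complex" where
  "otrace B U = (\<Sum>a\<in>B. U a a)"

definition unitary_on :: "'b set \<Rightarrow> 'b oper \<Rightarrow> bool" where
  "unitary_on B U \<longleftrightarrow>
     (\<forall>a\<in>B. \<forall>b\<in>B. oprod B (adj U) U a b = of_bool (a = b)
                \<and> oprod B U (adj U) a b = of_bool (a = b))"

definition psd_on :: "'b set \<Rightarrow> 'b oper \<Rightarrow> bool" where
  "psd_on B E \<longleftrightarrow>
     (\<forall>a\<in>B. \<forall>b\<in>B. adj E a b = E a b) \<and>
     (\<forall>v :: 'b \<Rightarrow> complex. 0 \<le> Re (\<Sum>a\<in>B. \<Sum>b\<in>B. cnj (v a) * E a b * v b))"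

text \<open>A measurement (POVM) with outcomes in \<open>bool\<close>.\<close>

definition povm_on :: "'b set \<Rightarrow> (bool \<Rightarrow> 'b oper) \<Rightarrow> bool" where
  "povm_on B E \<longleftrightarrow>
     (\<forall>c. psd_on B (E c)) \<and> (\<forall>a\<in>B. \<forall>b\<in>B. (\<Sum>c\<in>UNIV. E c a b) = of_bool (a = b))"

definition pure_op :: "('b \<Rightarrow> complex) \<Rightarrow> 'b oper" where
  "pure_op \<psi> = (\<lambda>a b. \<psi> a * cnj (\<psi> b))"

definition ptrace_fst :: "'a set \<Rightarrow> ('a \<times> 'b) oper \<Rightarrow> 'b oper" where
  "ptrace_fst A \<rho> = (\<lambda>b b'. \<Sum>a\<in>A. \<rho> (a, b) (a, b'))"

definition ptrace_snd :: "'b set \<Rightarrow> ('a \<times> 'b) oper \<Rightarrow> 'a oper" where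
  "ptrace_snd B \<rho> = (\<lambda>a a'. \<Sum>b\<in>B. \<rho> (a, b) (a', b))"

section \<open>Von Neumann entropy and mutual information\<close>

definition oper_mat :: "'b set \<Rightarrow> 'b oper \<Rightarrow> complex mat" where
  "oper_mat B \<rho> =
     mat (card B) (card B) (\<lambda>(i, j). \<rho> (from_nat_into B i) (from_nat_into B j))"

text \<open>
  Entropy in bits: the Shannon entropy of the eigenvalues, counted with their multiplicity as
  roots of the characteristic polynomial. The term of a zero eigenvalue is \<open>0\<close>.
  The enumeration chosen in \<open>oper_mat\<close> does not matter, as another one gives a similar matrix.
\<close>

definition vn_entropy :: "'b set \<Rightarrow> 'b oper \<Rightarrow> real" where
  "vn_entropy B \<rho> =
     - (\<Sum>r | poly (char_poly (oper_mat B \<rho>)) r = 0.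
          real (order r (char_poly (oper_mat B \<rho>))) * (Re r * log 2 (Re r)))"

definition mutual_info :: "'a set \<Rightarrow> 'b set \<Rightarrow> ('a \<times> 'b) oper \<Rightarrow> real" where
  "mutual_info A B \<rho> =
     vn_entropy A (ptrace_snd B \<rho>) + vn_entropy B (ptrace_fst A \<rho>) - vn_entropy (A \<times> B) \<rho>"

section \<open>Augmented Index\<close>

definition bitstrings :: "nat \<Rightarrow> bool list set" where
  "bitstrings n = {x. length x = n}"

text \<open>
  Indices \<open>k\<close> range over \<open>{1..n}\<close>, so the bit \<open>x\<^sub>k\<close> is \<open>x ! (k - 1)\<close> and the prefix \<open>x[1,k]\<close>
  is \<open>take k x\<close>.
\<close>

definition aug_index :: "bool list \<Rightarrow> nat \<Rightarrow> bool \<Rightarrow> bool" where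
  "aug_index x k b \<longleftrightarrow> x ! (k - 1) \<noteq> b"

section \<open>Two-party quantum protocols\<close>

text \<open>
  The workspace qubits carry labels in \<open>nat\<close>. A computational basis state of a set \<open>R\<close> of qubits
  is the set \<open>S \<subseteq> R\<close> of those qubits that are in state 1, so the labels for \<open>R\<close> form \<open>Pow R\<close>
  and, for disjoint \<open>R\<close> and \<open>R'\<close>, the basis state \<open>|S\<rangle> \<otimes> |S'\<rangle>\<close> of \<open>R \<union> R'\<close> is \<open>|S \<union> S'\<rangle>\<close>.

  \<open>message i\<close> is the set of qubits sent in the \<open>i\<close>-th message. The unitary of round \<open>i\<close> is
  \<open>alice_op i x\<close> (\<open>i\<close> odd) or \<open>bob_op i k b (x[1,k-1])\<close> (\<open>i\<close> even), and the final measurement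
  likewise depends on the measuring player's input. Only the operators of rounds in which
  the player in question moves are used.
\<close>

record protocol =
  qubits :: "nat set"
  alice_start :: "nat set"
  shared_state :: "nat set \<Rightarrow> complex"
  message :: "nat \<Rightarrow> nat set"
  alice_op :: "nat \<Rightarrow> bool list \<Rightarrow> nat set oper"
  bob_op :: "nat \<Rightarrow> nat \<Rightarrow> bool \<Rightarrow> bool list \<Rightarrow> nat set oper"
  alice_meas :: "bool list \<Rightarrow> bool \<Rightarrow> nat set oper"
  bob_meas :: "nat \<Rightarrow> bool \<Rightarrow> bool list \<Rightarrow> bool \<Rightarrow> nat set oper"

text \<open>The qubits held immediately after the \<open>i\<close>-th message.\<close>

fun alice_qubits :: "protocol \<Rightarrow> nat \<Rightarrow> nat set" where
  "alice_qubits p 0 = alice_start p"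
| "alice_qubits p (Suc i) =
     (if odd (Suc i) then alice_qubits p i - message p (Suc i)
      else alice_qubits p i \<union> message p (Suc i))"

definition bob_qubits :: "protocol \<Rightarrow> nat \<Rightarrow> nat set" where
  "bob_qubits p i = qubits p - alice_qubits p i"

definition protocol_for :: "nat \<Rightarrow> nat \<Rightarrow> protocol \<Rightarrow> bool" where
  "protocol_for n t p \<longleftrightarrow>
     finite (qubits p) \<and>
     alice_start p \<subseteq> qubits p \<and>
     (\<Sum>S\<in>Pow (qubits p). (cmod (shared_state p S))\<^sup>2) = 1 \<and>
     (\<forall>i\<in>{1..t}. odd i \<longrightarrow>
        message p i \<subseteq> alice_qubits p (i - 1) \<and>
        (\<forall>x\<in>bitstrings n. unitary_on (Pow (alice_qubits p (i - 1))) (alice_op p i x))) \<and>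
     (\<forall>i\<in>{1..t}. even i \<longrightarrow>
        message p i \<subseteq> bob_qubits p (i - 1) \<and>
        (\<forall>k\<in>{1..n}. \<forall>b. \<forall>z\<in>bitstrings (k - 1).
           unitary_on (Pow (bob_qubits p (i - 1))) (bob_op p i k b z))) \<and>
     (if odd t
      then \<forall>k\<in>{1..n}. \<forall>b. \<forall>z\<in>bitstrings (k - 1).
             povm_on (Pow (bob_qubits p t)) (bob_meas p k b z)
      else \<forall>x\<in>bitstrings n. povm_on (Pow (alice_qubits p t)) (alice_meas p x))"

text \<open>
  States of Alice's input register together with the whole workspace are vectors with labels
  \<open>(x, S)\<close>. \<open>controlled R U\<close> applies \<open>U x\<close> to the qubits in \<open>R\<close> when the input register
  contains \<open>x\<close>.
\<close>

type_synonym joint_state = "bool list \<times> nat set \<Rightarrow> complex"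

definition controlled :: "nat set \<Rightarrow> (bool list \<Rightarrow> nat set oper) \<Rightarrow> joint_state \<Rightarrow> joint_state" where
  "controlled R U \<Psi> = (\<lambda>(x, S). \<Sum>T\<in>Pow R. U x (S \<inter> R) T * \<Psi> (x, (S - R) \<union> T))"

text \<open>
  \<open>run p k \<beta> a i\<close> is the joint state after the \<open>i\<close>-th message when the input register starts in
  \<open>\<Sum>\<^sub>x a x |x\<rangle>\<close> and Bob's index is \<open>k\<close>. Bob's bit may be read off the register: it is \<open>\<beta> x\<close> when
  the register contains \<open>x\<close>. Sending qubits changes their owner but not the state.
\<close>

fun run :: "protocol \<Rightarrow> nat \<Rightarrow> (bool list \<Rightarrow> bool) \<Rightarrow> (bool list \<Rightarrow> complex) \<Rightarrow> nat \<Rightarrow> joint_state" where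
  "run p k \<beta> a 0 = (\<lambda>(x, S). a x * shared_state p S)"
| "run p k \<beta> a (Suc i) =
     (if odd (Suc i)
      then controlled (alice_qubits p i) (alice_op p (Suc i)) (run p k \<beta> a i)
      else controlled (bob_qubits p i) (\<lambda>x. bob_op p (Suc i) k (\<beta> x) (take (k - 1) x))
             (run p k \<beta> a i))"

text \<open>The reduced state of the input register and the workspace qubits in \<open>R\<close>.\<close>

definition reduced :: "protocol \<Rightarrow> nat set \<Rightarrow> joint_state \<Rightarrow> (bool list \<times> nat set) oper" where
  "reduced p R \<Psi> =
     ptrace_snd (Pow (qubits p - R)) (pure_op (\<lambda>((x, S), T). \<Psi> (x, S \<union> T)))"

section \<open>Distributional error\<close>

definition output_prob :: "nat \<Rightarrow> nat \<Rightarrow> protocol \<Rightarrow> bool list \<Rightarrow> nat \<Rightarrow> bool \<Rightarrow> bool \<Rightarrow> real" where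
  "output_prob n t p x k b c =
     (let R = (if odd t then bob_qubits p t else alice_qubits p t);
          E = (if odd t then bob_meas p k b (take (k - 1) x) else alice_meas p x);
          \<rho> = ptrace_fst (bitstrings n)
                (reduced p R (run p k (\<lambda>_. b) (\<lambda>y. of_bool (y = x)) t))
      in Re (otrace (Pow R) (oprod (Pow R) (E c) \<rho>)))"

definition error_prob :: "nat \<Rightarrow> nat \<Rightarrow> protocol \<Rightarrow> real" where
  "error_prob n t p =
     (\<Sum>x\<in>bitstrings n. \<Sum>k=1..n. \<Sum>b\<in>UNIV.
        output_prob n t p x k b (\<not> aug_index x k b) / (2 ^ n * real n * 2))"

section \<open>Quantum information costs\<close>

text \<open>
  The run on a uniform superposition of Alice's inputs and index \<open>k\<close> under the condition
  \<open>b = x\<^sub>k\<close>, so that Bob effectively reads the first \<open>k\<close> qubits of the register.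
\<close>

definition run0 :: "nat \<Rightarrow> protocol \<Rightarrow> nat \<Rightarrow> nat \<Rightarrow> joint_state" where
  "run0 n p k i =
     run p k (\<lambda>x. x ! (k - 1)) (\<lambda>x. if x \<in> bitstrings n then complex_of_real (1 / sqrt (2 ^ n)) else 0) i"

definition measure_register :: "(bool list \<times> nat set) oper \<Rightarrow> (bool list \<times> nat set) oper" where
  "measure_register \<rho> = (\<lambda>(x, S) (x', S'). if x = x' then \<rho> (x, S) (x', S') else 0)"

text \<open>
  Conditioning the measured register on the prefix \<open>z\<close>. The register content is uniform,
  so a prefix of length \<open>k\<close> has probability \<open>2\<^sup>-\<^sup>k\<close>, which accounts for the factor.
\<close>

definition given_prefix :: "bool list \<Rightarrow> (bool list \<times> nat set) oper \<Rightarrow> (bool list \<times> nat set) oper" where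
  "given_prefix z \<rho> = (\<lambda>(x, S) (x', S').
     if take (length z) x = z \<and> take (length z) x' = z
     then 2 ^ length z * \<rho> (x, S) (x', S') else 0)"

text \<open>
  The condition \<open>X[1,K]\<close> determines \<open>K\<close>, being a string of length \<open>K\<close>; its values are the pairs
  of \<open>k\<close> and a string \<open>z\<close> of length \<open>k\<close>, with probability \<open>1 / (n 2\<^sup>k)\<close>.
\<close>

definition QIC_A :: "nat \<Rightarrow> nat \<Rightarrow> protocol \<Rightarrow> real" where
  "QIC_A n t p =
     (\<Sum>i | i \<in> {1..t} \<and> odd i.
        \<Sum>k=1..n. \<Sum>z\<in>bitstrings k.
          1 / (real n * 2 ^ k) *
          mutual_info (bitstrings n) (Pow (bob_qubits p i))
            (given_prefix z (measure_register (reduced p (bob_qubits p i) (run0 n p k i)))))"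

text \<open>The joint state of the classical uniform \<open>K\<close>, the input register and Alice's workspace.\<close>

definition index_alice_state :: "nat \<Rightarrow> protocol \<Rightarrow> nat \<Rightarrow> (nat \<times> bool list \<times> nat set) oper" where
  "index_alice_state n p i = (\<lambda>(k, u) (k', u').
     if k = k' then 1 / of_nat n * reduced p (alice_qubits p i) (run0 n p k i) u u' else 0)"

definition QIC_B :: "nat \<Rightarrow> nat \<Rightarrow> protocol \<Rightarrow> real" where
  "QIC_B n t p =
     (\<Sum>i | i \<in> {1..t} \<and> even i.
        mutual_info {1..n} (bitstrings n \<times> Pow (alice_qubits p i)) (index_alice_state n p i))"

definition kappa :: real where
  "kappa = ln 2 / 2"

end

theory Submission
  imports Defs "HOL-Analysis.L2_Norm"
begin

text \<open>
  Fix indices \<open>j \<le> n/2 < l\<close>, a prefix \<open>w\<close> of length \<open>l - 1\<close> and a bit \<open>c\<close>, and compare the runs in which Alice's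
  input extends \<open>u = w c\<close> or \<open>u' = w (\<not>c)\<close> (in superposition over the remaining bits) and Bob's input
  is \<open>(j, w\<^sub>j, w[1,j-1])\<close> or \<open>(l, c, w)\<close>. Only the combination of \<open>u'\<close> with \<open>(l, c, w)\<close> has function value 1.

  Little information about \<open>X\<close> in Bob's registers makes the reduced states for \<open>u\<close> and \<open>u'\<close> close when Bob holds \<open>j\<close>,
  so an operation of Alice alone nearly maps one run to the other after each odd message. Little information
  about \<open>K\<close> in Alice's registers gives an operation of Bob alone, independent of the input register,
  that nearly exchanges \<open>j\<close> and \<open>l\<close> after each even message. As these operations commute with each other
  and with the moves of the other player, a hybrid argument shows that the fourth run can nearly be reached from the
  others, contradicting the different function value unless the accumulated distances are large.

  Closeness is obtained without Uhlmann's theorem: both states are mapped isometrically to the canonical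
  purification \<open>sqrt \<rho>\<close>, and the Hilbert--Schmidt distance of square roots is bounded by the relative entropy.
  The entropies telescope along the prefixes of \<open>X\<close>, and the final step averages over \<open>j\<close>, \<open>l\<close>, \<open>w\<close> and \<open>c\<close>.
\<close>

section \<open>Spectral decomposition\<close>

text \<open>Taking \<open>j\<close> in the lower and \<open>l\<close> in the upper half makes
  \<open>j < l\<close> for all \<open>(n/2)^2\<close> pairs, so whatever Bob reads with index
  \<open>j\<close> lies inside \<open>w\<close> and is common to \<open>u\<close> and
  \<open>u'\<close>. For fixed \<open>j\<close>, the chain rule lets the information about bit
  \<open>l\<close> add up over \<open>l\<close> to at most the information about all bits after
  \<open>j\<close>; averaging over the upper half is the source of the factor \<open>1/n\<close>.
  Bob's information carries no such factor, because the states of all indices are compared with one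
  average state.

  The prefix \<open>w\<close> is fixed rather than superposed because Alice's correcting operation
  also acts on the register: it commutes with Bob's moves only if these no longer read the register.

  Uhlmann's theorem would supply a unitary taking one run directly to the other. An isometry into a
  canonical purification needs an additional register of outcomes instead, which is why corrections
  appear as families of Kraus operators and distances as norms of families. In a comparison each of
  the two runs is mapped by its own isometry, so that none ever has to be inverted.\<close>

lemma sum_of_bool_eq [simp]:
  fixes f :: "'b \<Rightarrow> 'c::comm_semiring_1"
  assumes "finite B"
  shows "(\<Sum>b\<in>B. of_bool (a = b) * f b) = of_bool (a \<in> B) * f a"
    and "(\<Sum>b\<in>B. of_bool (b = a) * f b) = of_bool (a \<in> B) * f a"
    and "(\<Sum>b\<in>B. f b * of_bool (a = b)) = of_bool (a \<in> B) * f a"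
    and "(\<Sum>b\<in>B. f b * of_bool (b = a)) = of_bool (a \<in> B) * f a"
proof -
  have e: "of_bool (a = b) * f b = (if a = b then f a else 0)"
    "of_bool (b = a) * f b = (if a = b then f a else 0)"
    "f b * of_bool (a = b) = (if a = b then f a else 0)"
    "f b * of_bool (b = a) = (if a = b then f a else 0)" for b by auto
  show "(\<Sum>b\<in>B. of_bool (a = b) * f b) = of_bool (a \<in> B) * f a"
    "(\<Sum>b\<in>B. of_bool (b = a) * f b) = of_bool (a \<in> B) * f a"
    "(\<Sum>b\<in>B. f b * of_bool (a = b)) = of_bool (a \<in> B) * f a"
    "(\<Sum>b\<in>B. f b * of_bool (b = a)) = of_bool (a \<in> B) * f a"
    unfolding e using assms by simp_all
qed

lemma oprod_assoc: "oprod B (oprod B U V) W = oprod B U (oprod B V W)"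
proof (intro ext)
  fix a d
  show "oprod B (oprod B U V) W a d = oprod B U (oprod B V W) a d"
    unfolding oprod_def sum_distrib_left sum_distrib_right
    by (subst sum.swap) (simp add: mult.assoc)
qed

lemma adj_oprod: "adj (oprod B U V) = oprod B (adj V) (adj U)"
  by (auto simp: adj_def oprod_def mult.commute)

text \<open>Kernels are total functions with arbitrary values outside \<open>B\<close>, so matrix
  identities can only be expected on \<open>B\<close>.\<close>

definition eq_on :: "'b set \<Rightarrow> 'b oper \<Rightarrow> 'b oper \<Rightarrow> bool" where
  "eq_on B U V \<longleftrightarrow> (\<forall>a\<in>B. \<forall>b\<in>B. U a b = V a b)"

lemma eq_on_trans: "eq_on B U V \<Longrightarrow> eq_on B V W \<Longrightarrow> eq_on B U W"
  by (simp add: eq_on_def)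

lemma eq_on_sym: "eq_on B U V \<Longrightarrow> eq_on B V U"
  by (simp add: eq_on_def)

lemma eq_on_oprod: "eq_on B U U' \<Longrightarrow> eq_on B V V' \<Longrightarrow> eq_on B (oprod B U V) (oprod B U' V')"
  by (auto simp: eq_on_def oprod_def intro!: sum.cong)

abbreviation ident :: "'b oper" where "ident \<equiv> (\<lambda>a b. of_bool (a = b))"

lemma oprod_ident:
  assumes "finite B"
  shows "eq_on B (oprod B ident U) U" "eq_on B (oprod B U ident) U"
  using assms by (auto simp: eq_on_def oprod_def)

lemma unitary_on_iff:
  "unitary_on B U \<longleftrightarrow> eq_on B (oprod B (adj U) U) ident \<and> eq_on B (oprod B U (adj U)) ident"
  by (auto simp: unitary_on_def eq_on_def)

lemma unitary_on_oprod:
  fixes U V :: "'b oper"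
  assumes "finite B" "unitary_on B U" "unitary_on B V"
  shows "unitary_on B (oprod B U V)"
proof -
  have mid: "eq_on B (oprod B X (oprod B (oprod B Y Z) W)) ident"
    if "eq_on B (oprod B Y Z) ident" "eq_on B (oprod B X W) ident" for X Y Z W :: "'b oper"
  proof -
    have "eq_on B (oprod B (oprod B Y Z) W) W"
      by (rule eq_on_trans[OF eq_on_oprod[OF that(1)] oprod_ident(1)[OF assms(1)]]) (simp add: eq_on_def)
    from eq_on_oprod[OF _ this, of X X] have "eq_on B (oprod B X (oprod B (oprod B Y Z) W)) (oprod B X W)"
      by (simp add: eq_on_def)
    then show ?thesis using that(2) eq_on_trans by blast
  qed
  have "eq_on B (oprod B (adj V) (oprod B (oprod B (adj U) U) V)) ident"
    "eq_on B (oprod B U (oprod B (oprod B V (adj V)) (adj U))) ident"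
    by (rule mid; use assms(2,3) in \<open>simp add: unitary_on_iff\<close>)+
  then show ?thesis by (simp add: unitary_on_iff adj_oprod oprod_assoc)
qed

text \<open>The diagonalisation of \<open>\<rho>\<close> by a unitary. The eigenvalues are real and
  indexed by the basis labels, so multiplicities appear as repeated values.\<close>

definition spectral :: "'b set \<Rightarrow> 'b oper \<Rightarrow> 'b oper \<Rightarrow> ('b \<Rightarrow> real) \<Rightarrow> bool" where
  "spectral B \<rho> U l \<longleftrightarrow> unitary_on B U \<and>
     (\<forall>a\<in>B. \<forall>b\<in>B. \<rho> a b = (\<Sum>c\<in>B. U a c * of_real (l c) * cnj (U b c)))"

lemma oper_mat_carrier [simp]: "oper_mat B \<rho> \<in> carrier_mat (card B) (card B)"
  by (simp add: oper_mat_def)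

lemma enum_sum:
  assumes "finite B"
  shows "(\<Sum>j<card B. f (from_nat_into B j)) = (\<Sum>b\<in>B. f b)"
  by (rule sum.reindex_bij_betw[OF bij_betw_from_nat_into_finite[OF assms]])

lemma enum_mem: "finite B \<Longrightarrow> i < card B \<Longrightarrow> from_nat_into B i \<in> B"
  by (metis card.empty from_nat_into less_nat_zero_code)

lemma enum_inj: "finite B \<Longrightarrow> i < card B \<Longrightarrow> j < card B \<Longrightarrow>
    from_nat_into B i = from_nat_into B j \<longleftrightarrow> i = j"
  using bij_betw_from_nat_into_finite[of B] unfolding bij_betw_def inj_on_def by auto

text \<open>An eigenvalue is a root of the characteristic polynomial. The unit norm and the real
  entry at \<open>z\<close> prepare the reflection in \<open>householder\<close>.\<close>

lemma eigenvector_exists: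
  fixes H :: "'b oper"
  assumes fin: "finite B" and ne: "z \<in> B"
  shows "\<exists>v r. (\<forall>a\<in>B. (\<Sum>b\<in>B. H a b * v b) = r * v a) \<and> (\<Sum>b\<in>B. (cmod (v b))\<^sup>2) = 1
           \<and> Im (v z) = 0 \<and> 0 \<le> Re (v z)"
proof -
  let ?n = "card B" and ?M = "oper_mat B H" and ?g = "from_nat_into B"
  have n0: "?n > 0" using fin ne card_gt_0_iff by blast
  have "\<not> constant (poly (char_poly ?M))"
    using degree_monic_char_poly[of "oper_mat B H" "card B"] n0 by (simp add: constant_degree)
  then obtain r where "poly (char_poly ?M) r = 0"
    using fundamental_theorem_of_algebra by blast
  then obtain w where w: "w \<in> carrier_vec ?n" "w \<noteq> 0\<^sub>v ?n" "?M *\<^sub>v w = r \<cdot>\<^sub>v w"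
    using eigenvalue_root_char_poly[OF oper_mat_carrier, of B H r]
    unfolding eigenvalue_def eigenvector_def by (auto simp: oper_mat_def)
  define u where "u b = w $ (to_nat_on B b)" for b
  have ug: "u (?g i) = w $ i" if "i < ?n" for i
  proof -
    have "i \<in> to_nat_on B ` B" using to_nat_on_finite[OF fin] that by (simp add: bij_betw_def)
    then show ?thesis by (simp add: u_def)
  qed
  have surj: "\<exists>i<?n. b = ?g i" if "b \<in> B" for b
    using bij_betw_from_nat_into_finite[OF fin] that unfolding bij_betw_def by auto
  have ev: "(\<Sum>b\<in>B. H a b * u b) = r * u a" if "a \<in> B" for a
  proof -
    obtain i where i: "i < ?n" "a = ?g i" using surj \<open>a \<in> B\<close> by blast
    have "(\<Sum>b\<in>B. H a b * u b) = (\<Sum>j<?n. H a (?g j) * u (?g j))"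
      using enum_sum[OF fin, of "\<lambda>b. H a b * u b"] by simp
    also have "\<dots> = (?M *\<^sub>v w) $ i"
      using i w(1) by (simp add: oper_mat_def scalar_prod_def ug lessThan_atLeast0)
    finally show ?thesis using i w(1,3) by (simp add: ug)
  qed
  obtain i where i: "i < ?n" "w $ i \<noteq> 0" using w(1,2) by (metis carrier_vecD eq_vecI index_zero_vec)
  define s where "s = (\<Sum>b\<in>B. (cmod (u b))\<^sup>2)"
  have "s > 0" unfolding s_def
    by (rule sum_pos2[OF fin enum_mem[OF fin i(1)]]) (use i in \<open>auto simp: ug\<close>)
  \<comment> \<open>A phase that turns the entry at \<open>z\<close> into a nonnegative real; any
    phase serves if that entry is zero.\<close>
  define ph where "ph = (if u z = 0 then 1 else cnj (u z) / cmod (u z))"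
  have phn: "cmod ph = 1" by (simp add: ph_def norm_divide)
  define v where "v b = ph / sqrt s * u b" for b
  have "(\<Sum>b\<in>B. H a b * v b) = r * v a" if "a \<in> B" for a
  proof -
    have "(\<Sum>b\<in>B. H a b * v b) = ph / sqrt s * (\<Sum>b\<in>B. H a b * u b)"
      unfolding v_def sum_distrib_left by (intro sum.cong refl) (simp only: mult.left_commute)
    then show ?thesis by (simp only: ev[OF that] v_def mult.left_commute)
  qed
  moreover have "(\<Sum>b\<in>B. (cmod (v b))\<^sup>2) = 1"
    using \<open>s > 0\<close> by (simp add: v_def norm_mult norm_divide phn power_mult_distrib power_divide
        flip: s_def sum_divide_distrib)
  moreover have "v z = of_real (cmod (u z) / sqrt s)"
    using complex_norm_square[of "u z"] by (auto simp: v_def ph_def field_simps power2_eq_square)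
  ultimately show ?thesis using \<open>s > 0\<close>
    by (intro exI[of _ v] exI[of _ r]) (auto simp del: of_real_divide)
qed

text \<open>The reflection along \<open>v - e_z\<close> exchanges the unit vectors
  \<open>e_z\<close> and \<open>v\<close> as soon as their inner product is real. If they coincide
  there is no direction to reflect along, and the identity serves.\<close>

lemma householder:
  fixes v :: "'b \<Rightarrow> complex"
  assumes fin: "finite B" and z: "z \<in> B" and nv: "(\<Sum>b\<in>B. (cmod (v b))\<^sup>2) = 1" and im: "Im (v z) = 0"
  shows "\<exists>W. adj W = W \<and> eq_on B (oprod B W W) ident \<and> (\<forall>b\<in>B. W b z = v b)"
proof (cases "\<forall>b\<in>B. v b = of_bool (b = z)")
  case True
  then show ?thesis using oprod_ident(1)[OF fin, of ident]
    by (intro exI[of _ ident]) (auto simp: adj_def fun_eq_iff)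
next
  case False
  define w where "w b = v b - of_bool (b = z)" for b
  define s where "s = (\<Sum>b\<in>B. (cmod (w b))\<^sup>2)"
  obtain b0 where b0: "b0 \<in> B" "w b0 \<noteq> 0" using False by (auto simp: w_def)
  have "s > 0" unfolding s_def
    by (rule sum_pos2[OF fin b0(1)]) (use b0 in auto)
  have cn: "(cmod (w b))\<^sup>2 = (cmod (v b))\<^sup>2 + of_bool (b = z) * (1 - 2 * Re (v b))" for b
    unfolding w_def cmod_power2 by (cases "b = z") (simp_all add: power2_eq_square algebra_simps)
  have s2: "s = 2 - 2 * Re (v z)"
    unfolding s_def cn by (simp add: sum.distrib nv fin z)
  have sw: "(\<Sum>b\<in>B. cnj (w b) * w b) = of_real s"
    unfolding s_def of_real_sum by (intro sum.cong refl) (simp only: complex_norm_square mult.commute)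
  define q where "q = complex_of_real (2 / s)"
  define W where "W a b = of_bool (a = b) - w a * cnj (w b) * q" for a b
  have "adj W = W" by (auto simp: adj_def W_def fun_eq_iff q_def)
  moreover have "eq_on B (oprod B W W) ident"
  proof -
    have "oprod B W W a c = of_bool (a = c)" if "a \<in> B" "c \<in> B" for a c
    proof -
      have "oprod B W W a c = (\<Sum>b\<in>B. of_bool (a = b) * of_bool (b = c)
          - of_bool (a = b) * (w b * cnj (w c) * q) - (w a * cnj (w b) * q) * of_bool (b = c)
          + w a * cnj (w c) * q * q * (cnj (w b) * w b))"
        unfolding oprod_def W_def by (intro sum.cong refl) (simp add: algebra_simps)
      also have "\<dots> = of_bool (a = c) - w a * cnj (w c) * q - w a * cnj (w c) * q
          + w a * cnj (w c) * q * q * of_real s"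
        using that by (simp add: sum.distrib sum_subtractf fin sw flip: sum_distrib_left)
      also have "q * of_real s = 2" using \<open>s > 0\<close> by (simp add: q_def)
      then have "w a * cnj (w c) * q * q * of_real s = w a * cnj (w c) * q * 2"
        by (simp only: mult.assoc)
      finally show ?thesis by simp
    qed
    then show ?thesis by (simp add: eq_on_def)
  qed
  moreover have "W b z = v b" if "b \<in> B" for b
  proof -
    have "cnj (w z) = - of_real (s / 2)"
      using im by (simp add: w_def complex_eq_iff s2 field_simps)
    then have "cnj (w z) * q = -1" using \<open>s > 0\<close> by (simp add: q_def)
    then have "w b * cnj (w z) * q = - w b" by (simp only: mult.assoc) simp
    then show ?thesis by (simp add: W_def w_def)
  qed
  ultimately show ?thesis by blast
qed

lemma spectral_conj:
  assumes fin: "finite B" and W: "unitary_on B W" and E: "spectral B H' E l"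
    and H: "eq_on B H (oprod B W (oprod B H' (adj W)))"
  shows "spectral B H (oprod B W E) l"
proof -
  let ?D = "\<lambda>a b. of_bool (a = b) * complex_of_real (l b)"
  have D: "(\<Sum>c\<in>B. U a c * of_real (l c) * cnj (U b c)) = oprod B U (oprod B ?D (adj U)) a b" for U :: "'a oper" and a b
    unfolding oprod_def adj_def using fin by (intro sum.cong) (auto simp: mult.assoc)
  have E': "eq_on B H' (oprod B E (oprod B ?D (adj E)))"
    using E by (simp add: spectral_def eq_on_def D)
  have r: "eq_on B U U" for U :: "'a oper" by (simp add: eq_on_def)
  have "eq_on B (oprod B W (oprod B H' (adj W))) (oprod B W (oprod B (oprod B E (oprod B ?D (adj E))) (adj W)))"
    by (intro eq_on_oprod r E')
  with H have "eq_on B H (oprod B (oprod B W E) (oprod B ?D (adj (oprod B W E))))"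
    by (auto simp: oprod_assoc adj_oprod intro: eq_on_trans)
  then show ?thesis unfolding spectral_def D
    using unitary_on_oprod[OF fin W] E by (simp add: eq_on_def spectral_def)
qed

text \<open>Induction on the label set: after a reflection that turns an eigenvector into
  \<open>e_z\<close>, row and column \<open>z\<close> vanish off the diagonal, and the remaining
  block lives on the smaller set.\<close>

lemma hermitian_spectral:
  fixes H :: "'b oper"
  assumes "finite B" and "eq_on B (adj H) H"
  shows "\<exists>U l. spectral B H U l"
  using assms
proof (induction B arbitrary: H rule: finite_induct)
  case empty
  then show ?case by (auto simp: spectral_def unitary_on_def)
next
  case (insert z B)
  let ?C = "insert z B"
  have fin: "finite ?C" and z: "z \<in> ?C" using insert by auto
  obtain v r where v: "\<forall>a\<in>?C. (\<Sum>b\<in>?C. H a b * v b) = r * v a"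
      "(\<Sum>b\<in>?C. (cmod (v b))\<^sup>2) = 1" "Im (v z) = 0"
    using eigenvector_exists[OF fin z, of H] by blast
  obtain W where W: "adj W = W" "eq_on ?C (oprod ?C W W) ident" "\<forall>b\<in>?C. W b z = v b"
    using householder[OF fin z v(2,3)] by blast
  have uW: "unitary_on ?C W" by (simp add: unitary_on_iff W)
  have herm: "cnj (H b a) = H a b" if "a \<in> ?C" "b \<in> ?C" for a b
    using insert.prems that unfolding eq_on_def adj_def by blast
  define H' where "H' = oprod ?C W (oprod ?C H W)"
  have rl: "eq_on ?C U U" for U :: "'b oper" by (simp add: eq_on_def)
  have hH': "eq_on ?C (adj H') H'"
    unfolding H'_def adj_oprod W oprod_assoc by (intro eq_on_oprod rl insert.prems)
  have col: "H' a z = r * of_bool (a = z)" if "a \<in> ?C" for a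
  proof -
    have "oprod ?C H W b z = r * W b z" if "b \<in> ?C" for b
    proof -
      have "oprod ?C H W b z = (\<Sum>c\<in>?C. H b c * v c)"
        unfolding oprod_def using W(3) by (intro sum.cong) auto
      then show ?thesis using v(1) W(3) that by auto
    qed
    then have "H' a z = r * oprod ?C W W a z"
      unfolding H'_def oprod_def[of _ W] sum_distrib_left
      by (intro sum.cong refl) (auto simp: mult.left_commute)
    moreover have "oprod ?C W W a z = of_bool (a = z)" using W(2) that z unfolding eq_on_def by blast
    ultimately show ?thesis by simp
  qed
  have rr: "cnj r = r" using hH' z col[OF z] by (auto simp: eq_on_def adj_def)
  have row: "H' z a = r * of_bool (a = z)" if "a \<in> ?C" for a
    using hH' z that col[OF that] rr by (cases "a = z") (auto simp: eq_on_def adj_def)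
  \<comment> \<open>The same kernel read on fewer labels is already the smaller block; its
    diagonalisation is later extended by the identity at \<open>z\<close>.\<close>
  have "eq_on B (adj H') H'" using hH' by (auto simp: eq_on_def)
  from insert.IH[OF this] obtain E l where E: "spectral B H' E l" by blast
  define E' where "E' a b = (if a = z \<or> b = z then of_bool (a = b) else E a b)" for a b
  define l' where "l' c = (if c = z then Re r else l c)" for c
  have r_re: "of_real (Re r) = r" using rr by (simp add: complex_eq_iff)
  have "spectral ?C H' E' l'"
    unfolding spectral_def
  proof (intro conjI ballI)
    show "unitary_on ?C E'"
      unfolding unitary_on_def
    proof (intro ballI)
      fix a b assume ab: "a \<in> ?C" "b \<in> ?C"
      have nz: "c \<noteq> z" if "c \<in> B" for c using that insert by auto
      show "oprod ?C (adj E') E' a b = of_bool (a = b) \<and> oprod ?C E' (adj E') a b = of_bool (a = b)"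
      proof (cases "a = z \<or> b = z")
        case True
        have "oprod B (adj E') E' a b = 0" "oprod B E' (adj E') a b = 0"
          unfolding oprod_def adj_def using True nz by (intro sum.neutral; auto simp: E'_def)+
        then show ?thesis using True insert(1,2) by (auto simp: E'_def oprod_def adj_def)
      next
        case False
        have "oprod B (adj E') E' a b = oprod B (adj E) E a b" "oprod B E' (adj E') a b = oprod B E (adj E) a b"
          unfolding oprod_def adj_def using False nz by (intro sum.cong; auto simp: E'_def)+
        then show ?thesis using False ab E insert(1,2)
          by (auto simp: E'_def oprod_def adj_def spectral_def unitary_on_def)
      qed
    qed
    fix a b assume ab: "a \<in> ?C" "b \<in> ?C"
    have nz: "c \<noteq> z" if "c \<in> B" for c using that insert by auto
    show "H' a b = (\<Sum>c\<in>?C. E' a c * of_real (l' c) * cnj (E' b c))"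
    proof (cases "a = z \<or> b = z")
      case True
      have "(\<Sum>c\<in>B. E' a c * of_real (l' c) * cnj (E' b c)) = 0"
        using True nz by (intro sum.neutral) (auto simp: E'_def)
      then show ?thesis using True ab row col insert(1,2) by (auto simp: E'_def l'_def r_re)
    next
      case False
      have "(\<Sum>c\<in>B. E' a c * of_real (l' c) * cnj (E' b c)) = (\<Sum>c\<in>B. E a c * of_real (l c) * cnj (E b c))"
        using False nz by (intro sum.cong) (auto simp: E'_def l'_def)
      then show ?thesis using False ab E insert(1,2) by (auto simp: E'_def l'_def spectral_def)
    qed
  qed
  moreover have "eq_on ?C H (oprod ?C W (oprod ?C H' (adj W)))"
  proof -
    have "eq_on ?C (oprod ?C (oprod ?C W W) (oprod ?C H (oprod ?C W W))) (oprod ?C ident (oprod ?C H ident))"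
      by (intro eq_on_oprod rl W(2))
    moreover have "eq_on ?C (oprod ?C ident (oprod ?C H ident)) H"
      using oprod_ident[OF fin] eq_on_trans by blast
    ultimately show ?thesis unfolding H'_def W(1) oprod_assoc using eq_on_trans eq_on_sym by blast
  qed
  ultimately show ?case using spectral_conj[OF fin uW] by blast
qed

section \<open>Entropy and Hilbert--Schmidt distance\<close>

lemma cnj_of_bool [simp]: "cnj (of_bool P) = of_bool P"
  by (simp add: of_bool_def)

lemma sum_rotate: "(\<Sum>a\<in>A. \<Sum>b\<in>B. \<Sum>c\<in>C. f a b c) = (\<Sum>c\<in>C. \<Sum>a\<in>A. \<Sum>b\<in>B. f a b c)"
  by (rule trans[OF sum.cong[OF refl sum.swap] sum.swap])

section \<open>Entropy in terms of eigenvalues\<close>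

lemma order_prod_linear:
  fixes l :: "'i \<Rightarrow> complex"
  assumes "finite I"
  shows "order r (\<Prod>i\<in>I. [:- l i, 1:]) = card {i\<in>I. l i = r}"
  using assms
proof (induction I rule: finite_induct)
  case empty
  then show ?case by (simp add: order_0I)
next
  case (insert i I)
  have ne: "(\<Prod>i\<in>insert i I. [:- l i, 1:]) \<noteq> 0" using insert(1) by simp
  have "order r (\<Prod>i\<in>insert i I. [:- l i, 1:]) = order r [:- l i, 1:] + card {i\<in>I. l i = r}"
    using order_mult[OF ne[unfolded prod.insert[OF insert(1,2)]], of r]
    by (simp only: prod.insert[OF insert(1,2)] insert.IH)
  also have "order r [:- l i, 1:] = of_bool (l i = r)"
    by (cases "l i = r") (use order_power_n_n[of r 1] in \<open>auto intro!: order_0I\<close>)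
  also have "{j\<in>insert i I. l j = r} = (if l i = r then insert i {i\<in>I. l i = r} else {i\<in>I. l i = r})" by auto
  then have "of_bool (l i = r) + card {i\<in>I. l i = r} = card {j\<in>insert i I. l j = r}"
    using insert(1,2) by simp
  finally show ?case .
qed

lemma sum_roots_linear:
  fixes l :: "'i \<Rightarrow> complex" and F :: "complex \<Rightarrow> real"
  assumes fin: "finite I"
  defines "P \<equiv> \<Prod>i\<in>I. [:- l i, 1:]"
  shows "(\<Sum>r | poly P r = 0. real (order r P) * F r) = (\<Sum>i\<in>I. F (l i))"
proof -
  have roots: "{r. poly P r = 0} = l ` I"
    unfolding P_def using fin by (auto simp: poly_prod)
  have "(\<Sum>r\<in>l ` I. real (order r P) * F r) = (\<Sum>r\<in>l ` I. \<Sum>i | i \<in> I \<and> l i = r. F (l i))"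
    unfolding P_def order_prod_linear[OF fin] by (intro sum.cong) auto
  also have "\<dots> = (\<Sum>i\<in>I. F (l i))"
    using sum.image_gen[OF fin, of "\<lambda>i. F (l i)" l] by simp
  finally show ?thesis by (simp add: roots)
qed

text \<open>Carried over to matrices by the enumeration of \<open>B\<close>, a spectral
  decomposition is a similarity to a diagonal matrix, so the characteristic polynomial splits into
  the linear factors given by \<open>l\<close>. Later entropy computations can then use any
  convenient diagonalisation.\<close>

lemma vn_entropy_spectral:
  assumes fin: "finite B" and sp: "spectral B \<rho> U l"
  shows "vn_entropy B \<rho> = - (\<Sum>c\<in>B. l c * log 2 (l c))"
proof -
  let ?n = "card B" and ?g = "from_nat_into B"
  define P where "P = mat ?n ?n (\<lambda>(i, j). U (?g i) (?g j))"
  define Q where "Q = mat ?n ?n (\<lambda>(i, j). cnj (U (?g j) (?g i)))"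
  define D where "D = mat ?n ?n (\<lambda>(i, j). of_bool (i = j) * complex_of_real (l (?g i)))"
  have [simp]: "P \<in> carrier_mat ?n ?n" "Q \<in> carrier_mat ?n ?n" "D \<in> carrier_mat ?n ?n"
    by (auto simp: P_def Q_def D_def)
  have s: "(\<Sum>k = 0..<?n. f (?g k)) = (\<Sum>b\<in>B. f b)" for f :: "'a \<Rightarrow> complex"
    using enum_sum[OF fin, of f] by (simp add: lessThan_atLeast0)
  have u: "(\<Sum>c\<in>B. cnj (U c a) * U c b) = of_bool (a = b)"
    "(\<Sum>c\<in>B. U a c * cnj (U b c)) = of_bool (a = b)" if "a \<in> B" "b \<in> B" for a b
    using sp that unfolding spectral_def unitary_on_def oprod_def adj_def by auto
  have PQ: "P * Q = 1\<^sub>m ?n"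
    by (rule eq_matI)
       (auto simp: P_def Q_def scalar_prod_def s[of "\<lambda>c. U _ c * cnj (U _ c)"] u enum_mem[OF fin] enum_inj[OF fin])
  have QP: "Q * P = 1\<^sub>m ?n"
    by (rule eq_matI)
       (auto simp: P_def Q_def scalar_prod_def s[of "\<lambda>c. cnj (U c _) * U c _"] u enum_mem[OF fin] enum_inj[OF fin])
  have PD: "P * D = mat ?n ?n (\<lambda>(i, j). U (?g i) (?g j) * of_real (l (?g j)))"
  proof (rule eq_matI; clarsimp simp: P_def D_def scalar_prod_def)
    fix i j assume "i < ?n" "j < ?n"
    have "(\<Sum>k = 0..<?n. U (?g i) (?g k) * (of_bool (k = j) * of_real (l (?g k))))
        = (\<Sum>k = 0..<?n. (U (?g i) (?g k) * of_real (l (?g k))) * of_bool (k = j))"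
      by (intro sum.cong) auto
    then show "(\<Sum>k = 0..<?n. U (?g i) (?g k) * (of_bool (k = j) * of_real (l (?g k)))) = U (?g i) (?g j) * of_real (l (?g j))"
      using \<open>j < ?n\<close> by simp
  qed
  have A: "oper_mat B \<rho> = P * D * Q"
    unfolding PD
  proof (rule eq_matI; clarsimp simp: Q_def oper_mat_def scalar_prod_def)
    fix i j assume ij: "i < ?n" "j < ?n"
    show "\<rho> (?g i) (?g j) = (\<Sum>k = 0..<?n. U (?g i) (?g k) * of_real (l (?g k)) * cnj (U (?g j) (?g k)))"
      unfolding s[of "\<lambda>c. U (?g i) c * complex_of_real (l c) * cnj (U (?g j) c)"]
      using sp ij enum_mem[OF fin] unfolding spectral_def by blast
  qed
  have "similar_mat (oper_mat B \<rho>) D"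
    by (rule similar_matI[OF _ PQ QP A]) auto
  then have "char_poly (oper_mat B \<rho>) = char_poly D" by (rule char_poly_similar)
  also have "\<dots> = (\<Prod>a\<leftarrow>diag_mat D. [:- a, 1:])"
    by (rule char_poly_upper_triangular[of _ ?n]) (auto simp: D_def upper_triangular_def)
  also have "diag_mat D = map (\<lambda>i. of_real (l (?g i))) [0..<?n]"
    by (auto simp: diag_mat_def D_def)
  also have "(\<Prod>a\<leftarrow>\<dots>. [:- a, 1:]) = (\<Prod>i\<in>{..<?n}. [:- of_real (l (?g i)), 1:])"
    by (simp add: prod.distinct_set_conv_list[symmetric] lessThan_atLeast0 comp_def)
  also have "\<dots> = (\<Prod>b\<in>B. [:- of_real (l b), 1:])"
    by (rule prod.reindex_bij_betw[OF bij_betw_from_nat_into_finite[OF fin]])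
  finally have cp: "char_poly (oper_mat B \<rho>) = (\<Prod>b\<in>B. [:- of_real (l b), 1:])" .
  show ?thesis
    unfolding vn_entropy_def cp
    using sum_roots_linear[OF fin, of "\<lambda>b. of_real (l b)" "\<lambda>r. Re r * log 2 (Re r)"] by simp
qed

lemma vn_entropy_cong: "finite B \<Longrightarrow> eq_on B \<rho> \<rho>' \<Longrightarrow> vn_entropy B \<rho> = vn_entropy B \<rho>'"
proof -
  assume "finite B" "eq_on B \<rho> \<rho>'"
  then have "oper_mat B \<rho> = oper_mat B \<rho>'"
    by (auto simp: oper_mat_def eq_on_def enum_mem)
  then show ?thesis by (simp add: vn_entropy_def)
qed

lemma spectral_eigenvalue:
  assumes sp: "spectral B \<rho> U l" and fin: "finite B" and c: "c \<in> B" "d \<in> B"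
  shows "(\<Sum>a\<in>B. \<Sum>b\<in>B. cnj (U a c) * \<rho> a b * U b d) = of_bool (c = d) * of_real (l c)"
proof -
  have u: "(\<Sum>b\<in>B. cnj (U b e) * U b e') = of_bool (e = e')" if "e \<in> B" "e' \<in> B" for e e'
    using sp that unfolding spectral_def unitary_on_def oprod_def adj_def by auto
  have "(\<Sum>a\<in>B. \<Sum>b\<in>B. cnj (U a c) * \<rho> a b * U b d)
      = (\<Sum>a\<in>B. \<Sum>b\<in>B. \<Sum>e\<in>B. of_real (l e) * ((cnj (U a c) * U a e) * (cnj (U b e) * U b d)))"
    using sp unfolding spectral_def
    by (intro sum.cong refl) (simp add: sum_distrib_left sum_distrib_right mult_ac)
  also have "\<dots> = (\<Sum>e\<in>B. \<Sum>a\<in>B. \<Sum>b\<in>B. of_real (l e) * ((cnj (U a c) * U a e) * (cnj (U b e) * U b d)))"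
    by (rule sum_rotate)
  also have "\<dots> = (\<Sum>e\<in>B. of_real (l e) * ((\<Sum>a\<in>B. cnj (U a c) * U a e) * (\<Sum>b\<in>B. cnj (U b e) * U b d)))"
    unfolding sum_product unfolding sum_distrib_left by (rule refl)
  also have "\<dots> = (\<Sum>e\<in>B. of_bool (c = e) * (of_real (l e) * of_bool (e = d)))"
    using u c by (intro sum.cong refl) auto
  also have "\<dots> = of_bool (c = d) * of_real (l c)" using fin c by simp
  finally show ?thesis .
qed

lemma psd_spectral:
  assumes fin: "finite B" and psd: "psd_on B \<rho>"
  shows "\<exists>U l. spectral B \<rho> U l \<and> (\<forall>c\<in>B. 0 \<le> l c)"
proof -
  have "eq_on B (adj \<rho>) \<rho>" using psd by (simp add: psd_on_def eq_on_def)
  then obtain U l where sp: "spectral B \<rho> U l" using hermitian_spectral[OF fin] by blast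
  have "0 \<le> l c" if "c \<in> B" for c
  proof -
    have "0 \<le> Re (\<Sum>a\<in>B. \<Sum>b\<in>B. cnj (U a c) * \<rho> a b * U b c)"
      using psd unfolding psd_on_def by (elim conjE) (drule spec[of _ "\<lambda>b. U b c"], simp)
    then show ?thesis unfolding spectral_eigenvalue[OF sp fin that that] by simp
  qed
  then show ?thesis using sp by blast
qed

lemma spectral_trace:
  assumes "finite B" and sp: "spectral B \<rho> U l"
  shows "otrace B \<rho> = of_real (\<Sum>c\<in>B. l c)"
proof -
  have u: "(\<Sum>b\<in>B. cnj (U b e) * U b e) = 1" if "e \<in> B" for e
    using sp that unfolding spectral_def unitary_on_def oprod_def adj_def by auto
  have "otrace B \<rho> = (\<Sum>a\<in>B. \<Sum>c\<in>B. of_real (l c) * (cnj (U a c) * U a c))"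
    using sp unfolding otrace_def spectral_def by (intro sum.cong) (auto simp: mult_ac)
  also have "\<dots> = (\<Sum>c\<in>B. of_real (l c) * (\<Sum>a\<in>B. cnj (U a c) * U a c))"
    by (subst sum.swap) (simp add: sum_distrib_left)
  also have "\<dots> = (\<Sum>c\<in>B. of_real (l c))" using u by (intro sum.cong) auto
  finally show ?thesis by simp
qed

section \<open>Square roots and their Hilbert-Schmidt distance\<close>

definition eigendec :: "'b set \<Rightarrow> 'b oper \<Rightarrow> 'b oper \<times> ('b \<Rightarrow> real)" where
  "eigendec B \<rho> = (SOME (U, l). spectral B \<rho> U l \<and> (\<forall>c\<in>B. 0 \<le> l c))"

text \<open>The positive square root, made a function of \<open>\<rho>\<close> by choosing one
  diagonalisation, so that bounds proved separately speak of the same root.\<close>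

definition osqrt :: "'b set \<Rightarrow> 'b oper \<Rightarrow> 'b oper" where
  "osqrt B \<rho> = (case eigendec B \<rho> of (U, l) \<Rightarrow>
     (\<lambda>a b. \<Sum>c\<in>B. U a c * of_real (sqrt (l c)) * cnj (U b c)))"

lemma osqrt_obtain:
  assumes "finite B" "psd_on B \<rho>"
  obtains U l where "spectral B \<rho> U l" "\<And>c. c \<in> B \<Longrightarrow> 0 \<le> l c"
    "osqrt B \<rho> = (\<lambda>a b. \<Sum>c\<in>B. U a c * of_real (sqrt (l c)) * cnj (U b c))"
proof -
  obtain U l where ed: "eigendec B \<rho> = (U, l)" by fastforce
  have "case eigendec B \<rho> of (U, l) \<Rightarrow> spectral B \<rho> U l \<and> (\<forall>c\<in>B. 0 \<le> l c)"
    unfolding eigendec_def using psd_spectral[OF assms]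
    by (intro someI_ex[of "\<lambda>(U, l). spectral B \<rho> U l \<and> (\<forall>c\<in>B. 0 \<le> l c)"]) simp
  then have "spectral B \<rho> U l" "\<And>c. c \<in> B \<Longrightarrow> 0 \<le> l c" by (simp_all add: ed)
  moreover have "osqrt B \<rho> = (\<lambda>a b. \<Sum>c\<in>B. U a c * of_real (sqrt (l c)) * cnj (U b c))"
    unfolding osqrt_def ed by simp
  ultimately show thesis by (rule that)
qed

definition hs_dist2 :: "'b set \<Rightarrow> 'b oper \<Rightarrow> 'b oper \<Rightarrow> real" where
  "hs_dist2 B X Y = (\<Sum>a\<in>B. \<Sum>b\<in>B. (cmod (X a b - Y a b))\<^sup>2)"

lemma hs_dist2_nonneg: "0 \<le> hs_dist2 B X Y"
  by (simp add: hs_dist2_def sum_nonneg)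

text \<open>The factor 2 is the price for staying with squared distances, which are what entropies
  control and what can be averaged.\<close>

lemma hs_dist2_triangle:
  "hs_dist2 B X Y \<le> 2 * (hs_dist2 B X Z + hs_dist2 B Y Z)"
proof -
  have "(cmod (x - y))\<^sup>2 \<le> 2 * ((cmod (x - z))\<^sup>2 + (cmod (y - z))\<^sup>2)" for x y z :: complex
  proof -
    have "cmod (x - y) \<le> cmod (x - z) + cmod (y - z)"
      using norm_triangle_ineq4[of "x - z" "y - z"] by simp
    then have "(cmod (x - y))\<^sup>2 \<le> (cmod (x - z) + cmod (y - z))\<^sup>2" by (rule power_mono) simp
    also have "\<dots> \<le> 2 * ((cmod (x - z))\<^sup>2 + (cmod (y - z))\<^sup>2)"
      using sum_squares_bound[of "cmod (x - z)" "cmod (y - z)"] by (simp add: power2_sum)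
    finally show ?thesis .
  qed
  then show ?thesis
    unfolding hs_dist2_def sum_distrib_left sum.distrib[symmetric] by (intro sum_mono) auto
qed

lemma parseval:
  assumes fin: "finite B" and U: "unitary_on B U"
  shows "(\<Sum>c\<in>B. (cmod (\<Sum>a\<in>B. cnj (U a c) * v a))\<^sup>2) = (\<Sum>a\<in>B. (cmod (v a))\<^sup>2)"
proof -
  have "complex_of_real (\<Sum>c\<in>B. (cmod (\<Sum>a\<in>B. cnj (U a c) * v a))\<^sup>2)
      = (\<Sum>c\<in>B. \<Sum>a\<in>B. \<Sum>b\<in>B. (v a * cnj (v b)) * (U b c * cnj (U a c)))"
    unfolding of_real_sum complex_norm_square
    unfolding cnj_sum sum_product by (intro sum.cong refl) simp
  also have "\<dots> = (\<Sum>a\<in>B. \<Sum>b\<in>B. \<Sum>c\<in>B. (v a * cnj (v b)) * (U b c * cnj (U a c)))"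
    by (subst sum.swap, subst (2) sum.swap, rule refl)
  also have "\<dots> = (\<Sum>a\<in>B. \<Sum>b\<in>B. (v a * cnj (v b)) * (\<Sum>c\<in>B. U b c * cnj (U a c)))"
    by (simp add: sum_distrib_left)
  also have "\<dots> = (\<Sum>a\<in>B. \<Sum>b\<in>B. (v a * cnj (v b)) * of_bool (b = a))"
    using U unfolding unitary_on_def oprod_def adj_def by (intro sum.cong refl) auto
  also have "\<dots> = (\<Sum>a\<in>B. v a * cnj (v a))" using fin by simp
  also have "\<dots> = of_real (\<Sum>a\<in>B. (cmod (v a))\<^sup>2)"
    by (simp only: of_real_sum complex_norm_square)
  finally show ?thesis using of_real_eq_iff by blast
qed

text \<open>This is \<open>ln s \<le> s - 1\<close> at \<open>s = sqrt (y / x)\<close>: the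
  pointwise reason why relative entropy dominates the squared Hellinger distance.\<close>

lemma mult_ln_ge:
  fixes x y :: real
  assumes "0 < x" "0 < y"
  shows "2 * (x - sqrt x * sqrt y) \<le> x * (ln x - ln y)"
proof -
  have "ln (sqrt y / sqrt x) \<le> sqrt y / sqrt x - 1"
    by (rule ln_le_minus_one) (use assms in simp)
  moreover have "ln (sqrt y / sqrt x) = (ln y - ln x) / 2"
    using assms by (simp add: ln_div ln_sqrt diff_divide_distrib)
  ultimately have "x * ((ln y - ln x) / 2) \<le> x * (sqrt y / sqrt x - 1)"
    using assms by (intro mult_left_mono) auto
  moreover have "x * (sqrt y / sqrt x) = sqrt x * sqrt y"
    using assms by (simp add: field_simps)
  moreover have "x * ((ln y - ln x) / 2) = - (x * (ln x - ln y)) / 2" by (simp add: algebra_simps)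
  moreover have "x * (sqrt y / sqrt x - 1) = x * (sqrt y / sqrt x) - x" by (simp add: right_diff_distrib)
  ultimately have "- (x * (ln x - ln y)) / 2 \<le> sqrt x * sqrt y - x" by (simp only:)
  then show ?thesis by (simp add: field_simps)
qed

text \<open>
  With eigenbases \<open>e\<close> of \<open>\<rho>\<close> and \<open>f\<close> of \<open>\<sigma>\<close>, the weights \<open>|\<langle>e c|f d\<rangle>|\<^sup>2\<close> turn both sides into a relative
  entropy and a squared Hellinger distance of classical (Nussbaum--Szkola) distributions on pairs \<open>(c, d)\<close>,
  which are compared pointwise by \<open>mult_ln_ge\<close>.
\<close>

lemma holevo_single:
  fixes \<rho> \<sigma> :: "'b oper"
  assumes fin: "finite B" and r: "spectral B \<rho> U l" "\<And>c. c \<in> B \<Longrightarrow> 0 \<le> l c" "(\<Sum>c\<in>B. l c) = 1"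
    and s: "spectral B \<sigma> V m" "\<And>c. c \<in> B \<Longrightarrow> 0 \<le> m c" "(\<Sum>c\<in>B. m c) = 1"
    and supp: "\<And>d. d \<in> B \<Longrightarrow> m d = 0 \<Longrightarrow> (\<Sum>a\<in>B. \<Sum>b\<in>B. cnj (V a d) * \<rho> a b * V b d) = 0"
  shows "hs_dist2 B (\<lambda>a b. \<Sum>c\<in>B. U a c * of_real (sqrt (l c)) * cnj (U b c))
           (\<lambda>a b. \<Sum>c\<in>B. V a c * of_real (sqrt (m c)) * cnj (V b c))
     \<le> (\<Sum>c\<in>B. l c * ln (l c))
         - (\<Sum>d\<in>B. Re (\<Sum>a\<in>B. \<Sum>b\<in>B. cnj (V a d) * \<rho> a b * V b d) * ln (m d))"
proof -
  have uU: "unitary_on B U" and uV: "unitary_on B V" using r(1) s(1) by (auto simp: spectral_def)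
  have dU: "(\<Sum>b\<in>B. cnj (U b e) * U b e') = of_bool (e = e')" if "e \<in> B" "e' \<in> B" for e e'
    using uU that unfolding unitary_on_def oprod_def adj_def by auto
  have dV: "(\<Sum>b\<in>B. cnj (V b e) * V b e') = of_bool (e = e')" if "e \<in> B" "e' \<in> B" for e e'
    using uV that unfolding unitary_on_def oprod_def adj_def by auto
  define G where "G c d = (\<Sum>a\<in>B. cnj (U a c) * V a d)" for c d
  define w where "w c d = (cmod (G c d))\<^sup>2" for c d
  have w0: "0 \<le> w c d" for c d by (simp add: w_def)
  have w_l: "(\<Sum>c\<in>B. w c d) = 1" if "d \<in> B" for d
  proof -
    have "complex_of_real (\<Sum>a\<in>B. (cmod (V a d))\<^sup>2) = 1"
      using dV[OF that that] by (simp only: of_real_sum complex_norm_square mult.commute) simp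
    then show ?thesis unfolding w_def G_def parseval[OF fin uU] using of_real_eq_1_iff by blast
  qed
  have Gcnj: "cnj (G c d) = (\<Sum>a\<in>B. cnj (V a d) * U a c)" for c d
    by (simp add: G_def cnj_sum mult.commute)
  have Gc: "cmod (G c d) = cmod (\<Sum>a\<in>B. cnj (V a d) * U a c)" for c d
    by (metis Gcnj complex_mod_cnj)
  have w_r: "(\<Sum>d\<in>B. w c d) = 1" if "c \<in> B" for c
  proof -
    have "complex_of_real (\<Sum>a\<in>B. (cmod (U a c))\<^sup>2) = 1"
      using dU[OF that that] by (simp only: of_real_sum complex_norm_square mult.commute) simp
    then show ?thesis unfolding w_def Gc parseval[OF fin uV] using of_real_eq_1_iff by blast
  qed
  have diag: "(\<Sum>a\<in>B. \<Sum>b\<in>B. cnj (V a d) * \<rho> a b * V b d) = of_real (\<Sum>c\<in>B. l c * w c d)" for d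
  proof -
    have "(\<Sum>a\<in>B. \<Sum>b\<in>B. cnj (V a d) * \<rho> a b * V b d)
      = (\<Sum>a\<in>B. \<Sum>b\<in>B. \<Sum>c\<in>B. of_real (l c) * ((cnj (V a d) * U a c) * (cnj (U b c) * V b d)))"
      using r(1) unfolding spectral_def
      by (intro sum.cong refl) (simp add: sum_distrib_left sum_distrib_right mult_ac)
    also have "\<dots> = (\<Sum>c\<in>B. \<Sum>a\<in>B. \<Sum>b\<in>B. of_real (l c) * ((cnj (V a d) * U a c) * (cnj (U b c) * V b d)))"
      by (rule sum_rotate)
    also have "\<dots> = (\<Sum>c\<in>B. of_real (l c) * (cnj (G c d) * G c d))"
      unfolding Gcnj unfolding G_def unfolding sum_product unfolding sum_distrib_left by (rule refl)
    also have "\<dots> = of_real (\<Sum>c\<in>B. l c * w c d)"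
      by (simp only: w_def of_real_sum of_real_mult complex_norm_square mult.commute)
    finally show ?thesis .
  qed
  let ?R = "\<lambda>a b. \<Sum>c\<in>B. U a c * complex_of_real (sqrt (l c)) * cnj (U b c)"
  let ?S = "\<lambda>a b. \<Sum>c\<in>B. V a c * complex_of_real (sqrt (m c)) * cnj (V b c)"
  let ?X = "\<lambda>b c. \<Sum>a\<in>B. cnj (U a c) * (?R a b - ?S a b)"
  \<comment> \<open>The entry of the difference of roots between the \<open>c\<close>-th eigenvector
    of \<open>\<rho>\<close> and the \<open>d\<close>-th of \<open>\<sigma>\<close>; by Parseval in
    both bases these entries determine the Hilbert-Schmidt distance.\<close>
  have entry: "(\<Sum>b\<in>B. (?X b c) * V b d)
      = of_real (sqrt (l c) - sqrt (m d)) * G c d" if cd: "c \<in> B" "d \<in> B" for c d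
  proof -
    have "(\<Sum>a\<in>B. cnj (U a c) * ?R a b) = of_real (sqrt (l c)) * cnj (U b c)" for b
    proof -
      have "(\<Sum>a\<in>B. cnj (U a c) * ?R a b) = (\<Sum>e\<in>B. (\<Sum>a\<in>B. cnj (U a c) * U a e) * (of_real (sqrt (l e)) * cnj (U b e)))"
        unfolding sum_distrib_left sum_distrib_right by (subst sum.swap) (simp add: mult.assoc)
      also have "\<dots> = (\<Sum>e\<in>B. of_bool (c = e) * (of_real (sqrt (l e)) * cnj (U b e)))"
        using dU cd by (intro sum.cong refl) auto
      finally show ?thesis using fin cd by simp
    qed
    moreover have "(\<Sum>b\<in>B. ?S a b * V b d) = V a d * of_real (sqrt (m d))" for a
    proof -
      have "(\<Sum>b\<in>B. ?S a b * V b d) = (\<Sum>e\<in>B. (V a e * of_real (sqrt (m e))) * (\<Sum>b\<in>B. cnj (V b e) * V b d))"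
        unfolding sum_distrib_left sum_distrib_right by (subst sum.swap) (simp add: mult.assoc)
      also have "\<dots> = (\<Sum>e\<in>B. (V a e * of_real (sqrt (m e))) * of_bool (e = d))"
        using dV cd by (intro sum.cong refl) auto
      finally show ?thesis using fin cd by simp
    qed
    moreover have "(\<Sum>b\<in>B. (?X b c) * V b d)
        = (\<Sum>b\<in>B. (\<Sum>a\<in>B. cnj (U a c) * ?R a b) * V b d) - (\<Sum>a\<in>B. cnj (U a c) * (\<Sum>b\<in>B. ?S a b * V b d))"
    proof -
      have "(\<Sum>a\<in>B. cnj (U a c) * (\<Sum>b\<in>B. ?S a b * V b d)) = (\<Sum>b\<in>B. (\<Sum>a\<in>B. cnj (U a c) * ?S a b) * V b d)"
        unfolding sum_distrib_left[of _ _ B] sum_distrib_right[of _ B]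
        by (subst sum.swap) (simp add: mult.assoc)
      then show ?thesis by (simp add: right_diff_distrib sum_subtractf left_diff_distrib)
    qed
    ultimately show ?thesis
      by (simp add: G_def sum_distrib_left left_diff_distrib right_diff_distrib sum_subtractf mult_ac)
  qed
  have hs: "hs_dist2 B ?R ?S = (\<Sum>c\<in>B. \<Sum>d\<in>B. (sqrt (l c) - sqrt (m d))\<^sup>2 * w c d)"
  proof -
    have "hs_dist2 B ?R ?S = (\<Sum>b\<in>B. \<Sum>a\<in>B. (cmod (?R a b - ?S a b))\<^sup>2)"
      unfolding hs_dist2_def by (rule sum.swap)
    also have "\<dots> = (\<Sum>b\<in>B. \<Sum>c\<in>B. (cmod (?X b c))\<^sup>2)"
      by (intro sum.cong refl parseval[OF fin uU, symmetric])
    also have "\<dots> = (\<Sum>c\<in>B. \<Sum>b\<in>B. (cmod (cnj (?X b c)))\<^sup>2)"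
      by (subst sum.swap) (simp only: complex_mod_cnj)
    also have "\<dots> = (\<Sum>c\<in>B. \<Sum>d\<in>B. (cmod (\<Sum>b\<in>B. cnj (V b d) * cnj (?X b c)))\<^sup>2)"
      by (intro sum.cong refl parseval[OF fin uV, symmetric])
    also have "\<dots> = (\<Sum>c\<in>B. \<Sum>d\<in>B. (cmod (\<Sum>b\<in>B. (?X b c) * V b d))\<^sup>2)"
    proof -
      have "cmod (\<Sum>b\<in>B. cnj (V b d) * cnj (g b)) = cmod (\<Sum>b\<in>B. g b * V b d)" for g d
      proof -
        have "(\<Sum>b\<in>B. cnj (V b d) * cnj (g b)) = cnj (\<Sum>b\<in>B. g b * V b d)"
          by (simp add: cnj_sum mult.commute)
        then show ?thesis by (metis complex_mod_cnj)
      qed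
      then show ?thesis by (simp only:)
    qed
    also have "\<dots> = (\<Sum>c\<in>B. \<Sum>d\<in>B. (sqrt (l c) - sqrt (m d))\<^sup>2 * w c d)"
      by (intro sum.cong refl) (simp only: entry norm_mult power_mult_distrib w_def norm_of_real power2_abs)
    finally show ?thesis .
  qed
  \<comment> \<open>The first summand on the right cancels in total, since both distributions have
    mass 1.\<close>
  have pointwise: "(sqrt (l c) - sqrt (m d))\<^sup>2 * w c d \<le> w c d * (m d - l c) + (l c * w c d) * (ln (l c) - ln (m d))"
    if cd: "c \<in> B" "d \<in> B" for c d
  proof (cases "l c = 0")
    case True
    then show ?thesis using s(2)[OF cd(2)] by simp
  next
    case l: False
    show ?thesis
    proof (cases "m d = 0")
      case True
      \<comment> \<open>Since \<open>ln 0 = 0\<close> here, an infinite relative entropy would go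
        unnoticed; the support hypothesis forces the mass of \<open>\<rho>\<close> on the kernel of
        \<open>\<sigma>\<close> to vanish.\<close>
      have "(\<Sum>c\<in>B. l c * w c d) = 0"
        using supp[OF cd(2) True] unfolding diag using of_real_eq_0_iff by blast
      then have "l c * w c d = 0"
        using r(2) w0 fin cd(1) by (subst (asm) sum_nonneg_eq_0_iff) auto
      then show ?thesis using l by simp
    next
      case False
      have p: "0 < l c" "0 < m d" using l False r(2)[OF cd(1)] s(2)[OF cd(2)] by linarith+
      have "(sqrt (l c) - sqrt (m d))\<^sup>2 = (m d - l c) + 2 * (l c - sqrt (l c) * sqrt (m d))"
        using p by (simp add: power2_diff)
      also have "\<dots> \<le> (m d - l c) + l c * (ln (l c) - ln (m d))"
        using mult_ln_ge[OF p] by simp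
      finally have "w c d * (sqrt (l c) - sqrt (m d))\<^sup>2 \<le> w c d * ((m d - l c) + l c * (ln (l c) - ln (m d)))"
        using w0 by (rule mult_left_mono)
      then show ?thesis by (simp add: algebra_simps)
    qed
  qed
  have "hs_dist2 B ?R ?S \<le> (\<Sum>c\<in>B. \<Sum>d\<in>B. w c d * (m d - l c) + (l c * w c d) * (ln (l c) - ln (m d)))"
    unfolding hs by (intro sum_mono pointwise)
  also have "\<dots> = (\<Sum>c\<in>B. \<Sum>d\<in>B. m d * w c d) - (\<Sum>c\<in>B. \<Sum>d\<in>B. l c * w c d)
      + (\<Sum>c\<in>B. \<Sum>d\<in>B. (l c * ln (l c)) * w c d) - (\<Sum>c\<in>B. \<Sum>d\<in>B. (l c * w c d) * ln (m d))"
    by (simp add: sum.distrib sum_subtractf algebra_simps)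
  also have "(\<Sum>c\<in>B. \<Sum>d\<in>B. m d * w c d) = 1"
    by (subst sum.swap) (simp add: sum_distrib_left[symmetric] w_l s(3))
  also have "(\<Sum>c\<in>B. \<Sum>d\<in>B. l c * w c d) = 1"
    by (simp add: sum_distrib_left[symmetric] w_r r(3))
  also have "(\<Sum>c\<in>B. \<Sum>d\<in>B. (l c * ln (l c)) * w c d) = (\<Sum>c\<in>B. l c * ln (l c))"
    by (simp add: sum_distrib_left[symmetric] w_r)
  also have "(\<Sum>c\<in>B. \<Sum>d\<in>B. (l c * w c d) * ln (m d)) = (\<Sum>d\<in>B. (\<Sum>c\<in>B. l c * w c d) * ln (m d))"
    by (subst sum.swap) (simp add: sum_distrib_right)
  finally show ?thesis unfolding diag by simp
qed

section \<open>Holevo information of ensembles\<close>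

lemma psd_on_sum:
  assumes "\<And>i. i \<in> I \<Longrightarrow> 0 \<le> p i" "\<And>i. i \<in> I \<Longrightarrow> psd_on B (\<rho> i)"
  shows "psd_on B (\<lambda>a b. \<Sum>i\<in>I. of_real (p i) * \<rho> i a b)"
  unfolding psd_on_def
proof (intro conjI ballI allI)
  fix a b assume "a \<in> B" "b \<in> B"
  then have "cnj (\<rho> i b a) = \<rho> i a b" if "i \<in> I" for i
    using assms(2)[OF that] by (simp add: psd_on_def adj_def)
  then show "adj (\<lambda>a b. \<Sum>i\<in>I. of_real (p i) * \<rho> i a b) a b = (\<Sum>i\<in>I. of_real (p i) * \<rho> i a b)"
    by (simp add: adj_def cnj_sum cong: sum.cong)
next
  fix v :: "'b \<Rightarrow> complex"
  let ?q = "\<Sum>a\<in>B. \<Sum>b\<in>B. cnj (v a) * (\<Sum>i\<in>I. complex_of_real (p i) * \<rho> i a b) * v b"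
  have "?q
      = (\<Sum>i\<in>I. of_real (p i) * (\<Sum>a\<in>B. \<Sum>b\<in>B. cnj (v a) * \<rho> i a b * v b))"
    unfolding sum_distrib_left sum_distrib_right
    by (subst sum_rotate) (intro sum.cong refl, simp add: mult_ac)
  then have "Re ?q
      = (\<Sum>i\<in>I. p i * Re (\<Sum>a\<in>B. \<Sum>b\<in>B. cnj (v a) * \<rho> i a b * v b))" by simp
  also have "\<dots> \<ge> 0" using assms by (intro sum_nonneg mult_nonneg_nonneg) (auto simp: psd_on_def)
  finally show "0 \<le> Re ?q" .
qed

text \<open>The Holevo quantity is the average relative entropy of the members to their mean:
  because \<open>\<sigma>\<close> is the mean, the terms with its logarithm recombine into its
  entropy. The factor \<open>ln 2\<close> converts bits to natural units.\<close>

lemma holevo_hs_bound: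
  fixes \<rho> :: "'i \<Rightarrow> 'b oper"
  assumes fin: "finite B" "finite I" and p: "\<And>i. i \<in> I \<Longrightarrow> 0 \<le> p i" "(\<Sum>i\<in>I. p i) = 1"
    and psd: "\<And>i. i \<in> I \<Longrightarrow> psd_on B (\<rho> i)" and tr: "\<And>i. i \<in> I \<Longrightarrow> otrace B (\<rho> i) = 1"
  defines "\<sigma> \<equiv> (\<lambda>a b. \<Sum>i\<in>I. of_real (p i) * \<rho> i a b)"
  shows "(\<Sum>i\<in>I. p i * hs_dist2 B (osqrt B (\<rho> i)) (osqrt B \<sigma>))
      \<le> ln 2 * (vn_entropy B \<sigma> - (\<Sum>i\<in>I. p i * vn_entropy B (\<rho> i)))"
proof -
  have psdS: "psd_on B \<sigma>" unfolding \<sigma>_def by (rule psd_on_sum) (use p psd in auto)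
  obtain V m where s: "spectral B \<sigma> V m" "\<And>c. c \<in> B \<Longrightarrow> 0 \<le> m c"
    "osqrt B \<sigma> = (\<lambda>a b. \<Sum>c\<in>B. V a c * of_real (sqrt (m c)) * cnj (V b c))"
    using osqrt_obtain[OF fin(1) psdS] by blast
  have "otrace B \<sigma> = (\<Sum>i\<in>I. of_real (p i) * otrace B (\<rho> i))"
    unfolding otrace_def \<sigma>_def sum_distrib_left by (rule sum.swap)
  also have "\<dots> = of_real (\<Sum>i\<in>I. p i)" using tr by simp
  finally have ms: "(\<Sum>c\<in>B. m c) = 1"
    unfolding spectral_trace[OF fin(1) s(1)] p(2) using of_real_eq_1_iff by (metis of_real_1)
  define D where "D i d = (\<Sum>a\<in>B. \<Sum>b\<in>B. cnj (V a d) * \<rho> i a b * V b d)" for i d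
  have D0: "0 \<le> Re (D i d)" if "i \<in> I" for i d
    using psd[OF that] unfolding psd_on_def D_def by (elim conjE) (drule spec[of _ "\<lambda>b. V b d"], simp)
  have mD: "m d = (\<Sum>i\<in>I. p i * Re (D i d))" if "d \<in> B" for d
  proof -
    have "complex_of_real (m d) = (\<Sum>a\<in>B. \<Sum>b\<in>B. cnj (V a d) * \<sigma> a b * V b d)"
      using spectral_eigenvalue[OF s(1) fin(1) that that] by simp
    also have "\<dots> = (\<Sum>i\<in>I. of_real (p i) * D i d)"
      unfolding \<sigma>_def D_def sum_distrib_left sum_distrib_right
      by (subst sum_rotate) (intro sum.cong refl, simp add: mult_ac)
    finally have "Re (of_real (m d)) = Re (\<Sum>i\<in>I. of_real (p i) * D i d)" by (rule arg_cong)
    then show ?thesis by simp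
  qed
  have single: "p i * hs_dist2 B (osqrt B (\<rho> i)) (osqrt B \<sigma>)
      \<le> p i * (- ln 2 * vn_entropy B (\<rho> i) - (\<Sum>d\<in>B. Re (D i d) * ln (m d)))" if i: "i \<in> I" for i
  \<comment> \<open>Only members of positive weight have their support inside that of the
    mean.\<close>
  proof (cases "p i = 0")
    case False
    obtain U l where r: "spectral B (\<rho> i) U l" "\<And>c. c \<in> B \<Longrightarrow> 0 \<le> l c"
      "osqrt B (\<rho> i) = (\<lambda>a b. \<Sum>c\<in>B. U a c * of_real (sqrt (l c)) * cnj (U b c))"
      using osqrt_obtain[OF fin(1) psd[OF i]] by blast
    have ls: "(\<Sum>c\<in>B. l c) = 1"
      using tr[OF i] unfolding spectral_trace[OF fin(1) r(1)] using of_real_eq_1_iff by blast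
    have hD: "cnj (D i d) = D i d" if "d \<in> B" for d
    proof -
      have "cnj (D i d) = (\<Sum>a\<in>B. \<Sum>b\<in>B. cnj (V b d) * \<rho> i b a * V a d)"
        unfolding D_def cnj_sum
      proof (intro sum.cong refl)
        fix a b assume "a \<in> B" "b \<in> B"
        then have "cnj (\<rho> i a b) = \<rho> i b a" using psd[OF i] by (simp add: psd_on_def adj_def)
        then show "cnj (cnj (V a d) * \<rho> i a b * V b d) = cnj (V b d) * \<rho> i b a * V a d" by simp
      qed
      also have "\<dots> = D i d" unfolding D_def by (rule sum.swap)
      finally show ?thesis .
    qed
    have supp: "D i d = 0" if d: "d \<in> B" "m d = 0" for d
    proof -
      have "(\<Sum>i\<in>I. p i * Re (D i d)) = 0" using mD[OF d(1)] d(2) by simp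
      then have "p i * Re (D i d) = 0"
        using sum_nonneg_eq_0_iff[of I "\<lambda>i. p i * Re (D i d)"] fin(2) i p(1) D0 by simp
      then show ?thesis using hD[OF d(1)] False by (simp add: complex_eq_iff)
    qed
    have "ln 2 * (- vn_entropy B (\<rho> i)) = (\<Sum>c\<in>B. l c * ln (l c))"
      unfolding vn_entropy_spectral[OF fin(1) r(1)] by (simp add: log_def sum_distrib_left)
    moreover have "hs_dist2 B (osqrt B (\<rho> i)) (osqrt B \<sigma>)
        \<le> (\<Sum>c\<in>B. l c * ln (l c)) - (\<Sum>d\<in>B. Re (D i d) * ln (m d))"
      unfolding r(3) s(3) D_def
      by (rule holevo_single[OF fin(1) r(1,2) ls s(1,2) ms]) (use supp in \<open>auto simp: D_def\<close>)
    ultimately show ?thesis using p(1)[OF i] by (intro mult_left_mono) auto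
  qed simp
  have "(\<Sum>i\<in>I. p i * hs_dist2 B (osqrt B (\<rho> i)) (osqrt B \<sigma>))
      \<le> (\<Sum>i\<in>I. p i * (- ln 2 * vn_entropy B (\<rho> i) - (\<Sum>d\<in>B. Re (D i d) * ln (m d))))"
    by (intro sum_mono single)
  also have "\<dots> = - ln 2 * (\<Sum>i\<in>I. p i * vn_entropy B (\<rho> i)) - (\<Sum>i\<in>I. \<Sum>d\<in>B. p i * Re (D i d) * ln (m d))"
    by (simp add: right_diff_distrib sum_subtractf sum_distrib_left sum_negf mult_ac)
  also have "(\<Sum>i\<in>I. \<Sum>d\<in>B. p i * Re (D i d) * ln (m d)) = (\<Sum>d\<in>B. m d * ln (m d))"
    by (subst sum.swap) (simp add: mD sum_distrib_right)
  also have "\<dots> = - ln 2 * vn_entropy B \<sigma>"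
    unfolding vn_entropy_spectral[OF fin(1) s(1)] by (simp add: log_def sum_distrib_left sum_negf)
  finally show ?thesis by (simp add: right_diff_distrib)
qed

text \<open>A classical first system makes the joint operator block diagonal. Its eigenvalues are
  the products \<open>p x * l x c\<close>, so the joint entropy is that of \<open>p\<close> plus the
  average entropy of the blocks, and the entropy of \<open>p\<close> cancels.\<close>

lemma mutual_info_classical_quantum:
  fixes \<rho> :: "'a \<Rightarrow> 'b oper"
  assumes fin: "finite X" "finite B" and p: "\<And>x. x \<in> X \<Longrightarrow> 0 \<le> p x"
    and psd: "\<And>x. x \<in> X \<Longrightarrow> psd_on B (\<rho> x)" and tr: "\<And>x. x \<in> X \<Longrightarrow> otrace B (\<rho> x) = 1"
    and \<omega>: "\<And>x b x' b'. x \<in> X \<Longrightarrow> b \<in> B \<Longrightarrow> x' \<in> X \<Longrightarrow> b' \<in> B \<Longrightarrow>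
              \<omega> (x, b) (x', b') = of_bool (x = x') * of_real (p x) * \<rho> x b b'"
  shows "mutual_info X B \<omega> = vn_entropy B (\<lambda>b b'. \<Sum>x\<in>X. of_real (p x) * \<rho> x b b')
           - (\<Sum>x\<in>X. p x * vn_entropy B (\<rho> x))"
proof -
  have "\<forall>x. \<exists>U l. x \<in> X \<longrightarrow> spectral B (\<rho> x) U l \<and> (\<forall>c\<in>B. 0 \<le> l c)"
    using psd_spectral[OF fin(2) psd] by blast
  then obtain U l where sp: "\<And>x. x \<in> X \<Longrightarrow> spectral B (\<rho> x) (U x) (l x)"
      and l0: "\<And>x c. x \<in> X \<Longrightarrow> c \<in> B \<Longrightarrow> 0 \<le> l x c"
    by metis
  have ls: "(\<Sum>c\<in>B. l x c) = 1" if "x \<in> X" for x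
    using tr[OF that] unfolding spectral_trace[OF fin(2) sp[OF that]] using of_real_eq_1_iff by blast
  have "spectral X (ptrace_snd B \<omega>) ident p"
    unfolding spectral_def
  proof (intro conjI ballI)
    show "unitary_on X ident" using fin by (simp add: unitary_on_def oprod_def adj_def)
    fix x x' assume x: "x \<in> X" "x' \<in> X"
    have "ptrace_snd B \<omega> x x' = of_bool (x = x') * of_real (p x) * otrace B (\<rho> x)"
      unfolding ptrace_snd_def otrace_def sum_distrib_left using x \<omega> by (intro sum.cong) auto
    then show "ptrace_snd B \<omega> x x' = (\<Sum>c\<in>X. of_bool (x = c) * of_real (p c) * cnj (of_bool (x' = c)))"
      using tr x fin by (simp add: mult.assoc)
  qed
  from vn_entropy_spectral[OF fin(1) this]
  have 1: "vn_entropy X (ptrace_snd B \<omega>) = - (\<Sum>x\<in>X. p x * log 2 (p x))" .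
  have 2: "vn_entropy B (ptrace_fst X \<omega>) = vn_entropy B (\<lambda>b b'. \<Sum>x\<in>X. of_real (p x) * \<rho> x b b')"
    by (rule vn_entropy_cong[OF fin(2)]) (use \<omega> in \<open>auto simp: eq_on_def ptrace_fst_def intro!: sum.cong\<close>)
  let ?U = "\<lambda>(x, b) (y, c). of_bool (x = y) * U x b c"
  have fin2: "finite (X \<times> B)" using fin by simp
  have u: "(\<Sum>b\<in>B. cnj (U x b e) * U x b e') = of_bool (e = e')"
      "(\<Sum>c\<in>B. U x e c * cnj (U x e' c)) = of_bool (e = e')" if "x \<in> X" "e \<in> B" "e' \<in> B" for x e e'
    using sp[OF that(1)] that unfolding spectral_def unitary_on_def oprod_def adj_def by auto
  have "spectral (X \<times> B) \<omega> ?U (\<lambda>(x, c). p x * l x c)"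
    unfolding spectral_def
  proof (intro conjI ballI)
    show "unitary_on (X \<times> B) ?U"
      unfolding unitary_on_def
    proof (intro ballI)
      fix a a' assume "a \<in> X \<times> B" "a' \<in> X \<times> B"
      then obtain x b y c where *: "a = (x, b)" "a' = (y, c)" "x \<in> X" "b \<in> B" "y \<in> X" "c \<in> B" by auto
      have "oprod (X \<times> B) (adj ?U) ?U a a'
         = (\<Sum>i\<in>X. of_bool (i = x) * (of_bool (i = y) * (\<Sum>j\<in>B. cnj (U i j b) * U i j c)))"
        unfolding * oprod_def adj_def by (simp add: sum_distrib_left mult_ac sum.cartesian_product')
      moreover have "oprod (X \<times> B) ?U (adj ?U) a a'
         = (\<Sum>i\<in>X. of_bool (x = i) * (of_bool (y = i) * (\<Sum>j\<in>B. U x b j * cnj (U y c j))))"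
        unfolding * oprod_def adj_def by (simp add: sum_distrib_left mult_ac sum.cartesian_product')
      ultimately show "oprod (X \<times> B) (adj ?U) ?U a a' = of_bool (a = a') \<and> oprod (X \<times> B) ?U (adj ?U) a a' = of_bool (a = a')"
        using * fin u by (cases "x = y") simp_all
    qed
  next
    fix a a' assume "a \<in> X \<times> B" "a' \<in> X \<times> B"
    then obtain x b x' b' where a: "a = (x, b)" "a' = (x', b')" "x \<in> X" "b \<in> B" "x' \<in> X" "b' \<in> B" by auto
    have "(\<Sum>c\<in>X \<times> B. ?U a c * of_real ((\<lambda>(x, c). p x * l x c) c) * cnj (?U a' c))
        = (\<Sum>y\<in>X. of_bool (x = y) * (of_bool (x' = y) * of_real (p y) * (\<Sum>c\<in>B. U x b c * of_real (l y c) * cnj (U x' b' c))))"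
      unfolding a by (simp add: sum_distrib_left mult_ac sum.cartesian_product')
    also have "\<dots> = of_bool (x' = x) * of_real (p x) * (\<Sum>c\<in>B. U x b c * of_real (l x c) * cnj (U x' b' c))"
      using a fin by simp
    also have "\<dots> = \<omega> a a'"
      using sp[OF a(3)] a unfolding a(1,2) \<omega>[OF a(3-6)] spectral_def by (auto simp: of_bool_def)
    finally show "\<omega> a a' = (\<Sum>c\<in>X \<times> B. ?U a c * of_real ((\<lambda>(x, c). p x * l x c) c) * cnj (?U a' c))"
      by simp
  qed
  from vn_entropy_spectral[OF fin2 this]
  have "vn_entropy (X \<times> B) \<omega> = - (\<Sum>x\<in>X. \<Sum>c\<in>B. (p x * l x c) * log 2 (p x * l x c))"
    by (simp add: sum.cartesian_product')
  also have "(\<Sum>x\<in>X. \<Sum>c\<in>B. (p x * l x c) * log 2 (p x * l x c))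
      = (\<Sum>x\<in>X. p x * log 2 (p x) + p x * (\<Sum>c\<in>B. l x c * log 2 (l x c)))"
  proof (rule sum.cong[OF refl])
    fix x assume x: "x \<in> X"
    have "(\<Sum>c\<in>B. (p x * l x c) * log 2 (p x * l x c))
        = (\<Sum>c\<in>B. (p x * log 2 (p x)) * l x c + p x * (l x c * log 2 (l x c)))"
    proof (rule sum.cong[OF refl])
      fix c assume c: "c \<in> B"
      show "(p x * l x c) * log 2 (p x * l x c) = (p x * log 2 (p x)) * l x c + p x * (l x c * log 2 (l x c))"
      \<comment> \<open>The logarithm splits over the product only for positive factors; otherwise
        both sides are zero.\<close>
      proof (cases "p x = 0 \<or> l x c = 0")
        case False
        then have "0 < p x" "0 < l x c" using p[OF x] l0[OF x c] by auto
        then show ?thesis by (simp add: log_mult algebra_simps)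
      qed auto
    qed
    also have "\<dots> = p x * log 2 (p x) + p x * (\<Sum>c\<in>B. l x c * log 2 (l x c))"
      by (simp add: sum.distrib ls[OF x] flip: sum_distrib_left)
    finally show "(\<Sum>c\<in>B. (p x * l x c) * log 2 (p x * l x c)) = \<dots>" .
  qed
  also have "\<dots> = (\<Sum>x\<in>X. p x * log 2 (p x)) - (\<Sum>x\<in>X. p x * vn_entropy B (\<rho> x))"
    using vn_entropy_spectral[OF fin(2) sp] by (simp add: sum.distrib sum_negf flip: sum_subtractf)
  finally show ?thesis unfolding mutual_info_def 1 2 by simp
qed

section \<open>Canonical purifications\<close>

text \<open>The completeness relation of Kraus operators: writing the outcome \<open>m\<close> into
  an additional register yields an isometry.\<close>

definition isometric :: "'m set \<Rightarrow> 'a set \<Rightarrow> ('m \<Rightarrow> 'a oper) \<Rightarrow> bool" where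
  "isometric M A k \<longleftrightarrow>
     (\<forall>a\<in>A. \<forall>b\<in>A. (\<Sum>m\<in>M. \<Sum>c\<in>A. cnj (k m c a) * k m c b) = of_bool (a = b))"

definition marginal :: "'a set \<Rightarrow> ('a \<Rightarrow> 'b \<Rightarrow> complex) \<Rightarrow> 'b oper" where
  "marginal A \<phi> = (\<lambda>b b'. \<Sum>a\<in>A. \<phi> a b * cnj (\<phi> a b'))"

text \<open>
  Kraus operators of an isometry that resets \<open>A\<close> to \<open>a0\<close> and creates the canonical purification of the marginal of
  \<open>\<phi>\<close> on \<open>B\<close> between \<open>B\<close> and the outcome register; \<open>None\<close> projects onto the complement of the support of \<open>\<phi>\<close> in \<open>A\<close>.
\<close>

definition canonical_kraus ::
  "'a set \<Rightarrow> 'b set \<Rightarrow> 'a \<Rightarrow> ('a \<Rightarrow> 'b \<Rightarrow> complex) \<Rightarrow> ('b option \<Rightarrow> 'a oper) \<Rightarrow> bool" where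
  "canonical_kraus A B a0 \<phi> k \<longleftrightarrow> isometric (insert None (Some ` B)) A k \<and>
     (\<forall>a\<in>A. \<forall>b\<in>B. (\<Sum>a'\<in>A. k None a a' * \<phi> a' b) = 0 \<and>
        (\<forall>b'\<in>B. (\<Sum>a'\<in>A. k (Some b') a a' * \<phi> a' b) = of_bool (a = a0) * osqrt B (marginal A \<phi>) b b'))"

lemma marginal_form:
  "(\<Sum>b\<in>B. \<Sum>b'\<in>B. u b * marginal A \<phi> b b' * v b') = (\<Sum>a\<in>A. (\<Sum>b\<in>B. u b * \<phi> a b) * (\<Sum>b\<in>B. v b * cnj (\<phi> a b)))"
proof -
  have "(\<Sum>b\<in>B. \<Sum>b'\<in>B. u b * marginal A \<phi> b b' * v b')
      = (\<Sum>b\<in>B. \<Sum>b'\<in>B. \<Sum>a\<in>A. (u b * \<phi> a b) * (v b' * cnj (\<phi> a b')))"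
    unfolding marginal_def sum_distrib_left sum_distrib_right by (intro sum.cong refl) (simp add: mult_ac)
  also have "\<dots> = (\<Sum>a\<in>A. \<Sum>b\<in>B. \<Sum>b'\<in>B. (u b * \<phi> a b) * (v b' * cnj (\<phi> a b')))"
    by (rule sum_rotate)
  also have "\<dots> = (\<Sum>a\<in>A. (\<Sum>b\<in>B. u b * \<phi> a b) * (\<Sum>b\<in>B. v b * cnj (\<phi> a b)))"
    unfolding sum_product ..
  finally show ?thesis .
qed

lemma psd_marginal: "psd_on B (marginal A \<phi>)"
  unfolding psd_on_def
proof (intro conjI ballI allI)
  fix a b
  show "adj (marginal A \<phi>) a b = marginal A \<phi> a b"
    by (simp add: adj_def marginal_def cnj_sum mult.commute)
next
  fix v :: "'a \<Rightarrow> complex"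
  have "(\<Sum>b\<in>B. v b * cnj (\<phi> a b)) = cnj (\<Sum>b\<in>B. cnj (v b) * \<phi> a b)" for a
    by (simp add: cnj_sum)
  then have "(\<Sum>a\<in>B. \<Sum>b\<in>B. cnj (v a) * marginal A \<phi> a b * v b)
      = (\<Sum>a\<in>A. (\<Sum>b\<in>B. cnj (v b) * \<phi> a b) * cnj (\<Sum>b\<in>B. cnj (v b) * \<phi> a b))"
    unfolding marginal_form by simp
  also have "Re \<dots> \<ge> 0" unfolding Re_sum by (intro sum_nonneg) (simp only: complex_mult_cnj, simp)
  finally show "0 \<le> Re (\<Sum>a\<in>B. \<Sum>b\<in>B. cnj (v a) * marginal A \<phi> a b * v b)" .
qed

text \<open>Schmidt decomposition: \<open>\<phi>\<close> is the sum of \<open>sqrt (l c)\<close>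
  times \<open>f c\<close> on \<open>A\<close> and the eigenvector \<open>U _ c\<close> on
  \<open>B\<close>. Replacing each \<open>f c\<close> by the complex conjugate of
  \<open>U _ c\<close>, stored in the outcome register, produces exactly the kernel of the square
  root.\<close>

lemma canonical_kraus_exists:
  fixes \<phi> :: "'a \<Rightarrow> 'b \<Rightarrow> complex"
  assumes finA: "finite A" and finB: "finite B" and a0: "a0 \<in> A"
  shows "\<exists>k. canonical_kraus A B a0 \<phi> k"
proof -
  let ?\<rho> = "marginal A \<phi>"
  obtain U l where sp: "spectral B ?\<rho> U l" and l0: "\<And>c. c \<in> B \<Longrightarrow> 0 \<le> l c"
    and sq: "osqrt B ?\<rho> = (\<lambda>a b. \<Sum>c\<in>B. U a c * of_real (sqrt (l c)) * cnj (U b c))"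
    using osqrt_obtain[OF finB psd_marginal] by blast
  have uc: "(\<Sum>b\<in>B. cnj (U b c) * U b d) = of_bool (c = d)"
    and ur: "(\<Sum>e\<in>B. U c e * cnj (U d e)) = of_bool (c = d)" if "c \<in> B" "d \<in> B" for c d
    using sp that unfolding spectral_def unitary_on_def oprod_def adj_def by auto
  define g where "g c a = (\<Sum>b\<in>B. cnj (U b c) * \<phi> a b)" for c a
  have gcnj: "cnj (g c a) = (\<Sum>b\<in>B. U b c * cnj (\<phi> a b))" for c a
    by (simp add: g_def cnj_sum)
  have gg: "(\<Sum>a\<in>A. g c a * cnj (g d a)) = of_bool (c = d) * of_real (l c)" if "c \<in> B" "d \<in> B" for c d
    using spectral_eigenvalue[OF sp finB that] unfolding marginal_form gcnj unfolding g_def .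
  have g0: "g c a = 0" if "c \<in> B" "l c = 0" "a \<in> A" for c a
  proof -
    have "complex_of_real (\<Sum>a\<in>A. (cmod (g c a))\<^sup>2) = 0"
      using gg[OF that(1,1)] that(2) by (simp only: of_real_sum complex_norm_square) simp
    then have "(\<Sum>a\<in>A. (cmod (g c a))\<^sup>2) = 0" using of_real_eq_0_iff by blast
    then show ?thesis using finA that(3) by (simp add: sum_nonneg_eq_0_iff)
  qed
  \<comment> \<open>Division by zero gives \<open>f c = 0\<close> for a zero eigenvalue, so the
    \<open>f c\<close> are orthonormal over the support and zero elsewhere.\<close>
  define f where "f c a = g c a / complex_of_real (sqrt (l c))" for c a
  have gf: "g c a = of_real (sqrt (l c)) * f c a" if "c \<in> B" "a \<in> A" for c a
    using g0[OF that(1) _ that(2)] by (auto simp: f_def)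
  have ff: "(\<Sum>a\<in>A. cnj (f c a) * f d a) = of_bool (c = d) * of_bool (l c \<noteq> 0)" if cd: "c \<in> B" "d \<in> B" for c d
  proof -
    have "(\<Sum>a\<in>A. cnj (f c a) * f d a) = (\<Sum>a\<in>A. g d a * cnj (g c a)) / (of_real (sqrt (l c)) * of_real (sqrt (l d)))"
      by (simp add: f_def sum_divide_distrib mult_ac)
    also have "\<dots> = of_bool (d = c) * of_real (l d) / of_real (sqrt (l c) * sqrt (l d))"
      using gg cd by simp
    also have "\<dots> = of_bool (c = d) * of_bool (l c \<noteq> 0)"
      using l0[OF cd(1)] by (auto simp: of_bool_def simp flip: of_real_mult)
    finally show ?thesis .
  qed
  have phi: "\<phi> a b = (\<Sum>c\<in>B. U b c * of_real (sqrt (l c)) * f c a)" if "a \<in> A" "b \<in> B" for a b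
  proof -
    have "(\<Sum>c\<in>B. U b c * of_real (sqrt (l c)) * f c a) = (\<Sum>c\<in>B. U b c * g c a)"
      using gf that by (intro sum.cong) (auto simp: mult.assoc)
    also have "\<dots> = (\<Sum>c\<in>B. \<Sum>e\<in>B. U b c * (cnj (U e c) * \<phi> a e))"
      by (simp add: g_def sum_distrib_left)
    also have "\<dots> = (\<Sum>e\<in>B. (\<Sum>c\<in>B. U b c * cnj (U e c)) * \<phi> a e)"
      by (subst sum.swap) (simp add: sum_distrib_right mult.assoc)
    also have "\<dots> = (\<Sum>e\<in>B. of_bool (b = e) * \<phi> a e)" using ur that by (intro sum.cong) auto
    finally show ?thesis using finB that by simp
  qed
  have f_phi: "(\<Sum>a\<in>A. cnj (f c a) * \<phi> a b) = U b c * of_real (sqrt (l c))" if cb: "c \<in> B" "b \<in> B" for c b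
  proof -
    have "(\<Sum>a\<in>A. cnj (f c a) * \<phi> a b) = (\<Sum>a\<in>A. \<Sum>d\<in>B. (U b d * of_real (sqrt (l d))) * (cnj (f c a) * f d a))"
      using phi cb by (intro sum.cong refl) (simp add: sum_distrib_left mult_ac)
    also have "\<dots> = (\<Sum>d\<in>B. (U b d * of_real (sqrt (l d))) * (\<Sum>a\<in>A. cnj (f c a) * f d a))"
      by (subst sum.swap) (simp add: sum_distrib_left)
    also have "\<dots> = (\<Sum>d\<in>B. of_bool (c = d) * (U b d * of_real (sqrt (l d)) * of_bool (l d \<noteq> 0)))"
      using ff cb by (intro sum.cong refl) auto
    finally show ?thesis using finB cb by (cases "l c = 0") simp_all
  qed
  \<comment> \<open>\<open>T\<close> sends \<open>f c\<close> to the conjugated eigenvector in the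
    outcome register; \<open>P\<close> is the projection onto the span of the \<open>f c\<close>,
    and its complement becomes the outcome \<open>None\<close>.\<close>
  define T where "T b a = (\<Sum>c\<in>B. cnj (U b c) * cnj (f c a))" for b a
  define P where "P a a' = (\<Sum>c\<in>B. f c a * cnj (f c a'))" for a a'
  define k where "k m a a' = (case m of None \<Rightarrow> of_bool (a = a') - P a a' | Some b \<Rightarrow> of_bool (a = a0) * T b a')"
    for m and a a' :: 'a
  have Pherm: "cnj (P a a') = P a' a" for a a'
    by (simp add: P_def cnj_sum mult.commute)
  have TT: "(\<Sum>b\<in>B. cnj (T b a) * T b a') = P a a'" for a a'
  proof -
    have "(\<Sum>b\<in>B. cnj (T b a) * T b a') = (\<Sum>b\<in>B. \<Sum>c\<in>B. \<Sum>d\<in>B. (f c a * cnj (f d a')) * (cnj (U b d) * U b c))"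
      unfolding T_def cnj_sum sum_product by (intro sum.cong refl) simp
    also have "\<dots> = (\<Sum>c\<in>B. \<Sum>d\<in>B. \<Sum>b\<in>B. (f c a * cnj (f d a')) * (cnj (U b d) * U b c))"
      by (rule sum_rotate[symmetric])
    also have "\<dots> = (\<Sum>c\<in>B. \<Sum>d\<in>B. (f c a * cnj (f d a')) * of_bool (d = c))"
      using uc by (intro sum.cong refl) (simp flip: sum_distrib_left)
    also have "\<dots> = P a a'" using finB by (simp add: P_def)
    finally show ?thesis .
  qed
  have PP: "(\<Sum>e\<in>A. cnj (P e a) * P e a') = P a a'" for a a'
  proof -
    have "(\<Sum>e\<in>A. cnj (P e a) * P e a') = (\<Sum>e\<in>A. \<Sum>c\<in>B. \<Sum>d\<in>B. (f c a * cnj (f d a')) * (cnj (f c e) * f d e))"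
      unfolding P_def cnj_sum sum_product by (intro sum.cong refl) simp
    also have "\<dots> = (\<Sum>c\<in>B. \<Sum>d\<in>B. \<Sum>e\<in>A. (f c a * cnj (f d a')) * (cnj (f c e) * f d e))"
      by (rule sum_rotate[symmetric])
    also have "\<dots> = (\<Sum>c\<in>B. \<Sum>d\<in>B. of_bool (c = d) * (of_bool (l c \<noteq> 0) * (f c a * cnj (f d a'))))"
      using ff by (intro sum.cong refl) (auto simp flip: sum_distrib_left)
    also have "\<dots> = (\<Sum>c\<in>B. of_bool (l c \<noteq> 0) * (f c a * cnj (f c a')))"
      by (intro sum.cong refl) (simp only: sum_of_bool_eq[OF finB], simp)
    also have "\<dots> = P a a'" unfolding P_def by (intro sum.cong refl) (auto simp: f_def)
    finally show ?thesis .
  qed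
  have iso: "isometric (insert None (Some ` B)) A k"
    unfolding isometric_def
  proof (intro ballI)
    fix a b assume ab: "a \<in> A" "b \<in> A"
    have "(\<Sum>m\<in>Some ` B. \<Sum>c\<in>A. cnj (k m c a) * k m c b) = (\<Sum>b'\<in>B. \<Sum>c\<in>A. of_bool (c = a0) * (cnj (T b' a) * T b' b))"
      by (subst sum.reindex) (auto simp: k_def intro!: sum.cong)
    also have "\<dots> = P a b" using finA a0 TT by simp
    finally have 1: "(\<Sum>m\<in>Some ` B. \<Sum>c\<in>A. cnj (k m c a) * k m c b) = P a b" .
    have "(\<Sum>c\<in>A. cnj (k None c a) * k None c b)
        = (\<Sum>c\<in>A. of_bool (c = a) * of_bool (c = b) - of_bool (c = a) * P c b - cnj (P c a) * of_bool (c = b) + cnj (P c a) * P c b)"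
      by (intro sum.cong refl) (simp add: k_def algebra_simps)
    also have "\<dots> = of_bool (a = b) - P a b - P a b + P a b"
      using ab finA Pherm PP by (simp add: sum.distrib sum_subtractf)
    finally show "(\<Sum>m\<in>insert None (Some ` B). \<Sum>c\<in>A. cnj (k m c a) * k m c b) = of_bool (a = b)"
      using finB 1 by simp
  qed
  have "(\<Sum>a'\<in>A. k None a a' * \<phi> a' b) = 0" if "a \<in> A" "b \<in> B" for a b
  proof -
    have "(\<Sum>a'\<in>A. P a a' * \<phi> a' b) = (\<Sum>a'\<in>A. \<Sum>c\<in>B. f c a * (cnj (f c a') * \<phi> a' b))"
      by (simp add: P_def sum_distrib_right mult.assoc)
    also have "\<dots> = (\<Sum>c\<in>B. f c a * (\<Sum>a'\<in>A. cnj (f c a') * \<phi> a' b))"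
      by (subst sum.swap) (simp add: sum_distrib_left)
    also have "\<dots> = \<phi> a b" using f_phi phi that by (simp add: mult_ac)
    finally show ?thesis using finA that by (simp add: k_def left_diff_distrib sum_subtractf)
  qed
  moreover have "(\<Sum>a'\<in>A. k (Some b') a a' * \<phi> a' b) = of_bool (a = a0) * osqrt B ?\<rho> b b'"
    if "b \<in> B" "b' \<in> B" for a b b'
  proof -
    have "(\<Sum>a'\<in>A. T b' a' * \<phi> a' b) = (\<Sum>a'\<in>A. \<Sum>c\<in>B. cnj (U b' c) * (cnj (f c a') * \<phi> a' b))"
      by (simp add: T_def sum_distrib_right mult.assoc)
    also have "\<dots> = (\<Sum>c\<in>B. cnj (U b' c) * (\<Sum>a'\<in>A. cnj (f c a') * \<phi> a' b))"
      by (subst sum.swap) (simp add: sum_distrib_left)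
    also have "\<dots> = osqrt B ?\<rho> b b'" using f_phi that by (simp add: sq mult_ac)
    finally show ?thesis by (simp add: k_def mult.assoc flip: sum_distrib_left)
  qed
  ultimately show ?thesis using iso unfolding canonical_kraus_def by blast
qed

text \<open>Both isometries leave \<open>A\<close> in the same state \<open>a0\<close> and put
  everything else into the root, so nothing but the difference of the roots remains.\<close>

lemma canonical_kraus_dist:
  assumes finA: "finite A" and finB: "finite B" and a0: "a0 \<in> A"
    and k: "canonical_kraus A B a0 \<phi> k" and k': "canonical_kraus A B a0 \<phi>' k'"
  shows "(\<Sum>m\<in>insert None (Some ` B). \<Sum>a\<in>A. \<Sum>b\<in>B.
           (cmod ((\<Sum>a'\<in>A. k' m a a' * \<phi>' a' b) - (\<Sum>a'\<in>A. k m a a' * \<phi> a' b)))\<^sup>2)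
         = hs_dist2 B (osqrt B (marginal A \<phi>')) (osqrt B (marginal A \<phi>))"
proof -
  let ?R = "osqrt B (marginal A \<phi>)" and ?R' = "osqrt B (marginal A \<phi>')"
  have none: "(\<Sum>a\<in>A. \<Sum>b\<in>B. (cmod ((\<Sum>a'\<in>A. k' None a a' * \<phi>' a' b) - (\<Sum>a'\<in>A. k None a a' * \<phi> a' b)))\<^sup>2) = 0"
    using k k' unfolding canonical_kraus_def by (intro sum.neutral ballI) simp
  have "(\<Sum>m\<in>Some ` B. \<Sum>a\<in>A. \<Sum>b\<in>B.
           (cmod ((\<Sum>a'\<in>A. k' m a a' * \<phi>' a' b) - (\<Sum>a'\<in>A. k m a a' * \<phi> a' b)))\<^sup>2)
      = (\<Sum>c\<in>B. \<Sum>a\<in>A. \<Sum>b\<in>B. of_bool (a = a0) * (cmod (?R' b c - ?R b c))\<^sup>2)"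
    using k k' unfolding canonical_kraus_def
    by (subst sum.reindex) (auto intro!: sum.cong simp: of_bool_def)
  also have "\<dots> = (\<Sum>c\<in>B. \<Sum>b\<in>B. (cmod (?R' b c - ?R b c))\<^sup>2)"
    using finA a0 by (simp flip: sum_distrib_left)
  also have "\<dots> = hs_dist2 B ?R' ?R" unfolding hs_dist2_def by (rule sum.swap)
  finally show ?thesis using finB none by simp
qed

lemma isometric_apply:
  assumes "finite A" "isometric M A k"
  shows "(\<Sum>m\<in>M. \<Sum>a\<in>A. cnj (\<Sum>b\<in>A. k m a b * f b) * (\<Sum>b\<in>A. k m a b * h b)) = (\<Sum>a\<in>A. cnj (f a) * h a)"
proof -
  have "(\<Sum>m\<in>M. \<Sum>a\<in>A. cnj (\<Sum>b\<in>A. k m a b * f b) * (\<Sum>b\<in>A. k m a b * h b))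
      = (\<Sum>m\<in>M. \<Sum>b\<in>A. \<Sum>c\<in>A. \<Sum>a\<in>A. (cnj (f b) * h c) * (cnj (k m a b) * k m a c))"
    unfolding cnj_sum sum_product by (subst sum_rotate[symmetric]) (simp add: mult_ac)
  also have "\<dots> = (\<Sum>b\<in>A. \<Sum>c\<in>A. \<Sum>m\<in>M. \<Sum>a\<in>A. (cnj (f b) * h c) * (cnj (k m a b) * k m a c))"
    by (rule sum_rotate[symmetric])
  also have "\<dots> = (\<Sum>b\<in>A. \<Sum>c\<in>A. (cnj (f b) * h c) * of_bool (b = c))"
    using assms(2) unfolding isometric_def by (intro sum.cong refl) (simp flip: sum_distrib_left)
  also have "\<dots> = (\<Sum>a\<in>A. cnj (f a) * h a)" using assms(1) by simp
  finally show ?thesis .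
qed

lemma isometric_unitary: "unitary_on A U \<Longrightarrow> isometric {m} A (\<lambda>_. U)"
  by (simp add: isometric_def unitary_on_def oprod_def adj_def)

section \<open>Isometric families on joint states\<close>

lemma sum_Pow_split:
  assumes "R \<subseteq> Q"
  shows "(\<Sum>S\<in>Pow Q. f S) = (\<Sum>S\<in>Pow (Q - R). \<Sum>T\<in>Pow R. f (S \<union> T))"
proof -
  have "(\<Sum>S\<in>Pow Q. f S) = (\<Sum>(S, T)\<in>Pow (Q - R) \<times> Pow R. f (S \<union> T))"
    by (rule sum.reindex_bij_witness[of _ "\<lambda>(S, T). S \<union> T" "\<lambda>S. (S - R, S \<inter> R)"])
       (use assms in \<open>auto simp: Un_Diff Diff_Int_distrib2 intro!: arg_cong[of _ _ f]\<close>)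
  then show ?thesis by (simp add: sum.cartesian_product)
qed

definition inner_on :: "bool list set \<Rightarrow> nat set \<Rightarrow> joint_state \<Rightarrow> joint_state \<Rightarrow> complex" where
  "inner_on Y Q \<psi> \<phi> = (\<Sum>y\<in>Y. \<Sum>S\<in>Pow Q. cnj (\<psi> (y, S)) * \<phi> (y, S))"

definition local_op :: "bool list set \<Rightarrow> nat set \<Rightarrow> (bool list \<times> nat set) oper \<Rightarrow> joint_state \<Rightarrow> joint_state" where
  "local_op Y R k \<psi> = (\<lambda>(y, S). \<Sum>(z, T)\<in>Y \<times> Pow R. k (y, S \<inter> R) (z, T) * \<psi> (z, (S - R) \<union> T))"

lemma local_op_union:
  assumes "S \<inter> R = {}" "T \<subseteq> R"
  shows "local_op Y R k \<psi> (y, S \<union> T) = (\<Sum>a\<in>Y \<times> Pow R. k (y, T) a * \<psi> (fst a, S \<union> snd a))"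
proof -
  have "(S \<union> T) \<inter> R = T" "S \<union> T - R = S" using assms by auto
  then show ?thesis by (simp add: local_op_def case_prod_unfold)
qed

lemma controlled_union:
  assumes "S \<inter> R = {}" "T \<subseteq> R"
  shows "controlled R U \<psi> (y, S \<union> T) = (\<Sum>T'\<in>Pow R. U y T T' * \<psi> (y, S \<union> T'))"
proof -
  have "(S \<union> T) \<inter> R = T" "S \<union> T - R = S" using assms by auto
  then show ?thesis by (simp add: controlled_def)
qed

text \<open>The components of one isometry into a space enlarged by an outcome register. Families of
  the two players write to different outcome registers, so they can be composed in either
  order.\<close>

definition isometries :: "'m set \<Rightarrow> bool list set \<Rightarrow> nat set \<Rightarrow> ('m \<Rightarrow> joint_state \<Rightarrow> joint_state) \<Rightarrow> bool" where
  "isometries M Y Q T \<longleftrightarrow>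
     (\<forall>\<psi> \<phi>. (\<Sum>m\<in>M. inner_on Y Q (T m \<psi>) (T m \<phi>)) = inner_on Y Q \<psi> \<phi>) \<and>
     (\<forall>m \<psi> \<phi>. T m (\<lambda>\<omega>. \<psi> \<omega> - \<phi> \<omega>) = (\<lambda>\<omega>. T m \<psi> \<omega> - T m \<phi> \<omega>))"

lemma isometry_local_op:
  assumes fin: "finite Y" "finite Q" and R: "R \<subseteq> Q" and k: "isometric M (Y \<times> Pow R) k"
  shows "isometries M Y Q (\<lambda>m. local_op Y R (k m))"
  unfolding isometries_def
proof (intro conjI allI)
  fix \<psi> \<phi> :: joint_state
  let ?A = "Y \<times> Pow R"
  let ?L = "\<lambda>S. \<Sum>m\<in>M. \<Sum>a\<in>?A. cnj (local_op Y R (k m) \<psi> (fst a, S \<union> snd a)) * local_op Y R (k m) \<phi> (fst a, S \<union> snd a)"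
  have finA: "finite ?A" using fin R finite_subset by auto
  have split: "inner_on Y Q F G = (\<Sum>S\<in>Pow (Q - R). \<Sum>a\<in>?A. cnj (F (fst a, S \<union> snd a)) * G (fst a, S \<union> snd a))" for F G
    unfolding inner_on_def sum_Pow_split[OF R]
    by (subst sum.swap) (simp add: sum.cartesian_product')
  have "(\<Sum>m\<in>M. inner_on Y Q (local_op Y R (k m) \<psi>) (local_op Y R (k m) \<phi>))
      = (\<Sum>S\<in>Pow (Q - R). \<Sum>m\<in>M. \<Sum>a\<in>?A. cnj (local_op Y R (k m) \<psi> (fst a, S \<union> snd a)) * local_op Y R (k m) \<phi> (fst a, S \<union> snd a))"
    unfolding split by (rule sum.swap)
  also have "\<dots> = (\<Sum>S\<in>Pow (Q - R). \<Sum>a\<in>?A. cnj (\<psi> (fst a, S \<union> snd a)) * \<phi> (fst a, S \<union> snd a))"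
  proof (rule sum.cong[OF refl])
    fix S assume "S \<in> Pow (Q - R)"
    then have S: "S \<inter> R = {}" by auto
    have "?L S
       = (\<Sum>m\<in>M. \<Sum>a\<in>?A. cnj (\<Sum>b\<in>?A. k m a b * \<psi> (fst b, S \<union> snd b)) * (\<Sum>b\<in>?A. k m a b * \<phi> (fst b, S \<union> snd b)))"
      using local_op_union[OF S] by (intro sum.cong refl) auto
    then show "?L S
       = (\<Sum>a\<in>?A. cnj (\<psi> (fst a, S \<union> snd a)) * \<phi> (fst a, S \<union> snd a))"
      using isometric_apply[OF finA k] by simp
  qed
  finally show "(\<Sum>m\<in>M. inner_on Y Q (local_op Y R (k m) \<psi>) (local_op Y R (k m) \<phi>)) = inner_on Y Q \<psi> \<phi>"
    unfolding split .
next
  fix m and \<psi> \<phi> :: joint_state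
  show "local_op Y R (k m) (\<lambda>\<omega>. \<psi> \<omega> - \<phi> \<omega>) = (\<lambda>\<omega>. local_op Y R (k m) \<psi> \<omega> - local_op Y R (k m) \<phi> \<omega>)"
    by (auto simp: local_op_def right_diff_distrib sum_subtractf case_prod_unfold)
qed

lemma isometry_controlled:
  assumes fin: "finite Y" "finite Q" and R: "R \<subseteq> Q"
    and k: "\<And>y. y \<in> Y \<Longrightarrow> isometric M (Pow R) (\<lambda>m. k m y)"
  shows "isometries M Y Q (\<lambda>m. controlled R (k m))"
  unfolding isometries_def
proof (intro conjI allI)
  fix \<psi> \<phi> :: joint_state
  let ?L = "\<lambda>y S. \<Sum>m\<in>M. \<Sum>a\<in>Pow R. cnj (controlled R (k m) \<psi> (y, S \<union> a)) * controlled R (k m) \<phi> (y, S \<union> a)"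
  have finR: "finite (Pow R)" using fin R finite_subset by auto
  have split: "inner_on Y Q F G = (\<Sum>y\<in>Y. \<Sum>S\<in>Pow (Q - R). \<Sum>a\<in>Pow R. cnj (F (y, S \<union> a)) * G (y, S \<union> a))" for F G
    unfolding inner_on_def sum_Pow_split[OF R] ..
  have "(\<Sum>m\<in>M. inner_on Y Q (controlled R (k m) \<psi>) (controlled R (k m) \<phi>))
      = (\<Sum>y\<in>Y. \<Sum>S\<in>Pow (Q - R). \<Sum>m\<in>M. \<Sum>a\<in>Pow R. cnj (controlled R (k m) \<psi> (y, S \<union> a)) * controlled R (k m) \<phi> (y, S \<union> a))"
    unfolding split by (rule sum_rotate[symmetric])
  also have "\<dots> = (\<Sum>y\<in>Y. \<Sum>S\<in>Pow (Q - R). \<Sum>a\<in>Pow R. cnj (\<psi> (y, S \<union> a)) * \<phi> (y, S \<union> a))"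
  proof (intro sum.cong refl)
    fix y S assume y: "y \<in> Y" and "S \<in> Pow (Q - R)"
    then have S: "S \<inter> R = {}" by auto
    have "?L y S
       = (\<Sum>m\<in>M. \<Sum>a\<in>Pow R. cnj (\<Sum>b\<in>Pow R. k m y a b * \<psi> (y, S \<union> b)) * (\<Sum>b\<in>Pow R. k m y a b * \<phi> (y, S \<union> b)))"
      using controlled_union[OF S] by (intro sum.cong refl) auto
    then show "?L y S
       = (\<Sum>a\<in>Pow R. cnj (\<psi> (y, S \<union> a)) * \<phi> (y, S \<union> a))"
      using isometric_apply[OF finR k[OF y]] by simp
  qed
  finally show "(\<Sum>m\<in>M. inner_on Y Q (controlled R (k m) \<psi>) (controlled R (k m) \<phi>)) = inner_on Y Q \<psi> \<phi>"
    unfolding split .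
next
  fix m and \<psi> \<phi> :: joint_state
  show "controlled R (k m) (\<lambda>\<omega>. \<psi> \<omega> - \<phi> \<omega>) = (\<lambda>\<omega>. controlled R (k m) \<psi> \<omega> - controlled R (k m) \<phi> \<omega>)"
    by (auto simp: controlled_def right_diff_distrib sum_subtractf)
qed

lemma controlled_controlled_commute:
  assumes "A \<inter> B = {}"
  shows "controlled A U (controlled B (\<lambda>_. g) \<psi>) = controlled B (\<lambda>_. g) (controlled A U \<psi>)"
proof (intro ext, clarify)
  fix y S
  have "S - A \<union> T - B \<union> T' = S - B \<union> T' - A \<union> T" "(S - A \<union> T) \<inter> B = S \<inter> B" "(S - B \<union> T') \<inter> A = S \<inter> A"
    if "T \<in> Pow A" "T' \<in> Pow B" for T T' using that assms by auto
  then show "controlled A U (controlled B (\<lambda>_. g) \<psi>) (y, S) = controlled B (\<lambda>_. g) (controlled A U \<psi>) (y, S)"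
    unfolding controlled_def prod.case sum_distrib_left
    by (subst sum.swap) (intro sum.cong refl, simp add: mult.left_commute)
qed

text \<open>The left operation may alter the register, so disjointness of the qubits is not enough:
  the right one must act alike for every register content, as Bob's moves do once the prefix he
  reads is fixed.\<close>

lemma local_op_controlled_commute:
  assumes "A \<inter> B = {}"
  shows "local_op Y A k (controlled B (\<lambda>_. g) \<psi>) = controlled B (\<lambda>_. g) (local_op Y A k \<psi>)"
proof (intro ext, clarify)
  fix y S
  have "S - A \<union> T - B \<union> T' = S - B \<union> T' - A \<union> T" "(S - A \<union> T) \<inter> B = S \<inter> B" "(S - B \<union> T') \<inter> A = S \<inter> A"
    if "T \<in> Pow A" "T' \<in> Pow B" for T T' using that assms by auto
  then show "local_op Y A k (controlled B (\<lambda>_. g) \<psi>) (y, S) = controlled B (\<lambda>_. g) (local_op Y A k \<psi>) (y, S)"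
    unfolding controlled_def local_op_def prod.case sum_distrib_left case_prod_unfold
    by (subst sum.swap) (intro sum.cong refl, auto simp: mult.left_commute)
qed

section \<open>Norms and distances of isometric families\<close>

definition family_norm :: "'m set \<Rightarrow> bool list set \<Rightarrow> nat set \<Rightarrow> ('m \<Rightarrow> joint_state) \<Rightarrow> real" where
  "family_norm M Y Q F = L2_set (\<lambda>(m, \<omega>). cmod (F m \<omega>)) (M \<times> Y \<times> Pow Q)"

lemma family_norm_power2:
  "(family_norm M Y Q F)\<^sup>2 = (\<Sum>m\<in>M. Re (inner_on Y Q (F m) (F m)))"
proof -
  have c: "Re (cnj z * z) = (cmod z)\<^sup>2" for z
    by (metis complex_norm_square mult.commute Re_complex_of_real)
  have "(family_norm M Y Q F)\<^sup>2 = (\<Sum>m\<in>M. \<Sum>y\<in>Y. \<Sum>S\<in>Pow Q. (cmod (F m (y, S)))\<^sup>2)"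
    unfolding family_norm_def L2_set_def by (subst real_sqrt_pow2) (auto simp: sum.cartesian_product' intro!: sum_nonneg)
  then show ?thesis unfolding inner_on_def Re_sum c .
qed

lemma family_norm_nonneg [simp]: "0 \<le> family_norm M Y Q F"
  by (simp add: family_norm_def)

lemma family_norm_eqI:
  assumes "(\<Sum>m\<in>M. Re (inner_on Y Q (F m) (F m))) = (\<Sum>m\<in>M'. Re (inner_on Y' Q' (G m) (G m)))"
  shows "family_norm M Y Q F = family_norm M' Y' Q' G"
  using assms unfolding family_norm_power2[symmetric] by (simp add: power2_eq_iff_nonneg)

lemma family_norm_triangle:
  "family_norm M Y Q (\<lambda>m \<omega>. F m \<omega> + G m \<omega>) \<le> family_norm M Y Q F + family_norm M Y Q G"
proof -
  have "family_norm M Y Q (\<lambda>m \<omega>. F m \<omega> + G m \<omega>) \<le> L2_set (\<lambda>x. cmod (F (fst x) (snd x)) + cmod (G (fst x) (snd x))) (M \<times> Y \<times> Pow Q)"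
    unfolding family_norm_def by (intro L2_set_mono) (auto simp: norm_triangle_ineq)
  also have "\<dots> \<le> family_norm M Y Q F + family_norm M Y Q G"
    unfolding family_norm_def case_prod_unfold by (rule L2_set_triangle_ineq)
  finally show ?thesis .
qed

lemma family_norm_isometric:
  assumes S: "isometries N Y Q S"
  shows "family_norm (N \<times> M) Y Q (\<lambda>(n, m). S n (F m)) = family_norm M Y Q F"
    "family_norm (M \<times> N) Y Q (\<lambda>(m, n). S n (F m)) = family_norm M Y Q F"
proof -
  have *: "(\<Sum>m\<in>M. \<Sum>n\<in>N. Re (inner_on Y Q (S n (F m)) (S n (F m)))) = (\<Sum>m\<in>M. Re (inner_on Y Q (F m) (F m)))"
    using S by (simp add: isometries_def flip: Re_sum)
  show "family_norm (N \<times> M) Y Q (\<lambda>(n, m). S n (F m)) = family_norm M Y Q F"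
    by (rule family_norm_eqI) (use * in \<open>subst (asm) sum.swap, simp add: sum.cartesian_product'\<close>)
  show "family_norm (M \<times> N) Y Q (\<lambda>(m, n). S n (F m)) = family_norm M Y Q F"
    by (rule family_norm_eqI) (use * in \<open>simp add: sum.cartesian_product'\<close>)
qed

text \<open>How far two runs are apart after each has been mapped by its own isometry. This replaces
  the distance after an optimal local unitary.\<close>

definition family_dist where
  "family_dist M Y Q T' \<psi>' T \<psi> = family_norm M Y Q (\<lambda>m \<omega>. T' m \<psi>' \<omega> - T m \<psi> \<omega>)"

lemma family_dist_nonneg [simp]: "0 \<le> family_dist M Y Q T' \<psi>' T \<psi>"
  by (simp add: family_dist_def)

text \<open>After applying \<open>S'\<close>, which preserves the norm, the difference
  \<open>S' T' \<beta>' - S' T \<beta>\<close> is the sum of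
  \<open>T' (S' \<beta>' - S \<alpha>')\<close>, \<open>S (T' \<alpha>' - T \<alpha>)\<close> and
  \<open>T (S \<alpha> - S' \<beta>)\<close>: a detour around the square of the four runs along its
  three other sides. The outer isometries are free of cost.\<close>

lemma family_dist_exchange:
  assumes T: "isometries M Y Q T" and T': "isometries M Y Q T'"
    and S: "isometries N Y Q S" and S': "isometries N Y Q S'"
    and c: "\<And>m n \<psi>. T m (S n \<psi>) = S n (T m \<psi>)" "\<And>m n \<psi>. T' m (S n \<psi>) = S n (T' m \<psi>)"
           "\<And>m n \<psi>. T m (S' n \<psi>) = S' n (T m \<psi>)" "\<And>m n \<psi>. T' m (S' n \<psi>) = S' n (T' m \<psi>)"
  shows "family_dist M Y Q T' \<beta>' T \<beta>
      \<le> family_dist N Y Q S' \<beta>' S \<alpha>' + family_dist M Y Q T' \<alpha>' T \<alpha> + family_dist N Y Q S' \<beta> S \<alpha>"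
proof -
  let ?N = "family_norm (N \<times> M) Y Q"
  let ?X = "\<lambda>n \<omega>. S' n \<beta>' \<omega> - S n \<alpha>' \<omega>" and ?Z = "\<lambda>m \<omega>. T' m \<alpha>' \<omega> - T m \<alpha> \<omega>"
    and ?W = "\<lambda>n \<omega>. S n \<alpha> \<omega> - S' n \<beta> \<omega>"
  have lin: "X m (\<lambda>\<omega>. \<psi> \<omega> - \<phi> \<omega>) = (\<lambda>\<omega>. X m \<psi> \<omega> - X m \<phi> \<omega>)" if "isometries I Y Q X"
    for I and X :: "'c \<Rightarrow> joint_state \<Rightarrow> joint_state" and m \<psi> \<phi>
    using that by (simp add: isometries_def)
  have "family_dist M Y Q T' \<beta>' T \<beta> = ?N (\<lambda>(n, m). S' n (\<lambda>\<omega>. T' m \<beta>' \<omega> - T m \<beta> \<omega>))"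
    unfolding family_dist_def family_norm_isometric(1)[OF S'] ..
  also have "(\<lambda>(n, m). S' n (\<lambda>\<omega>. T' m \<beta>' \<omega> - T m \<beta> \<omega>))
      = (\<lambda>nm \<omega>. (case nm of (n, m) \<Rightarrow> T' m (?X n)) \<omega>
          + ((case nm of (n, m) \<Rightarrow> S n (?Z m)) \<omega>
          + (case nm of (n, m) \<Rightarrow> T m (?W n)) \<omega>))"
    by (auto simp: fun_eq_iff lin[OF T] lin[OF T'] lin[OF S] lin[OF S'] c)
  also have "?N \<dots> \<le> ?N (\<lambda>(n, m). T' m (?X n))
      + (?N (\<lambda>(n, m). S n (?Z m)) + ?N (\<lambda>(n, m). T m (?W n)))"
    by (rule order_trans[OF family_norm_triangle add_left_mono[OF family_norm_triangle]])
  also have "?N (\<lambda>(n, m). T' m (?X n)) = family_dist N Y Q S' \<beta>' S \<alpha>'"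
    unfolding family_dist_def by (rule family_norm_isometric(2)[OF T'])
  also have "?N (\<lambda>(n, m). S n (?Z m)) = family_dist M Y Q T' \<alpha>' T \<alpha>"
    unfolding family_dist_def by (rule family_norm_isometric(1)[OF S])
  also have "?N (\<lambda>(n, m). T m (?W n)) = family_dist N Y Q S \<alpha> S' \<beta>"
    unfolding family_dist_def by (rule family_norm_isometric(2)[OF T])
  also have "family_dist N Y Q S \<alpha> S' \<beta> = family_dist N Y Q S' \<beta> S \<alpha>"
    unfolding family_dist_def family_norm_def by (simp add: norm_minus_commute)
  finally show ?thesis by simp
qed

text \<open>A round of the player whose input agrees in both runs leaves the distance seen through
  the other player's isometries unchanged.\<close>

lemma family_dist_unitary:
  assumes B: "isometries {()} Y Q (\<lambda>_. B)"
    and c: "\<And>m \<psi>. T m (B \<psi>) = B (T m \<psi>)" "\<And>m \<psi>. T' m (B \<psi>) = B (T' m \<psi>)"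
  shows "family_dist M Y Q T' (B \<psi>') T (B \<psi>) = family_dist M Y Q T' \<psi>' T \<psi>"
proof -
  let ?X = "\<lambda>m \<omega>. T' m \<psi>' \<omega> - T m \<psi> \<omega>"
  have "family_norm M Y Q (\<lambda>m. B (?X m)) = family_norm M Y Q (\<lambda>m \<omega>. T' m \<psi>' \<omega> - T m \<psi> \<omega>)"
  proof (rule family_norm_eqI)
    have "inner_on Y Q (B X) (B X) = inner_on Y Q X X" for X using B by (simp add: isometries_def)
    then show "(\<Sum>m\<in>M. Re (inner_on Y Q (B (?X m)) (B (?X m))))
      = (\<Sum>m\<in>M. Re (inner_on Y Q (?X m) (?X m)))"
      by (simp only:)
  qed
  then show ?thesis using B unfolding family_dist_def c by (simp add: isometries_def)
qed

text \<open>
  Here \<open>gv\<close>, \<open>gu\<close> and \<open>h\<close> are the values of a form \<open>g\<close> with \<open>|g| \<le> \<parallel>\<cdot>\<parallel>\<^sup>2\<close> at unit vectors \<open>v\<close>, \<open>u\<close> and at the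
  pair, and \<open>r = Re \<langle>v, u\<rangle>\<close>, so that \<open>\<parallel>v - u\<parallel>\<^sup>2 = 2 - 2 r\<close>. Polarisation with \<open>x (v - u) \<plusminus> (v + u) / x\<close> gives a bound
  for every \<open>x > 0\<close>, which is then optimised.
\<close>

lemma form_difference_bound:
  fixes gv gu h r :: real
  assumes b: "\<And>a b. \<bar>a\<^sup>2 * gv + 2 * a * b * h + b\<^sup>2 * gu\<bar> \<le> a\<^sup>2 + b\<^sup>2 + 2 * a * b * r"
  shows "gv - gu \<le> 2 * sqrt (2 - 2 * r)"
proof -
  have r: "\<bar>r\<bar> \<le> 1" using b[of 1 1] b[of 1 "-1"] by simp
  have key: "gv - gu \<le> x\<^sup>2 * (1 - r) + (1 + r) / x\<^sup>2" if x: "x > 0" for x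
  proof -
    \<comment> \<open>These satisfy \<open>p^2 - q^2 = 4\<close>. The form at
      \<open>p v - q u\<close> and, with opposite sign, at \<open>q v - p u\<close> have the same
      mixed term, so \<open>h\<close> cancels.\<close>
    let ?p = "x + 1 / x" and ?q = "x - 1 / x"
    have e: "?p\<^sup>2 - ?q\<^sup>2 = 4" "?p\<^sup>2 + ?q\<^sup>2 = 2 * (x\<^sup>2 + 1 / x\<^sup>2)" "?p * ?q = x\<^sup>2 - 1 / x\<^sup>2"
      using x by (simp_all add: power2_eq_square field_simps)
    have "(p\<^sup>2 - q\<^sup>2) * (gv - gu) \<le> 2 * (p\<^sup>2 + q\<^sup>2) - 4 * (p * q) * r" for p q :: real
    proof -
      have "p\<^sup>2 * gv - 2 * p * q * h + q\<^sup>2 * gu \<le> p\<^sup>2 + q\<^sup>2 - 2 * p * q * r"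
        using b[of p "- q"] by simp
      moreover have "- (q\<^sup>2 * gv - 2 * p * q * h + p\<^sup>2 * gu) \<le> p\<^sup>2 + q\<^sup>2 - 2 * p * q * r"
        using b[of q "- p"] by (simp add: mult_ac)
      ultimately show ?thesis by (simp add: algebra_simps)
    qed
    from this[of ?p ?q]
    have "4 * (gv - gu) \<le> 4 * (x\<^sup>2 + 1 / x\<^sup>2) - 4 * (x\<^sup>2 - 1 / x\<^sup>2) * r" unfolding e by simp
    moreover have "4 * (x\<^sup>2 + 1 / x\<^sup>2) - 4 * (x\<^sup>2 - 1 / x\<^sup>2) * r = 4 * (x\<^sup>2 * (1 - r) + (1 + r) / x\<^sup>2)"
      by (simp add: algebra_simps add_divide_distrib)
    ultimately have "4 * (gv - gu) \<le> 4 * (x\<^sup>2 * (1 - r) + (1 + r) / x\<^sup>2)" by (simp only:)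
    then show ?thesis by (simp only: mult_le_cancel_left_pos zero_less_numeral)
  qed
  show ?thesis
  proof (cases "r = 1")
    case True
    \<comment> \<open>For \<open>r = 1\<close> the infimum over \<open>x\<close> is only approached
      as \<open>x\<close> grows.\<close>
    have "gv - gu \<le> 0"
    proof (rule field_le_epsilon)
      fix e :: real assume "e > 0"
      then show "gv - gu \<le> 0 + e" using key[of "sqrt (2 / e)"] True by simp
    qed
    then show ?thesis using True by simp
  next
    case False
    then have r1: "1 - r > 0" using r by linarith
    define s where "s = sqrt (2 - 2 * r)"
    have s: "s > 0" "1 - r = s * s / 2" using r1 by (simp_all add: s_def)
    \<comment> \<open>The choice \<open>x^2 = 2 / s\<close> makes the first term \<open>s\<close>
      and the second \<open>s * (1 + r) / 2\<close>, hence at most \<open>s\<close>.\<close>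
    have "gv - gu \<le> 2 / s * (1 - r) + (1 + r) / (2 / s)"
      using key[of "sqrt (2 / s)"] s(1) by simp
    also have "2 / s * (1 - r) = s" unfolding s(2) using s(1) by simp
    also have "(1 + r) / (2 / s) = (1 + r) / 2 * s" by simp
    also have "\<dots> \<le> 1 * s" by (rule mult_right_mono) (use r s(1) in auto)
    finally show ?thesis by (simp add: s_def)
  qed
qed

section \<open>Measurements and the hybrid argument\<close>

lemma inner_on_combination:
  "inner_on Y Q (\<lambda>\<omega>. of_real a * X \<omega> + of_real b * Z \<omega>) (\<lambda>\<omega>. of_real a * X' \<omega> + of_real b * Z' \<omega>)
    = of_real (a\<^sup>2) * inner_on Y Q X X' + of_real (a * b) * (inner_on Y Q X Z' + inner_on Y Q Z X')
      + of_real (b\<^sup>2) * inner_on Y Q Z Z'"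
  unfolding inner_on_def sum_distrib_left sum.distrib[symmetric]
  by (intro sum.cong refl) (simp add: algebra_simps power2_eq_square)

lemma controlled_combination:
  "controlled R U (\<lambda>\<omega>. x * \<psi> \<omega> + y * \<phi> \<omega>) = (\<lambda>\<omega>. x * controlled R U \<psi> \<omega> + y * controlled R U \<phi> \<omega>)"
  by (auto simp: controlled_def fun_eq_iff distrib_left sum.distrib sum_distrib_left mult_ac)

lemma inner_on_controlled:
  assumes "R \<subseteq> Q"
  shows "inner_on Y Q \<psi> (controlled R K \<psi>)
      = (\<Sum>y\<in>Y. \<Sum>S\<in>Pow (Q - R). \<Sum>a\<in>Pow R. \<Sum>b\<in>Pow R. cnj (\<psi> (y, S \<union> a)) * K y a b * \<psi> (y, S \<union> b))"
  unfolding inner_on_def sum_Pow_split[OF assms]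
proof (intro sum.cong refl)
  fix y S T assume "S \<in> Pow (Q - R)" "T \<in> Pow R"
  then have "S \<inter> R = {}" "T \<subseteq> R" by auto
  then show "cnj (\<psi> (y, S \<union> T)) * controlled R K \<psi> (y, S \<union> T) = (\<Sum>b\<in>Pow R. cnj (\<psi> (y, S \<union> T)) * K y T b * \<psi> (y, S \<union> b))"
    by (simp add: controlled_union sum_distrib_left mult.assoc)
qed

lemma inner_on_povm:
  assumes fin: "finite Q" and R: "R \<subseteq> Q" and K: "\<And>y. y \<in> Y \<Longrightarrow> povm_on (Pow R) (K y)"
  shows "0 \<le> Re (inner_on Y Q \<psi> (controlled R (\<lambda>y. K y c) \<psi>))"
    and "inner_on Y Q \<psi> (controlled R (\<lambda>y. K y True) \<psi>) + inner_on Y Q \<psi> (controlled R (\<lambda>y. K y False) \<psi>) = inner_on Y Q \<psi> \<psi>"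
proof -
  let ?q = "\<lambda>c. inner_on Y Q \<psi> (controlled R (\<lambda>y. K y c) \<psi>)"
  have finR: "finite (Pow R)" using fin R finite_subset by auto
  show "0 \<le> Re (inner_on Y Q \<psi> (controlled R (\<lambda>y. K y c) \<psi>))"
    unfolding inner_on_controlled[OF R] Re_sum[of _ Y] Re_sum[of _ "Pow (Q - R)"]
  proof (intro sum_nonneg)
    fix y S assume "y \<in> Y"
    then have "psd_on (Pow R) (K y c)" using K by (simp add: povm_on_def)
    then show "0 \<le> Re (\<Sum>a\<in>Pow R. \<Sum>b\<in>Pow R. cnj (\<psi> (y, S \<union> a)) * K y c a b * \<psi> (y, S \<union> b))"
      unfolding psd_on_def by (elim conjE) (drule spec[of _ "\<lambda>a. \<psi> (y, S \<union> a)"], simp)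
  qed
  have "?q True + ?q False
     = (\<Sum>y\<in>Y. \<Sum>S\<in>Pow (Q - R). \<Sum>a\<in>Pow R. \<Sum>b\<in>Pow R. cnj (\<psi> (y, S \<union> a)) * (K y True a b + K y False a b) * \<psi> (y, S \<union> b))"
    unfolding inner_on_controlled[OF R] by (simp add: sum.distrib algebra_simps)
  also have "\<dots> = (\<Sum>y\<in>Y. \<Sum>S\<in>Pow (Q - R). \<Sum>a\<in>Pow R. \<Sum>b\<in>Pow R. of_bool (a = b) * (cnj (\<psi> (y, S \<union> a)) * \<psi> (y, S \<union> b)))"
  proof (intro sum.cong refl)
    fix y S a b assume "y \<in> Y" "a \<in> Pow R" "b \<in> Pow R"
    then have "K y True a b + K y False a b = of_bool (a = b)"
      using K[of y] by (simp add: povm_on_def UNIV_bool add.commute)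
    then show "cnj (\<psi> (y, S \<union> a)) * (K y True a b + K y False a b) * \<psi> (y, S \<union> b) = of_bool (a = b) * (cnj (\<psi> (y, S \<union> a)) * \<psi> (y, S \<union> b))"
      by simp
  qed
  also have "\<dots> = inner_on Y Q \<psi> \<psi>"
    unfolding inner_on_def sum_Pow_split[OF R] by (simp only: sum_of_bool_eq[OF finR]) (intro sum.cong refl, simp)
  finally show "?q True + ?q False = inner_on Y Q \<psi> \<psi>" .
qed

text \<open>With \<open>G\<close> the probability of \<open>True\<close> minus that of
  \<open>False\<close>, \<open>G\<close> is \<open>1 - 2 q False\<close> at \<open>\<psi>'\<close>
  and \<open>2 q True - 1\<close> at \<open>\<psi>\<close>. Isometries commuting with the
  measurement preserve both values, so the form can be compared at the images, whose distance is the
  given one. The factor 2 of \<open>form_difference_bound\<close> cancels against that of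
  \<open>G\<close>.\<close>

lemma measurement_bias:
  assumes fin: "finite Q" and R: "R \<subseteq> Q" and K: "\<And>y. y \<in> Y \<Longrightarrow> povm_on (Pow R) (K y)"
    and T: "isometries M Y Q T" and T': "isometries M Y Q T'"
    and c: "\<And>m c \<psi>. T m (controlled R (\<lambda>y. K y c) \<psi>) = controlled R (\<lambda>y. K y c) (T m \<psi>)"
      "\<And>m c \<psi>. T' m (controlled R (\<lambda>y. K y c) \<psi>) = controlled R (\<lambda>y. K y c) (T' m \<psi>)"
    and unit: "inner_on Y Q \<psi> \<psi> = 1" "inner_on Y Q \<psi>' \<psi>' = 1"
  shows "1 \<le> Re (inner_on Y Q \<psi>' (controlled R (\<lambda>y. K y False) \<psi>'))
      + Re (inner_on Y Q \<psi> (controlled R (\<lambda>y. K y True) \<psi>)) + family_dist M Y Q T' \<psi>' T \<psi>"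
proof -
  let ?E = "\<lambda>c. controlled R (\<lambda>y. K y c)"
  let ?q = "\<lambda>c \<phi>. Re (inner_on Y Q \<phi> (?E c \<phi>))"
  define V where "V m = T' m \<psi>'" for m
  define U where "U m = T m \<psi>" for m
  let ?W = "\<lambda>a b m \<omega>. of_real a * V m \<omega> + of_real b * U m \<omega>"
  define G where "G X Z = Re (inner_on Y Q X (?E True Z)) - Re (inner_on Y Q X (?E False Z))" for X Z
  define gv where "gv = (\<Sum>m\<in>M. G (V m) (V m))"
  define gu where "gu = (\<Sum>m\<in>M. G (U m) (U m))"
  define h where "h = (\<Sum>m\<in>M. (G (V m) (U m) + G (U m) (V m)) / 2)"
  define r where "r = (\<Sum>m\<in>M. (Re (inner_on Y Q (V m) (U m)) + Re (inner_on Y Q (U m) (V m))) / 2)"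
  have q0: "0 \<le> ?q c \<phi>" and q1: "?q True \<phi> + ?q False \<phi> = Re (inner_on Y Q \<phi> \<phi>)" for c \<phi>
    using inner_on_povm[OF fin R K] by (auto simp flip: plus_complex.sel(1))
  have gvv: "gv = G \<psi>' \<psi>'" and guu: "gu = G \<psi> \<psi>"
    using T T' unfolding gv_def gu_def G_def V_def U_def c[symmetric]
    by (simp_all add: sum_subtractf isometries_def flip: Re_sum)
  have nv: "(\<Sum>m\<in>M. Re (inner_on Y Q (V m) (V m))) = 1" "(\<Sum>m\<in>M. Re (inner_on Y Q (U m) (U m))) = 1"
    using T T' unit unfolding V_def U_def by (simp_all add: isometries_def flip: Re_sum)
  have norm: "(\<Sum>m\<in>M. Re (inner_on Y Q (?W a b m) (?W a b m)))
      = a\<^sup>2 + b\<^sup>2 + 2 * a * b * r" for a b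
  proof -
    have "Re (inner_on Y Q (?W a b m) (?W a b m))
      = a\<^sup>2 * Re (inner_on Y Q (V m) (V m)) + 2 * a * b * ((Re (inner_on Y Q (V m) (U m)) + Re (inner_on Y Q (U m) (V m))) / 2)
        + b\<^sup>2 * Re (inner_on Y Q (U m) (U m))" for m
      unfolding inner_on_combination by (simp add: algebra_simps flip: of_real_power)
    then have "(\<Sum>m\<in>M. Re (inner_on Y Q (?W a b m) (?W a b m)))
      = a\<^sup>2 * (\<Sum>m\<in>M. Re (inner_on Y Q (V m) (V m))) + 2 * a * b * r + b\<^sup>2 * (\<Sum>m\<in>M. Re (inner_on Y Q (U m) (U m)))"
      unfolding r_def by (simp only: sum.distrib sum_distrib_left)
    then show ?thesis by (simp add: nv)
  qed
  have "\<bar>a\<^sup>2 * gv + 2 * a * b * h + b\<^sup>2 * gu\<bar> \<le> a\<^sup>2 + b\<^sup>2 + 2 * a * b * r" for a b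
  proof -
    let ?F = "\<lambda>m \<omega>. of_real a * V m \<omega> + of_real b * U m \<omega>"
    have "G (?F m) (?F m) = a\<^sup>2 * G (V m) (V m) + a * b * (G (V m) (U m) + G (U m) (V m)) + b\<^sup>2 * G (U m) (U m)" for m
      unfolding G_def controlled_combination inner_on_combination by (simp add: algebra_simps flip: of_real_power)
    then have "G (?F m) (?F m) = a\<^sup>2 * G (V m) (V m) + 2 * a * b * ((G (V m) (U m) + G (U m) (V m)) / 2) + b\<^sup>2 * G (U m) (U m)" for m
      by simp
    then have "a\<^sup>2 * gv + 2 * a * b * h + b\<^sup>2 * gu = (\<Sum>m\<in>M. G (?F m) (?F m))"
      unfolding gv_def gu_def h_def by (simp only: sum.distrib sum_distrib_left)
    also have "\<bar>\<dots>\<bar> \<le> (\<Sum>m\<in>M. \<bar>G (?F m) (?F m)\<bar>)" by (rule sum_abs)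
    also have "\<dots> \<le> (\<Sum>m\<in>M. Re (inner_on Y Q (?F m) (?F m)))"
    proof (rule sum_mono)
      fix m
      show "\<bar>G (?F m) (?F m)\<bar> \<le> Re (inner_on Y Q (?F m) (?F m))"
        using q0[where c = True and \<phi> = "?F m"] q0[where c = False and \<phi> = "?F m"] q1[where \<phi> = "?F m"] unfolding G_def by linarith
    qed
    finally show ?thesis unfolding norm .
  qed
  from form_difference_bound[OF this] have "gv - gu \<le> 2 * sqrt (2 - 2 * r)" .
  moreover have dist: "family_dist M Y Q T' \<psi>' T \<psi> = sqrt (2 - 2 * r)"
  proof -
    have "(family_dist M Y Q T' \<psi>' T \<psi>)\<^sup>2 = 2 - 2 * r"
      using norm[of 1 "-1"] unfolding family_dist_def family_norm_power2 V_def U_def by simp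
    then show ?thesis by (simp add: real_sqrt_unique)
  qed
  ultimately show "1 \<le> ?q False \<psi>' + ?q True \<psi> + family_dist M Y Q T' \<psi>' T \<psi>"
    using q1[where \<phi> = \<psi>] q1[where \<phi> = \<psi>'] unit unfolding gvv guu G_def by simp_all
qed

text \<open>\<open>D\<close> follows \<open>\<beta>'\<close>, comparing it after odd messages with
  \<open>\<beta>\<close>, which has the same input of Bob, and after even messages with
  \<open>\<alpha>'\<close>, which has the same input of Alice. \<open>g\<close> holds the controlled
  distances among the other runs. Each message passes from one comparison to the other by a single
  exchange.\<close>

lemma hybrid_bound:
  fixes \<alpha> \<alpha>' \<beta> \<beta>' :: "nat \<Rightarrow> joint_state" and T T' :: "nat \<Rightarrow> 'm \<Rightarrow> joint_state \<Rightarrow> joint_state"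
    and S S' :: "nat \<Rightarrow> 'n \<Rightarrow> joint_state \<Rightarrow> joint_state"
    and M :: "nat \<Rightarrow> 'm set" and N :: "nat \<Rightarrow> 'n set" and Y :: "bool list set" and Q :: "nat set"
  defines "g i \<equiv> if odd i then family_dist (M i) Y Q (T' i) (\<alpha>' i) (T i) (\<alpha> i)
                   else family_dist (N i) Y Q (S' i) (\<beta> i) (S i) (\<alpha> i)"
    and "D i \<equiv> if odd i then family_dist (M i) Y Q (T' i) (\<beta>' i) (T i) (\<beta> i)
                   else family_dist (N i) Y Q (S' i) (\<beta>' i) (S i) (\<alpha>' i)"
  assumes init: "D 0 = 0" "g 0 = 0"
    and alice: "\<And>i. i < t \<Longrightarrow> even i \<Longrightarrow> \<alpha> (Suc i) = A i (\<alpha> i) \<and> \<beta> (Suc i) = A i (\<beta> i) \<and>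
          \<alpha>' (Suc i) = A' i (\<alpha>' i) \<and> \<beta>' (Suc i) = A' i (\<beta>' i) \<and>
          isometries {()} Y Q (\<lambda>_. A i) \<and> isometries {()} Y Q (\<lambda>_. A' i)"
    and bob: "\<And>i. i < t \<Longrightarrow> odd i \<Longrightarrow> \<alpha> (Suc i) = B i (\<alpha> i) \<and> \<alpha>' (Suc i) = B i (\<alpha>' i) \<and>
          \<beta> (Suc i) = B' i (\<beta> i) \<and> \<beta>' (Suc i) = B' i (\<beta>' i) \<and>
          isometries {()} Y Q (\<lambda>_. B i) \<and> isometries {()} Y Q (\<lambda>_. B' i)"
    and T: "\<And>i. i \<le> t \<Longrightarrow> odd i \<Longrightarrow> isometries (M i) Y Q (T i) \<and> isometries (M i) Y Q (T' i)"
    and S: "\<And>i. i \<le> t \<Longrightarrow> even i \<Longrightarrow> isometries (N i) Y Q (S i) \<and> isometries (N i) Y Q (S' i)"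
    and SA: "\<And>i X Z m \<psi>. i < t \<Longrightarrow> even i \<Longrightarrow> X \<in> {S i, S' i} \<Longrightarrow> Z \<in> {A i, A' i} \<Longrightarrow> X m (Z \<psi>) = Z (X m \<psi>)"
    and TB: "\<And>i X Z m \<psi>. i < t \<Longrightarrow> odd i \<Longrightarrow> X \<in> {T i, T' i} \<Longrightarrow> Z \<in> {B i, B' i} \<Longrightarrow> X m (Z \<psi>) = Z (X m \<psi>)"
    and TS: "\<And>i i' X Z m n \<psi>. i' = Suc i \<or> i = Suc i' \<Longrightarrow> i \<le> t \<Longrightarrow> i' \<le> t \<Longrightarrow> odd i \<Longrightarrow>
          X \<in> {T i, T' i} \<Longrightarrow> Z \<in> {S i', S' i'} \<Longrightarrow> X m (Z n \<psi>) = Z n (X m \<psi>)"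
  shows "D t \<le> (\<Sum>i<t. g i + g (Suc i))"
proof -
  have step: "D (Suc i) \<le> D i + (g i + g (Suc i))" if i: "i < t" for i
  proof (cases "even i")
    case True
    note a = alice[OF i True]
    have i1: "Suc i \<le> t" "odd (Suc i)" and i0: "i \<le> t" using i True by auto
    note c = TS[of i "Suc i"]
    \<comment> \<open>Alice has just moved. The outer two distances each compare runs with the same
      input of Alice, so her move can be undone there, which returns them to round
      \<open>i\<close>.\<close>
    have "D (Suc i) \<le> family_dist (N i) Y Q (S' i) (\<beta>' (Suc i)) (S i) (\<alpha>' (Suc i))
      + family_dist (M (Suc i)) Y Q (T' (Suc i)) (\<alpha>' (Suc i)) (T (Suc i)) (\<alpha> (Suc i))
      + family_dist (N i) Y Q (S' i) (\<beta> (Suc i)) (S i) (\<alpha> (Suc i))"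
      unfolding D_def using i1(2) T[OF i1] S[OF i0 True] i1 i0
      by (simp, intro family_dist_exchange) (auto intro: c)
    also have "family_dist (N i) Y Q (S' i) (\<beta>' (Suc i)) (S i) (\<alpha>' (Suc i)) = D i"
      using a True by (simp add: D_def) (rule family_dist_unitary; auto intro: SA[OF i True])
    also have "family_dist (N i) Y Q (S' i) (\<beta> (Suc i)) (S i) (\<alpha> (Suc i)) = g i"
      using a True by (simp add: g_def) (rule family_dist_unitary; auto intro: SA[OF i True])
    finally show ?thesis using i1(2) by (simp add: g_def)
  next
    case False
    note a = bob[OF i False]
    have i1: "Suc i \<le> t" "even (Suc i)" and i0: "i \<le> t" using i False by auto
    note c = TS[of "Suc i" i, symmetric]
    have "D (Suc i) \<le> family_dist (M i) Y Q (T' i) (\<beta>' (Suc i)) (T i) (\<beta> (Suc i))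
      + family_dist (N (Suc i)) Y Q (S' (Suc i)) (\<beta> (Suc i)) (S (Suc i)) (\<alpha> (Suc i))
      + family_dist (M i) Y Q (T' i) (\<alpha>' (Suc i)) (T i) (\<alpha> (Suc i))"
      unfolding D_def using i1(2) S[OF i1] T[OF i0 False] i1 i0 False
      by (simp, intro family_dist_exchange) (auto intro: c)
    also have "family_dist (M i) Y Q (T' i) (\<beta>' (Suc i)) (T i) (\<beta> (Suc i)) = D i"
      using a False by (simp add: D_def) (rule family_dist_unitary; auto intro: TB[OF i False])
    also have "family_dist (M i) Y Q (T' i) (\<alpha>' (Suc i)) (T i) (\<alpha> (Suc i)) = g i"
      using a False by (simp add: g_def) (rule family_dist_unitary; auto intro: TB[OF i False])
    finally show ?thesis using i1(2) by (simp add: g_def)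
  qed
  have "D i \<le> (\<Sum>m<i. g m + g (Suc m))" if "i \<le> t" for i
    using that
  proof (induction i)
    case 0
    then show ?case using init by simp
  next
    case (Suc i)
    then show ?case using step[of i] by simp
  qed
  then show ?thesis by simp
qed

section \<open>Canonical purifications across the cut between the players\<close>

lemma canonical_local_dist:
  assumes fin: "finite Y" "finite Q" and R: "R \<subseteq> Q" and a0: "a0 \<in> Y \<times> Pow R"
    and k: "canonical_kraus (Y \<times> Pow R) (Pow (Q - R)) a0 (\<lambda>a S. \<psi> (fst a, S \<union> snd a)) k"
    and k': "canonical_kraus (Y \<times> Pow R) (Pow (Q - R)) a0 (\<lambda>a S. \<psi>' (fst a, S \<union> snd a)) k'"
  shows "(family_dist (insert None (Some ` Pow (Q - R))) Y Q (\<lambda>m. local_op Y R (k' m)) \<psi>' (\<lambda>m. local_op Y R (k m)) \<psi>)\<^sup>2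
     = hs_dist2 (Pow (Q - R)) (osqrt (Pow (Q - R)) (marginal (Y \<times> Pow R) (\<lambda>a S. \<psi>' (fst a, S \<union> snd a))))
         (osqrt (Pow (Q - R)) (marginal (Y \<times> Pow R) (\<lambda>a S. \<psi> (fst a, S \<union> snd a))))"
proof -
  let ?A = "Y \<times> Pow R" and ?B = "Pow (Q - R)"
  let ?M = "insert None (Some ` ?B)"
  let ?F = "\<lambda>m a S. (cmod (local_op Y R (k' m) \<psi>' (fst a, S \<union> snd a) - local_op Y R (k m) \<psi> (fst a, S \<union> snd a)))\<^sup>2"
  let ?G = "\<lambda>m a S. (cmod ((\<Sum>a'\<in>?A. k' m a a' * \<psi>' (fst a', S \<union> snd a')) - (\<Sum>a'\<in>?A. k m a a' * \<psi> (fst a', S \<union> snd a'))))\<^sup>2"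
  have finA: "finite ?A" and finB: "finite ?B" using fin R finite_subset by auto
  have c: "Re (cnj z * z) = (cmod z)\<^sup>2" for z
    by (metis complex_norm_square mult.commute Re_complex_of_real)
  have "(family_dist ?M Y Q (\<lambda>m. local_op Y R (k' m)) \<psi>' (\<lambda>m. local_op Y R (k m)) \<psi>)\<^sup>2
      = (\<Sum>m\<in>?M. \<Sum>a\<in>?A. \<Sum>S\<in>?B. ?F m a S)"
    unfolding family_dist_def family_norm_power2 inner_on_def sum_Pow_split[OF R] Re_sum c
    by (intro sum.cong refl) (simp only: sum.cartesian_product' fst_conv snd_conv, rule sum.cong[OF refl], rule sum.swap)
  also have "\<dots> = (\<Sum>m\<in>?M. \<Sum>a\<in>?A. \<Sum>S\<in>?B.
      ?G m a S)"
  proof (intro sum.cong refl)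
    fix m a S assume "a \<in> ?A" "S \<in> ?B"
    then have "S \<inter> R = {}" "snd a \<subseteq> R" by auto
    then show "?F m a S
      = ?G m a S"
      by (simp add: local_op_union)
  qed
  also have "\<dots> = hs_dist2 ?B (osqrt ?B (marginal ?A (\<lambda>a S. \<psi>' (fst a, S \<union> snd a)))) (osqrt ?B (marginal ?A (\<lambda>a S. \<psi> (fst a, S \<union> snd a))))"
    by (rule canonical_kraus_dist[OF finA finB a0 k k'])
  finally show ?thesis .
qed

text \<open>Now the register lies on the side whose reduced state is compared, as in Bob's
  information cost. The operators therefore act only on Bob's qubits, and alike for all register
  contents.\<close>

lemma canonical_controlled_dist:
  assumes fin: "finite X" "finite Q" and R: "R \<subseteq> Q"
    and k: "canonical_kraus (Pow R) (X \<times> Pow (Q - R)) {} (\<lambda>T a. \<psi> (fst a, snd a \<union> T)) k"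
    and k': "canonical_kraus (Pow R) (X \<times> Pow (Q - R)) {} (\<lambda>T a. \<psi>' (fst a, snd a \<union> T)) k'"
  shows "(family_dist (insert None (Some ` (X \<times> Pow (Q - R)))) X Q
          (\<lambda>m. controlled R (\<lambda>_. k' m)) \<psi>' (\<lambda>m. controlled R (\<lambda>_. k m)) \<psi>)\<^sup>2
     = hs_dist2 (X \<times> Pow (Q - R)) (osqrt (X \<times> Pow (Q - R)) (marginal (Pow R) (\<lambda>T a. \<psi>' (fst a, snd a \<union> T))))
         (osqrt (X \<times> Pow (Q - R)) (marginal (Pow R) (\<lambda>T a. \<psi> (fst a, snd a \<union> T))))"
proof -
  let ?A = "Pow R" and ?B = "X \<times> Pow (Q - R)"
  let ?M = "insert None (Some ` ?B)"
  let ?F = "\<lambda>m T b. (cmod (controlled R (\<lambda>_. k' m) \<psi>' (fst b, snd b \<union> T) - controlled R (\<lambda>_. k m) \<psi> (fst b, snd b \<union> T)))\<^sup>2"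
  let ?G = "\<lambda>m T b. (cmod ((\<Sum>T'\<in>?A. k' m T T' * \<psi>' (fst b, snd b \<union> T')) - (\<Sum>T'\<in>?A. k m T T' * \<psi> (fst b, snd b \<union> T'))))\<^sup>2"
  have finA: "finite ?A" and finB: "finite ?B" using fin R finite_subset by auto
  have c: "Re (cnj z * z) = (cmod z)\<^sup>2" for z
    by (metis complex_norm_square mult.commute Re_complex_of_real)
  have "(family_dist ?M X Q (\<lambda>m. controlled R (\<lambda>_. k' m)) \<psi>' (\<lambda>m. controlled R (\<lambda>_. k m)) \<psi>)\<^sup>2
      = (\<Sum>m\<in>?M. \<Sum>T\<in>?A. \<Sum>b\<in>?B. ?F m T b)"
    unfolding family_dist_def family_norm_power2 inner_on_def sum_Pow_split[OF R] Re_sum c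
    by (intro sum.cong refl) (simp only: sum.cartesian_product' fst_conv snd_conv, rule sum_rotate)
  also have "\<dots> = (\<Sum>m\<in>?M. \<Sum>T\<in>?A. \<Sum>b\<in>?B.
      ?G m T b)"
  proof (intro sum.cong refl)
    fix m T b assume "T \<in> ?A" "b \<in> ?B"
    then have "snd b \<inter> R = {}" "T \<subseteq> R" by auto
    then show "?F m T b
      = ?G m T b"
      by (simp add: controlled_union)
  qed
  also have "\<dots> = hs_dist2 ?B (osqrt ?B (marginal ?A (\<lambda>T a. \<psi>' (fst a, snd a \<union> T)))) (osqrt ?B (marginal ?A (\<lambda>T a. \<psi> (fst a, snd a \<union> T))))"
    by (rule canonical_kraus_dist[OF finA finB _ k k']) simp
  finally show ?thesis .
qed

section \<open>Protocol states and the information revealed by Alice\<close>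

lemma finite_bitstrings [simp]: "finite (bitstrings n)"
  using finite_lists_length_eq[of "UNIV :: bool set" n] by (simp add: bitstrings_def)

lemma card_bitstrings: "card (bitstrings n) = 2 ^ n"
  using card_lists_length_eq[of "UNIV :: bool set" n] by (simp add: bitstrings_def)

lemma bitstrings_0 [simp]: "bitstrings 0 = {[]}"
  by (auto simp: bitstrings_def)

lemma sum_bitstrings_append:
  assumes "m \<le> n"
  shows "(\<Sum>x\<in>bitstrings n. f x) = (\<Sum>u\<in>bitstrings m. \<Sum>y\<in>bitstrings (n - m). f (u @ y))"
proof -
  have "(\<Sum>x\<in>bitstrings n. f x) = (\<Sum>(u, y)\<in>bitstrings m \<times> bitstrings (n - m). f (u @ y))"
    by (rule sum.reindex_bij_witness[of _ "\<lambda>(u, y). u @ y" "\<lambda>x. (take m x, drop m x)"])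
       (use assms in \<open>auto simp: bitstrings_def\<close>)
  then show ?thesis by (simp add: sum.cartesian_product)
qed

lemma sum_bitstrings_snoc:
  "(\<Sum>x\<in>bitstrings (Suc m). f x) = (\<Sum>u\<in>bitstrings m. f (u @ [True]) + f (u @ [False]))"
proof -
  have "bitstrings (Suc m - m) = {[True], [False]}"
    by (auto simp: bitstrings_def length_Suc_conv)
  then show ?thesis by (simp add: sum_bitstrings_append[of m "Suc m"])
qed

lemma sum_bitstrings_prefix:
  assumes "length z \<le> n"
  shows "(\<Sum>x\<in>bitstrings n. if take (length z) x = z then f x else 0) = (\<Sum>y\<in>bitstrings (n - length z). f (z @ y))"
proof -
  have "z @ drop (length z) x = x" if "take (length z) x = z" for x
    using append_take_drop_id[of "length z" x] that by simp
  then show ?thesis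
    unfolding sum.inter_filter[OF finite_bitstrings, symmetric] using assms
    by (intro sum.reindex_bij_witness[of _ "\<lambda>y. z @ y" "drop (length z)"]) (auto simp: bitstrings_def)
qed

definition workspace :: "protocol \<Rightarrow> nat \<Rightarrow> bool \<Rightarrow> bool list \<Rightarrow> nat \<Rightarrow> nat set \<Rightarrow> complex" where
  "workspace p k b x i = (\<lambda>S. run p k (\<lambda>_. b) (\<lambda>_. 1) i (x, S))"

lemma run_workspace: "run p k \<beta> a i (x, S) = a x * workspace p k (\<beta> x) x i S"
  unfolding workspace_def
  by (induction i arbitrary: S) (simp_all add: controlled_def sum_distrib_left mult.left_commute)

text \<open>The run on the uniform superposition of the inputs with prefix \<open>u\<close>; the register holds only the remaining bits.\<close>

definition slice :: "nat \<Rightarrow> protocol \<Rightarrow> nat \<Rightarrow> bool \<Rightarrow> bool list \<Rightarrow> nat \<Rightarrow> joint_state" where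
  "slice n p k b u i =
     (\<lambda>(y, S). of_real (1 / sqrt (2 ^ (n - length u))) * workspace p k b (u @ y) i S)"

lemma slice_alice:
  "even i \<Longrightarrow> slice n p k b u (Suc i) =
     controlled (alice_qubits p i) (\<lambda>y. alice_op p (Suc i) (u @ y)) (slice n p k b u i)"
  by (auto simp: slice_def workspace_def controlled_def sum_distrib_left mult.left_commute fun_eq_iff)

text \<open>Under \<open>k - 1 \<le> length u\<close>, the prefix that Bob reads lies in the fixed
  part \<open>u\<close>, so his move becomes independent of the register.\<close>

lemma slice_bob:
  "odd i \<Longrightarrow> k - 1 \<le> length u \<Longrightarrow> slice n p k b u (Suc i) =
     controlled (bob_qubits p i) (\<lambda>_. bob_op p (Suc i) k b (take (k - 1) u)) (slice n p k b u i)"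
  by (auto simp: slice_def workspace_def controlled_def sum_distrib_left mult.left_commute fun_eq_iff)

lemma alice_qubits_subset:
  assumes "protocol_for n t p" "i \<le> t"
  shows "alice_qubits p i \<subseteq> qubits p"
  using assms(2)
proof (induction i)
  case 0
  then show ?case using assms(1) by (simp add: protocol_for_def)
next
  case (Suc i)
  have "message p (Suc i) \<subseteq> bob_qubits p i" if "even (Suc i)"
  proof -
    have "message p (Suc i) \<subseteq> bob_qubits p (Suc i - 1)"
      using assms(1) Suc.prems that unfolding protocol_for_def
      by (metis atLeastAtMost_iff le_add1 plus_1_eq_Suc)
    then show ?thesis by simp
  qed
  then show ?case using Suc by (auto simp: bob_qubits_def)
qed

lemma bob_qubits_subset: "bob_qubits p i \<subseteq> qubits p"
  by (auto simp: bob_qubits_def)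

lemma isometry_alice:
  assumes p: "protocol_for n t p" and i: "i < t" "even i" and u: "length u \<le> n"
  shows "isometries {()} (bitstrings (n - length u)) (qubits p)
           (\<lambda>_. controlled (alice_qubits p i) (\<lambda>y. alice_op p (Suc i) (u @ y)))"
proof (rule isometry_controlled)
  show "finite (qubits p)" using p by (simp add: protocol_for_def)
  show "alice_qubits p i \<subseteq> qubits p" using alice_qubits_subset[OF p] i by simp
  fix y assume "y \<in> bitstrings (n - length u)"
  then have "u @ y \<in> bitstrings n" using u by (simp add: bitstrings_def)
  moreover have "\<forall>x\<in>bitstrings n. unitary_on (Pow (alice_qubits p (Suc i - 1))) (alice_op p (Suc i) x)"
    using p i unfolding protocol_for_def by (metis Suc_leI atLeastAtMost_iff even_Suc le_add1 plus_1_eq_Suc)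
  ultimately show "isometric {()} (Pow (alice_qubits p i)) (\<lambda>_. alice_op p (Suc i) (u @ y))"
    by (intro isometric_unitary) simp
qed simp

lemma isometry_bob:
  assumes p: "protocol_for n t p" and i: "i < t" "odd i" and k: "k \<in> {1..n}" and u: "k - 1 \<le> length u"
  shows "isometries {()} (bitstrings m) (qubits p)
           (\<lambda>_. controlled (bob_qubits p i) (\<lambda>_. bob_op p (Suc i) k b (take (k - 1) u)))"
proof (rule isometry_controlled)
  show "finite (qubits p)" using p by (simp add: protocol_for_def)
  show "bob_qubits p i \<subseteq> qubits p" by (rule bob_qubits_subset)
  have "take (k - 1) u \<in> bitstrings (k - 1)" using u by (simp add: bitstrings_def)
  moreover have "\<forall>k\<in>{1..n}. \<forall>b. \<forall>z\<in>bitstrings (k - 1). unitary_on (Pow (bob_qubits p (Suc i - 1))) (bob_op p (Suc i) k b z)"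
    using p i unfolding protocol_for_def by (metis Suc_leI atLeastAtMost_iff even_Suc le_add1 plus_1_eq_Suc)
  ultimately show "isometric {()} (Pow (bob_qubits p i)) (\<lambda>_. bob_op p (Suc i) k b (take (k - 1) u))" for y
    using k by (intro isometric_unitary) simp
qed simp

lemma slice_unit:
  assumes p: "protocol_for n t p" and k: "k \<in> {1..n}" "k - 1 \<le> length u" and u: "length u \<le> n" and "i \<le> t"
  shows "inner_on (bitstrings (n - length u)) (qubits p) (slice n p k b u i) (slice n p k b u i) = 1"
  using \<open>i \<le> t\<close>
proof (induction i)
  case 0
  have *: "cnj (x * z) * (x * z) = of_real ((cmod x)\<^sup>2 * (cmod z)\<^sup>2)" for x z
    unfolding of_real_mult complex_norm_square by simp
  have "inner_on (bitstrings (n - length u)) (qubits p) (slice n p k b u 0) (slice n p k b u 0)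
      = (\<Sum>y\<in>bitstrings (n - length u). \<Sum>S\<in>Pow (qubits p). of_real (1 / 2 ^ (n - length u) * (cmod (shared_state p S))\<^sup>2))"
    unfolding inner_on_def slice_def workspace_def prod.case * by (simp add: norm_divide power_divide)
  also have "\<dots> = of_real (\<Sum>y\<in>bitstrings (n - length u). 1 / 2 ^ (n - length u) * (\<Sum>S\<in>Pow (qubits p). (cmod (shared_state p S))\<^sup>2))"
    by (simp add: sum_distrib_left)
  also have "(\<Sum>S\<in>Pow (qubits p). (cmod (shared_state p S))\<^sup>2) = 1" using p by (simp add: protocol_for_def)
  finally show ?case by (simp add: card_bitstrings)
next
  case (Suc i)
  show ?case
  proof (cases "even i")
    case True
    then show ?thesis using Suc isometry_alice[OF p _ True u] unfolding slice_alice[OF True]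
      by (simp add: isometries_def)
  next
    case False
    then show ?thesis using Suc isometry_bob[OF p _ False k] unfolding slice_bob[OF False k(2)]
      by (simp add: isometries_def)
  qed
qed

lemma slice_eq_workspace: "length x = n \<Longrightarrow> slice n p k b x i ([], S) = workspace p k b x i S"
  by (simp add: slice_def)

lemma workspace_unit:
  assumes "protocol_for n t p" "k \<in> {1..n}" "i \<le> t" "x \<in> bitstrings n"
  shows "(\<Sum>S\<in>Pow (qubits p). cnj (workspace p k b x i S) * workspace p k b x i S) = 1"
  using slice_unit[OF assms(1,2) _ _ assms(3), of x b] assms(2,4)
  by (auto simp: bitstrings_def inner_on_def slice_eq_workspace)

section \<open>Bob's reduced states given a prefix of the input\<close>

lemma reduced_marginal:
  "reduced p R \<Psi> = marginal (Pow (qubits p - R)) (\<lambda>T a. \<Psi> (fst a, snd a \<union> T))"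
  by (auto simp: reduced_def ptrace_snd_def pure_op_def marginal_def fun_eq_iff)

definition bob_state :: "nat \<Rightarrow> protocol \<Rightarrow> nat \<Rightarrow> bool \<Rightarrow> bool list \<Rightarrow> nat \<Rightarrow> nat set oper" where
  "bob_state n p k b u i =
     marginal (bitstrings (n - length u) \<times> Pow (alice_qubits p i)) (\<lambda>a S. slice n p k b u i (fst a, S \<union> snd a))"

text \<open>The register is on the side traced out and is only read, so a superposition of the
  remaining bits acts on Bob like their uniform mixture.\<close>

lemma bob_state_average:
  assumes "length u \<le> m" "m \<le> n"
  shows "bob_state n p k b u i S S'
    = (\<Sum>y\<in>bitstrings (m - length u). of_real (1 / 2 ^ (m - length u)) * bob_state n p k b (u @ y) i S S')"
proof -
  let ?w = "\<lambda>x T. workspace p k b x i (S \<union> T) * cnj (workspace p k b x i (S' \<union> T))"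
  have e: "bob_state n p k b v i S S'
      = of_real (1 / 2 ^ (n - length v)) * (\<Sum>y\<in>bitstrings (n - length v). \<Sum>T\<in>Pow (alice_qubits p i). ?w (v @ y) T)"
    for v
  proof -
    have "complex_of_real (1 / sqrt (2 ^ (n - length v))) * of_real (1 / sqrt (2 ^ (n - length v))) = of_real (1 / 2 ^ (n - length v))"
      unfolding of_real_mult[symmetric] by simp
    then have "slice n p k b v i (y, S \<union> T) * cnj (slice n p k b v i (y, S' \<union> T)) = of_real (1 / 2 ^ (n - length v)) * ?w (v @ y) T" for y T
      by (simp add: slice_def) 
    then show ?thesis
      by (simp add: bob_state_def marginal_def sum.cartesian_product' sum_distrib_left)
  qed
  have "(\<Sum>y\<in>bitstrings (m - length u). of_real (1 / 2 ^ (m - length u)) * bob_state n p k b (u @ y) i S S')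
      = (\<Sum>y\<in>bitstrings (m - length u). of_real (1 / 2 ^ (n - length u)) * (\<Sum>y'\<in>bitstrings (n - length u - (m - length u)). \<Sum>T\<in>Pow (alice_qubits p i). ?w (u @ y @ y') T))"
  proof (rule sum.cong[OF refl])
    fix y assume "y \<in> bitstrings (m - length u)"
    then have l: "length (u @ y) = m" using assms by (simp add: bitstrings_def)
    have "(2::real) ^ (n - length u) = 2 ^ (m - length u) * 2 ^ (n - m)"
      using assms by (simp flip: power_add)
    then have "complex_of_real (1 / 2 ^ (m - length u)) * of_real (1 / 2 ^ (n - m)) = of_real (1 / 2 ^ (n - length u))"
      unfolding of_real_mult[symmetric] by simp
    moreover have "n - length u - (m - length u) = n - m" using assms by simp
    ultimately show "of_real (1 / 2 ^ (m - length u)) * bob_state n p k b (u @ y) i S S'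
      = of_real (1 / 2 ^ (n - length u)) * (\<Sum>y'\<in>bitstrings (n - length u - (m - length u)). \<Sum>T\<in>Pow (alice_qubits p i). ?w (u @ y @ y') T)"
      unfolding e l by (simp add: mult.assoc[symmetric] del: of_real_divide)
  qed
  also have "\<dots> = bob_state n p k b u i S S'"
    unfolding e sum_distrib_left[symmetric]
    using assms by (subst sum_bitstrings_append[of "m - length u" "n - length u"]) auto
  finally show ?thesis by simp
qed

lemma psd_bob_state: "psd_on B (bob_state n p k b u i)"
  unfolding bob_state_def by (rule psd_marginal)

lemma trace_bob_state:
  assumes p: "protocol_for n t p" and k: "k \<in> {1..n}" "k - 1 \<le> length u" and u: "length u \<le> n" and i: "i \<le> t"
  shows "otrace (Pow (bob_qubits p i)) (bob_state n p k b u i) = 1"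
proof -
  have "inner_on (bitstrings (n - length u)) (qubits p) (slice n p k b u i) (slice n p k b u i)
      = otrace (Pow (bob_qubits p i)) (bob_state n p k b u i)"
    unfolding inner_on_def sum_Pow_split[OF alice_qubits_subset[OF p i]] otrace_def bob_state_def marginal_def bob_qubits_def
    by (subst sum.swap) (simp add: sum.cartesian_product' mult.commute)
  then show ?thesis using slice_unit[OF assms] by simp
qed

text \<open>The conditional entropy of Bob's qubits given \<open>X[1,m]\<close> when his index is
  \<open>k \<le> m\<close> and his bit is the \<open>k\<close>-th bit of the prefix.\<close>

definition prefix_entropy :: "nat \<Rightarrow> protocol \<Rightarrow> nat \<Rightarrow> nat \<Rightarrow> nat \<Rightarrow> real" where
  "prefix_entropy n p k i m =
     (\<Sum>u\<in>bitstrings m. vn_entropy (Pow (bob_qubits p i)) (bob_state n p k (u ! (k - 1)) u i)) / 2 ^ m"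

text \<open>The drop of entropy on the right is the information in Bob's qubits about bit
  \<open>m + 1\<close> given the earlier bits, that is, the average Holevo quantity of the pairs of
  states for the two values of that bit.\<close>

lemma prefix_entropy_step:
  assumes p: "protocol_for n t p" and k: "k \<in> {1..m}" and m: "m < n" and i: "i \<le> t"
  shows "(\<Sum>w\<in>bitstrings m. \<Sum>c\<in>UNIV.
            hs_dist2 (Pow (bob_qubits p i)) (osqrt (Pow (bob_qubits p i)) (bob_state n p k (w ! (k - 1)) (w @ [\<not> c]) i))
              (osqrt (Pow (bob_qubits p i)) (bob_state n p k (w ! (k - 1)) (w @ [c]) i))) / 2 ^ Suc m
       \<le> 4 * ln 2 * (prefix_entropy n p k i m - prefix_entropy n p k i (Suc m))"
proof -
  let ?B = "Pow (bob_qubits p i)"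
  let ?\<rho> = "\<lambda>w u. bob_state n p k (w ! (k - 1)) u i"
  let ?R = "\<lambda>w u. osqrt ?B (?\<rho> w u)"
  let ?H = "\<lambda>w. \<Sum>c\<in>UNIV. hs_dist2 ?B (?R w (w @ [\<not> c])) (?R w (w @ [c]))"
  have finB: "finite ?B" using p finite_subset[OF bob_qubits_subset] by (auto simp: protocol_for_def)
  have "?H w
      \<le> 4 * ln 2 * (2 * vn_entropy ?B (?\<rho> w w) - (\<Sum>c\<in>UNIV. vn_entropy ?B (?\<rho> w (w @ [c]))))"
    if w: "w \<in> bitstrings m" for w
  proof -
    have lw: "length w = m" using w by (simp add: bitstrings_def)
    define \<sigma> where "\<sigma> = (\<lambda>a b. \<Sum>c\<in>UNIV. complex_of_real (1 / 2) * ?\<rho> w (w @ [c]) a b)"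
    have bs: "bitstrings (Suc m - m) = {[True], [False]}"
      by (auto simp: bitstrings_def length_Suc_conv)
    have eq: "\<sigma> = ?\<rho> w w"
      unfolding \<sigma>_def using m lw bob_state_average[of w "Suc m" n] bs
      by (auto simp: fun_eq_iff UNIV_bool)
    have "(\<Sum>c\<in>UNIV. 1 / 2 * hs_dist2 ?B (?R w (w @ [c])) (osqrt ?B \<sigma>))
        \<le> ln 2 * (vn_entropy ?B \<sigma> - (\<Sum>c\<in>UNIV. 1 / 2 * vn_entropy ?B (?\<rho> w (w @ [c]))))"
      unfolding \<sigma>_def
      by (rule holevo_hs_bound[OF finB]) (use psd_bob_state trace_bob_state[OF p _ _ _ i] k m lw in \<open>auto simp: UNIV_bool\<close>)
    moreover have "hs_dist2 ?B (?R w (w @ [\<not> c])) (?R w (w @ [c])) \<le> 2 * (hs_dist2 ?B (?R w (w @ [\<not> c])) (osqrt ?B \<sigma>) + hs_dist2 ?B (?R w (w @ [c])) (osqrt ?B \<sigma>))" for c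
      by (rule hs_dist2_triangle)
    \<comment> \<open>The triangle inequality costs 2, each distance to the mean occurs for both
      values of \<open>c\<close>, and the weights \<open>1 / 2\<close> contribute another 2.\<close>
    from this[of True] this[of False] have "?H w
        \<le> 8 * (\<Sum>c\<in>UNIV. 1 / 2 * hs_dist2 ?B (?R w (w @ [c])) (osqrt ?B \<sigma>))"
      by (simp add: UNIV_bool)
    ultimately have "?H w
        \<le> 8 * (ln 2 * (vn_entropy ?B \<sigma> - (\<Sum>c\<in>UNIV. 1 / 2 * vn_entropy ?B (?\<rho> w (w @ [c])))))" by linarith
    then show ?thesis unfolding eq by (simp add: UNIV_bool algebra_simps)
  qed
  then have "(\<Sum>w\<in>bitstrings m. \<Sum>c\<in>UNIV. hs_dist2 ?B (?R w (w @ [\<not> c])) (?R w (w @ [c])))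
      \<le> (\<Sum>w\<in>bitstrings m. 4 * ln 2 * (2 * vn_entropy ?B (?\<rho> w w) - (\<Sum>c\<in>UNIV. vn_entropy ?B (?\<rho> w (w @ [c])))))"
    by (rule sum_mono)
  also have "\<dots> = 4 * ln 2 * (2 * (\<Sum>w\<in>bitstrings m. vn_entropy ?B (?\<rho> w w)) - (\<Sum>w\<in>bitstrings m. \<Sum>c\<in>UNIV. vn_entropy ?B (?\<rho> w (w @ [c]))))"
    by (simp only: sum_distrib_left sum_subtractf right_diff_distrib)
  also have "(\<Sum>w\<in>bitstrings m. \<Sum>c\<in>UNIV. vn_entropy ?B (?\<rho> w (w @ [c]))) = (\<Sum>u\<in>bitstrings (Suc m). vn_entropy ?B (?\<rho> u u))"
    unfolding sum_bitstrings_snoc using k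
    by (intro sum.cong refl) (auto simp: UNIV_bool bitstrings_def nth_append)
  finally show ?thesis
    by (simp add: prefix_entropy_def field_simps)
qed

text \<open>Conditioning on further bits cannot raise the entropy, as each drop dominates a squared
  distance.\<close>

lemma prefix_entropy_antimono:
  assumes p: "protocol_for n t p" and k: "k \<in> {1..m}" and m: "m \<le> m'" "m' \<le> n" and i: "i \<le> t"
  shows "prefix_entropy n p k i m' \<le> prefix_entropy n p k i m"
  using m(1) m(2)
proof (induction m' rule: dec_induct)
  case (step j)
  have "0 \<le> 4 * ln 2 * (prefix_entropy n p k i j - prefix_entropy n p k i (Suc j))"
    by (rule order_trans[OF _ prefix_entropy_step[OF p _ _ i]])
       (use k step in \<open>auto intro!: divide_nonneg_nonneg sum_nonneg hs_dist2_nonneg\<close>)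
  then show ?case using step by (simp add: zero_le_mult_iff)
qed simp

lemma mutual_info_prefix:
  assumes p: "protocol_for n t p" and k: "k \<in> {1..n}" and i: "i \<le> t" and z: "z \<in> bitstrings k"
  defines "B \<equiv> Pow (bob_qubits p i)"
  shows "mutual_info (bitstrings n) B (given_prefix z (measure_register (reduced p (bob_qubits p i) (run0 n p k i))))
    = vn_entropy B (bob_state n p k (z ! (k - 1)) z i)
      - (\<Sum>y\<in>bitstrings (n - k). vn_entropy B (bob_state n p k ((z @ y) ! (k - 1)) (z @ y) i)) / 2 ^ (n - k)"
proof -
  let ?\<omega> = "given_prefix z (measure_register (reduced p (bob_qubits p i) (run0 n p k i)))"
  let ?\<rho> = "\<lambda>x. bob_state n p k (x ! (k - 1)) x i"
  \<comment> \<open>The register distribution conditioned on the prefix: uniform over the extensions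
    of \<open>z\<close>. It arises from \<open>2^-n\<close> and the factor \<open>2^k\<close> in
    \<open>given_prefix\<close>.\<close>
  define q where "q x = (if take k x = z then 1 / 2 ^ (n - k) else 0 :: real)" for x
  have lz: "length z = k" using z by (simp add: bitstrings_def)
  have finB: "finite B" unfolding B_def using p finite_subset[OF bob_qubits_subset] by (auto simp: protocol_for_def)
  have qb: "qubits p - bob_qubits p i = alice_qubits p i"
    using alice_qubits_subset[OF p i] by (auto simp: bob_qubits_def)
  have zn: "length z \<le> n" using k lz by simp
  have split: "(\<Sum>x\<in>bitstrings n. q x * f x) = (\<Sum>y\<in>bitstrings (n - k). f (z @ y)) / 2 ^ (n - k)" for f :: "bool list \<Rightarrow> real"
  proof -
    have "(\<Sum>x\<in>bitstrings n. q x * f x) = (\<Sum>x\<in>bitstrings n. if take (length z) x = z then f x / 2 ^ (n - k) else 0)"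
      by (intro sum.cong refl) (simp add: q_def lz)
    then show ?thesis unfolding sum_bitstrings_prefix[OF zn] by (simp add: lz sum_divide_distrib)
  qed
  have splitc: "(\<Sum>x\<in>bitstrings n. of_real (q x) * f x) = (\<Sum>y\<in>bitstrings (n - k). of_real (1 / 2 ^ (n - k)) * f (z @ y))"
    for f :: "bool list \<Rightarrow> complex"
  proof -
    have "(\<Sum>x\<in>bitstrings n. of_real (q x) * f x)
        = (\<Sum>x\<in>bitstrings n. if take (length z) x = z then of_real (1 / 2 ^ (n - k)) * f x else 0)"
      by (intro sum.cong refl) (simp add: q_def lz)
    then show ?thesis
      using sum_bitstrings_prefix[OF zn, of "\<lambda>x. complex_of_real (1 / 2 ^ (n - k)) * f x"] by (simp only: lz)
  qed
  have "mutual_info (bitstrings n) B ?\<omega> = vn_entropy B (\<lambda>b b'. \<Sum>x\<in>bitstrings n. of_real (q x) * ?\<rho> x b b')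
      - (\<Sum>x\<in>bitstrings n. q x * vn_entropy B (?\<rho> x))"
  proof (rule mutual_info_classical_quantum)
    fix x assume x: "x \<in> bitstrings n"
    show "0 \<le> q x" by (simp add: q_def)
    show "psd_on B (?\<rho> x)" by (rule psd_bob_state)
    show "otrace B (?\<rho> x) = 1" unfolding B_def
      by (rule trace_bob_state[OF p k _ _ i]) (use x k in \<open>auto simp: bitstrings_def\<close>)
    fix S x' S' assume x': "x' \<in> bitstrings n" and S: "S \<in> B" "S' \<in> B"
    have lx: "length x = n" using x by (simp add: bitstrings_def)
    have w2: "2 ^ k * (complex_of_real (1 / sqrt (2 ^ n)) * of_real (1 / sqrt (2 ^ n))) = of_real (1 / 2 ^ (n - k))"
    proof -
      have "(2::real) ^ n = 2 ^ k * 2 ^ (n - k)" using k by (simp flip: power_add)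
      then have "(2::real) ^ k * (1 / sqrt (2 ^ n) * (1 / sqrt (2 ^ n))) = 1 / 2 ^ (n - k)" by simp
      then show ?thesis by (metis of_real_mult of_real_numeral of_real_power)
    qed
    have r: "reduced p (bob_qubits p i) (run0 n p k i) (x, S) (x, S')
       = (of_real (1 / sqrt (2 ^ n)) * of_real (1 / sqrt (2 ^ n))) * ?\<rho> x S S'"
      using x lx by (simp add: reduced_marginal marginal_def run0_def run_workspace qb bob_state_def
          sum.cartesian_product' slice_eq_workspace sum_distrib_left mult_ac del: of_real_divide)
    show "?\<omega> (x, S) (x', S') = of_bool (x = x') * of_real (q x) * ?\<rho> x S S'"
    proof (cases "x = x' \<and> take k x = z")
      case True
      then have tr: "x' = x" "take k x = z" by auto
      then have "?\<omega> (x, S) (x', S') = 2 ^ k * reduced p (bob_qubits p i) (run0 n p k i) (x, S) (x, S')"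
        by (simp add: given_prefix_def measure_register_def lz)
      also have "\<dots> = of_real (1 / 2 ^ (n - k)) * ?\<rho> x S S'"
        unfolding r mult.assoc[symmetric] w2[symmetric] by simp
      finally show ?thesis using tr by (simp add: q_def)
    next
      case False
      then show ?thesis by (auto simp: given_prefix_def measure_register_def lz q_def)
    qed
  qed (use finB in auto)
  also have "(\<lambda>b b'. \<Sum>x\<in>bitstrings n. of_real (q x) * ?\<rho> x b b') = ?\<rho> z"
  proof (intro ext)
    fix b b'
    have "(\<Sum>x\<in>bitstrings n. of_real (q x) * ?\<rho> x b b') = (\<Sum>y\<in>bitstrings (n - k). of_real (1 / 2 ^ (n - k)) * ?\<rho> (z @ y) b b')"
      by (rule splitc)
    also have "\<dots> = (\<Sum>y\<in>bitstrings (n - length z). of_real (1 / 2 ^ (n - length z)) * bob_state n p k (z ! (k - 1)) (z @ y) i b b')"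
      using k by (simp add: lz nth_append)
    also have "\<dots> = ?\<rho> z b b'" by (rule bob_state_average[symmetric]) (use k lz in auto)
    finally show "(\<Sum>x\<in>bitstrings n. of_real (q x) * ?\<rho> x b b') = ?\<rho> z b b'" .
  qed
  finally show ?thesis unfolding split .
qed

definition alice_info :: "nat \<Rightarrow> protocol \<Rightarrow> nat \<Rightarrow> real" where
  "alice_info n p i = (\<Sum>k=1..n. prefix_entropy n p k i k - prefix_entropy n p k i n) / real n"

lemma QIC_A_alice_info:
  assumes "protocol_for n t p"
  shows "QIC_A n t p = (\<Sum>i | i \<in> {1..t} \<and> odd i. alice_info n p i)"
  unfolding QIC_A_def alice_info_def sum_divide_distrib
proof (intro sum.cong refl)
  fix i k assume "i \<in> {i. i \<in> {1..t} \<and> odd i}" and k: "k \<in> {1..n}"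
  then have i: "i \<le> t" by simp
  let ?B = "Pow (bob_qubits p i)"
  let ?e = "\<lambda>u. vn_entropy ?B (bob_state n p k (u ! (k - 1)) u i)"
  have "(\<Sum>z\<in>bitstrings k. 1 / (real n * 2 ^ k) *
          mutual_info (bitstrings n) ?B (given_prefix z (measure_register (reduced p (bob_qubits p i) (run0 n p k i)))))
      = (\<Sum>z\<in>bitstrings k. 1 / (real n * 2 ^ k) * (?e z - (\<Sum>y\<in>bitstrings (n - k). ?e (z @ y)) / 2 ^ (n - k)))"
    using mutual_info_prefix[OF assms k i] by (intro sum.cong refl) simp
  also have "\<dots> = 1 / (real n * 2 ^ k) * ((\<Sum>z\<in>bitstrings k. ?e z) - (\<Sum>z\<in>bitstrings k. \<Sum>y\<in>bitstrings (n - k). ?e (z @ y)) / 2 ^ (n - k))"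
    by (simp only: sum_distrib_left[symmetric] sum_subtractf sum_divide_distrib[symmetric])
  also have "(\<Sum>z\<in>bitstrings k. \<Sum>y\<in>bitstrings (n - k). ?e (z @ y)) = (\<Sum>x\<in>bitstrings n. ?e x)"
    by (rule sum_bitstrings_append[symmetric]) (use k in simp)
  also have "1 / (real n * 2 ^ k) * ((\<Sum>z\<in>bitstrings k. ?e z) - (\<Sum>x\<in>bitstrings n. ?e x) / 2 ^ (n - k))
      = ((\<Sum>z\<in>bitstrings k. ?e z) / 2 ^ k - (\<Sum>x\<in>bitstrings n. ?e x) / (2 ^ k * 2 ^ (n - k))) / real n"
    by (simp add: diff_divide_distrib right_diff_distrib mult.commute)
  also have "(2::real) ^ k * 2 ^ (n - k) = 2 ^ n" using k by (simp flip: power_add)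
  finally show "(\<Sum>z\<in>bitstrings k. 1 / (real n * 2 ^ k) *
          mutual_info (bitstrings n) ?B (given_prefix z (measure_register (reduced p (bob_qubits p i) (run0 n p k i)))))
      = (prefix_entropy n p k i k - prefix_entropy n p k i n) / real n"
    by (simp only: prefix_entropy_def)
qed

section \<open>Comparison of runs with different inputs\<close>

abbreviation alice_labels :: "nat \<Rightarrow> protocol \<Rightarrow> nat \<Rightarrow> (bool list \<times> nat set) set" where
  "alice_labels n p i \<equiv> bitstrings n \<times> Pow (alice_qubits p i)"

abbreviation alice_state :: "nat \<Rightarrow> protocol \<Rightarrow> nat \<Rightarrow> nat \<Rightarrow> (bool list \<times> nat set) oper" where
  "alice_state n p k i \<equiv> reduced p (alice_qubits p i) (run0 n p k i)"

lemma trace_alice_state: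
  assumes p: "protocol_for n t p" and k: "k \<in> {1..n}" and i: "i \<le> t"
  shows "otrace (alice_labels n p i) (alice_state n p k i) = 1"
proof -
  have w: "complex_of_real (1 / sqrt (2 ^ n)) * of_real (1 / sqrt (2 ^ n)) = of_real (1 / 2 ^ n)"
    unfolding of_real_mult[symmetric] by simp
  have Q: "qubits p - bob_qubits p i = alice_qubits p i" "qubits p - alice_qubits p i = bob_qubits p i"
    using alice_qubits_subset[OF p i] by (auto simp: bob_qubits_def)
  have "otrace (alice_labels n p i) (alice_state n p k i)
      = (\<Sum>x\<in>bitstrings n. \<Sum>S\<in>Pow (alice_qubits p i). \<Sum>T\<in>Pow (bob_qubits p i).
          run0 n p k i (x, S \<union> T) * cnj (run0 n p k i (x, S \<union> T)))"
    unfolding otrace_def reduced_marginal marginal_def Q by (simp add: sum.cartesian_product')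
  also have "\<dots> = (\<Sum>x\<in>bitstrings n. of_real (1 / 2 ^ n) *
      (\<Sum>S\<in>Pow (qubits p). cnj (workspace p k (x ! (k - 1)) x i S) * workspace p k (x ! (k - 1)) x i S))"
  proof (rule sum.cong[OF refl])
    fix x assume "x \<in> bitstrings n"
    then have "run0 n p k i (x, S) * cnj (run0 n p k i (x, S))
      = of_real (1 / 2 ^ n) * (cnj (workspace p k (x ! (k - 1)) x i S) * workspace p k (x ! (k - 1)) x i S)" for S
      unfolding w[symmetric] by (simp add: run0_def run_workspace mult_ac del: of_real_divide)
    then show "(\<Sum>S\<in>Pow (alice_qubits p i). \<Sum>T\<in>Pow (bob_qubits p i).
          run0 n p k i (x, S \<union> T) * cnj (run0 n p k i (x, S \<union> T)))
      = of_real (1 / 2 ^ n) * (\<Sum>S\<in>Pow (qubits p). cnj (workspace p k (x ! (k - 1)) x i S) * workspace p k (x ! (k - 1)) x i S)"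
      unfolding sum_Pow_split[OF bob_qubits_subset, of _ p i] Q(1) by (simp add: sum_distrib_left)
  qed
  also have "\<dots> = 1" using workspace_unit[OF p k i] by (simp add: card_bitstrings)
  finally show ?thesis .
qed

section \<open>Information revealed by Bob\<close>

definition bob_info :: "nat \<Rightarrow> protocol \<Rightarrow> nat \<Rightarrow> real" where
  "bob_info n p i = mutual_info {1..n} (alice_labels n p i) (index_alice_state n p i)"

lemma bob_info_bound:
  assumes p: "protocol_for n t p" and n: "n > 0" and i: "i \<le> t"
  defines "B \<equiv> bitstrings n \<times> Pow (alice_qubits p i)"
  shows "\<exists>Z. (\<Sum>k=1..n. hs_dist2 B (osqrt B (alice_state n p k i)) Z) \<le> real n * ln 2 * bob_info n p i"
proof -
  let ?\<rho> = "\<lambda>k. alice_state n p k i"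
  let ?\<sigma> = "\<lambda>b b'. \<Sum>k\<in>{1..n}. complex_of_real (1 / real n) * ?\<rho> k b b'"
  have finB: "finite B" unfolding B_def using p finite_subset[OF alice_qubits_subset[OF p i]] by (auto simp: protocol_for_def)
  have psd: "psd_on B (?\<rho> k)" for k unfolding reduced_marginal by (rule psd_marginal)
  have tr: "otrace B (?\<rho> k) = 1" if "k \<in> {1..n}" for k unfolding B_def by (rule trace_alice_state[OF p that i])
  have "bob_info n p i = vn_entropy B ?\<sigma> - (\<Sum>k\<in>{1..n}. 1 / real n * vn_entropy B (?\<rho> k))"
    unfolding bob_info_def B_def[symmetric]
    by (rule mutual_info_classical_quantum) (use finB psd tr in \<open>auto simp: index_alice_state_def\<close>)
  moreover have "(\<Sum>k\<in>{1..n}. 1 / real n * hs_dist2 B (osqrt B (?\<rho> k)) (osqrt B ?\<sigma>))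
      \<le> ln 2 * (vn_entropy B ?\<sigma> - (\<Sum>k\<in>{1..n}. 1 / real n * vn_entropy B (?\<rho> k)))"
    by (rule holevo_hs_bound[OF finB]) (use psd tr n in auto)
  ultimately have "(\<Sum>k\<in>{1..n}. hs_dist2 B (osqrt B (?\<rho> k)) (osqrt B ?\<sigma>)) / real n \<le> ln 2 * bob_info n p i"
    by (simp add: sum_divide_distrib)
  then have "(\<Sum>k\<in>{1..n}. hs_dist2 B (osqrt B (?\<rho> k)) (osqrt B ?\<sigma>)) \<le> real n * ln 2 * bob_info n p i"
    using n by (simp add: field_simps)
  then show ?thesis by blast
qed

text \<open>Chosen from the run on the full superposition, so that one family per round and index
  serves all prefixes. Before the first message that run does not depend on \<open>k\<close>, so the
  choice is the same for all indices.\<close>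

definition bob_kraus :: "nat \<Rightarrow> protocol \<Rightarrow> nat \<Rightarrow> nat \<Rightarrow> (bool list \<times> nat set) option \<Rightarrow> nat set oper" where
  "bob_kraus n p i k = (SOME \<kappa>. canonical_kraus (Pow (bob_qubits p i)) (alice_labels n p i) {}
     (\<lambda>T a. run0 n p k i (fst a, snd a \<union> T)) \<kappa>)"

lemma bob_kraus_canonical:
  assumes p: "protocol_for n t p" and i: "i \<le> t"
  shows "canonical_kraus (Pow (bob_qubits p i)) (alice_labels n p i) {}
     (\<lambda>T a. run0 n p k i (fst a, snd a \<union> T)) (bob_kraus n p i k)"
proof -
  have "finite (qubits p)" using p by (simp add: protocol_for_def)
  then have "finite (Pow (bob_qubits p i))" "finite (alice_labels n p i)"
    using finite_subset[OF bob_qubits_subset] finite_subset[OF alice_qubits_subset[OF p i]] by auto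
  from canonical_kraus_exists[OF this Pow_bottom] show ?thesis unfolding bob_kraus_def by (rule someI_ex)
qed

definition bob_family where
  "bob_family n p i k = (\<lambda>m. controlled (bob_qubits p i) (\<lambda>_. bob_kraus n p i k m))"

definition bob_outcomes :: "nat \<Rightarrow> protocol \<Rightarrow> nat \<Rightarrow> (bool list \<times> nat set) option set" where
  "bob_outcomes n p i = insert None (Some ` (alice_labels n p i))"

lemma isometric_bob_family:
  assumes p: "protocol_for n t p" and i: "i \<le> t"
  shows "isometries (bob_outcomes n p i) (bitstrings m) (qubits p) (bob_family n p i k)"
  unfolding bob_family_def bob_outcomes_def
  by (rule isometry_controlled)
     (use bob_kraus_canonical[OF assms] p bob_qubits_subset in \<open>auto simp: canonical_kraus_def protocol_for_def\<close>)

definition bob_dist :: "nat \<Rightarrow> protocol \<Rightarrow> nat \<Rightarrow> nat \<Rightarrow> bool list \<Rightarrow> nat \<Rightarrow> real" where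
  "bob_dist n p j l u i = family_dist (bob_outcomes n p i) (bitstrings (n - length u)) (qubits p)
     (bob_family n p i l) (slice n p l (u ! (l - 1)) u i) (bob_family n p i j) (slice n p j (u ! (j - 1)) u i)"

text \<open>The family leaves the register alone, so the squared distance on the full superposition
  is the average of those on the slices. This allows a bound per prefix although the information
  cost only sees the whole superposition.\<close>

lemma sum_bob_dist:
  assumes p: "protocol_for n t p" and i: "i \<le> t" and j: "j \<in> {1..m}" and l: "l \<in> {1..m}" and m: "m \<le> n"
  defines "B \<equiv> bitstrings n \<times> Pow (alice_qubits p i)"
  shows "(\<Sum>u\<in>bitstrings m. (bob_dist n p j l u i)\<^sup>2) / 2 ^ m
    = hs_dist2 B (osqrt B (alice_state n p l i)) (osqrt B (alice_state n p j i))"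
proof -
  let ?F = "\<lambda>\<mu> u y S. (cmod (bob_family n p i l \<mu> (run0 n p l i) (u @ y, S) - bob_family n p i j \<mu> (run0 n p j i) (u @ y, S)))\<^sup>2"
  have finQ: "finite (qubits p)" using p by (simp add: protocol_for_def)
  have Q: "qubits p - bob_qubits p i = alice_qubits p i" "qubits p - alice_qubits p i = bob_qubits p i"
    using alice_qubits_subset[OF p i] by (auto simp: bob_qubits_def)
  have c: "Re (cnj z * z) = (cmod z)\<^sup>2" for z
    by (metis complex_norm_square mult.commute Re_complex_of_real)
  have "hs_dist2 B (osqrt B (alice_state n p l i)) (osqrt B (alice_state n p j i))
      = (family_dist (bob_outcomes n p i) (bitstrings n) (qubits p) (bob_family n p i l) (run0 n p l i) (bob_family n p i j) (run0 n p j i))\<^sup>2"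
    using canonical_controlled_dist[of "bitstrings n" "qubits p" "bob_qubits p i", unfolded Q,
        OF _ finQ bob_qubits_subset bob_kraus_canonical[OF p i] bob_kraus_canonical[OF p i], of l j]
    by (simp add: B_def reduced_marginal Q bob_family_def bob_outcomes_def)
  also have "\<dots> = (\<Sum>\<mu>\<in>bob_outcomes n p i. \<Sum>u\<in>bitstrings m. \<Sum>y\<in>bitstrings (n - m). \<Sum>S\<in>Pow (qubits p).
      ?F \<mu> u y S)"
    unfolding family_dist_def family_norm_power2 inner_on_def Re_sum c
    by (rule sum.cong[OF refl]) (rule sum_bitstrings_append[OF m])
  also have "\<dots> = (\<Sum>u\<in>bitstrings m. \<Sum>\<mu>\<in>bob_outcomes n p i. \<Sum>y\<in>bitstrings (n - m). \<Sum>S\<in>Pow (qubits p).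
      ?F \<mu> u y S)"
    by (rule sum.swap)
  also have "\<dots> = (\<Sum>u\<in>bitstrings m. (bob_dist n p j l u i)\<^sup>2 / 2 ^ m)"
  proof (rule sum.cong[OF refl])
    fix u assume u: "u \<in> bitstrings m"
    then have lu: "length u = m" by (simp add: bitstrings_def)
    have r: "run0 n p k i (u @ y, S) = of_real (1 / sqrt (2 ^ m)) * slice n p k (u ! (k - 1)) u i (y, S)"
      if "y \<in> bitstrings (n - m)" "k \<in> {1..m}" for y S k
    proof -
      have "u @ y \<in> bitstrings n" "(u @ y) ! (k - 1) = u ! (k - 1)" using lu that m by (auto simp: bitstrings_def nth_append)
      moreover have "complex_of_real (1 / sqrt (2 ^ n)) = of_real (1 / sqrt (2 ^ m)) * of_real (1 / sqrt (2 ^ (n - m)))"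
        using m unfolding of_real_mult[symmetric] by (simp flip: real_sqrt_mult power_add)
      ultimately show ?thesis by (simp add: run0_def run_workspace slice_def lu mult.assoc del: of_real_divide)
    qed
    have f: "bob_family n p i k \<mu> (run0 n p k' i) (u @ y, S) = of_real (1 / sqrt (2 ^ m)) * bob_family n p i k \<mu> (slice n p k' (u ! (k' - 1)) u i) (y, S)"
      if "y \<in> bitstrings (n - m)" "k' \<in> {1..m}" for y S \<mu> k k'
      using r[OF that] by (simp add: bob_family_def controlled_def sum_distrib_left mult_ac del: of_real_divide)
    have d: "?F \<mu> u y S
      = (cmod (bob_family n p i l \<mu> (slice n p l (u ! (l - 1)) u i) (y, S) - bob_family n p i j \<mu> (slice n p j (u ! (j - 1)) u i) (y, S)))\<^sup>2 / 2 ^ m"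
      if "y \<in> bitstrings (n - m)" for y S \<mu>
      unfolding f[OF that l] f[OF that j] right_diff_distrib[symmetric] norm_mult power_mult_distrib
      by (simp add: norm_divide power_divide)
    show "(\<Sum>\<mu>\<in>bob_outcomes n p i. \<Sum>y\<in>bitstrings (n - m). \<Sum>S\<in>Pow (qubits p).
        ?F \<mu> u y S)
      = (bob_dist n p j l u i)\<^sup>2 / 2 ^ m"
      unfolding bob_dist_def family_dist_def family_norm_power2 inner_on_def Re_sum c lu sum_divide_distrib
      by (intro sum.cong refl) (rule d)
  qed
  finally show ?thesis by (simp add: sum_divide_distrib)
qed

section \<open>The hybrid argument on slices\<close>

definition prefix_dist2 :: "nat \<Rightarrow> protocol \<Rightarrow> nat \<Rightarrow> bool list \<Rightarrow> bool \<Rightarrow> nat \<Rightarrow> real" where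
  "prefix_dist2 n p j w c i = hs_dist2 (Pow (bob_qubits p i))
     (osqrt (Pow (bob_qubits p i)) (bob_state n p j (w ! (j - 1)) (w @ [\<not> c]) i))
     (osqrt (Pow (bob_qubits p i)) (bob_state n p j (w ! (j - 1)) (w @ [c]) i))"

definition round_dist :: "nat \<Rightarrow> protocol \<Rightarrow> nat \<Rightarrow> bool list \<Rightarrow> bool \<Rightarrow> nat \<Rightarrow> real" where
  "round_dist n p j w c i =
     (if odd i then sqrt (prefix_dist2 n p j w c i) else bob_dist n p j (Suc (length w)) (w @ [c]) i)"

text \<open>What Alice still holds after sending her own message she holds after both neighbouring
  messages of even number as well, so none of it is with Bob then.\<close>

lemma alice_bob_disjoint:
  assumes "odd i" "i' = Suc i \<or> i = Suc i'"
  shows "alice_qubits p i \<inter> bob_qubits p i' = {}"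
  using assms by (auto simp: bob_qubits_def)

text \<open>The clauses with \<open>local_op\<close> record that these isometries act on Alice's
  side only, so that for odd \<open>t\<close> they commute with Bob's final measurement.\<close>

lemma hybrid_slices:
  assumes p: "protocol_for n t p" and j: "j \<in> {1..length w}" and w: "length w < n"
  shows "\<exists>(M :: nat set option set) \<Theta> \<Theta>'. isometries M (bitstrings (n - Suc (length w))) (qubits p) \<Theta> \<and>
      isometries M (bitstrings (n - Suc (length w))) (qubits p) \<Theta>' \<and>
      (\<forall>m. \<exists>k. \<Theta> m = local_op (bitstrings (n - Suc (length w))) (alice_qubits p t) k) \<and>
      (\<forall>m. \<exists>k. \<Theta>' m = local_op (bitstrings (n - Suc (length w))) (alice_qubits p t) k) \<and>
      (if odd t then family_dist M (bitstrings (n - Suc (length w))) (qubits p)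
           \<Theta>' (slice n p (Suc (length w)) c (w @ [\<not> c]) t) \<Theta> (slice n p (Suc (length w)) c (w @ [c]) t)
       else family_dist (bob_outcomes n p t) (bitstrings (n - Suc (length w))) (qubits p)
           (bob_family n p t (Suc (length w))) (slice n p (Suc (length w)) c (w @ [\<not> c]) t)
           (bob_family n p t j) (slice n p j (w ! (j - 1)) (w @ [\<not> c]) t))
      \<le> (\<Sum>i<t. round_dist n p j w c i + round_dist n p j w c (Suc i))"
proof -
  let ?l = "Suc (length w)" and ?u = "w @ [c]" and ?u' = "w @ [\<not> c]" and ?b = "w ! (j - 1)"
  let ?Y = "bitstrings (n - Suc (length w))" and ?Q = "qubits p"
  let ?a0 = "(replicate (n - Suc (length w)) False, {} :: nat set)"
  \<comment> \<open>Unprimed runs use \<open>u\<close>, primed ones \<open>u'\<close>; the runs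
    named \<open>\<alpha>\<close> use index \<open>j\<close>, those named \<open>\<beta>\<close> use
    index \<open>l\<close> and bit \<open>c\<close>. Only in \<open>\<beta>'\<close> does Bob's bit
    differ from the indexed bit.\<close>
  define \<alpha> where "\<alpha> = slice n p j ?b ?u"
  define \<alpha>' where "\<alpha>' = slice n p j ?b ?u'"
  define \<beta> where "\<beta> = slice n p ?l c ?u"
  define \<beta>' where "\<beta>' = slice n p ?l c ?u'"
  have finQ: "finite ?Q" using p by (simp add: protocol_for_def)
  have lY: "n - length ?u = n - Suc (length w)" "n - length ?u' = n - Suc (length w)" by simp_all
  have a0: "?a0 \<in> ?Y \<times> Pow (alice_qubits p i)" for i by (simp add: bitstrings_def)
  let ?K = "\<lambda>\<psi> i. canonical_kraus (?Y \<times> Pow (alice_qubits p i)) (Pow (bob_qubits p i)) ?a0 (\<lambda>a S. \<psi> i (fst a, S \<union> snd a))"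
  have ex: "\<exists>k. i \<le> t \<longrightarrow> ?K \<psi> i k" for \<psi> :: "nat \<Rightarrow> joint_state" and i
  proof (cases "i \<le> t")
    case True
    show ?thesis
      using canonical_kraus_exists[OF _ _ a0, of i "Pow (bob_qubits p i)"] finQ
        finite_subset[OF bob_qubits_subset finQ] finite_subset[OF alice_qubits_subset[OF p True] finQ] by simp
  qed simp
  obtain \<tau> where \<tau>: "\<And>i. i \<le> t \<Longrightarrow> ?K \<alpha> i (\<tau> i)" using choice[of "\<lambda>i k. i \<le> t \<longrightarrow> ?K \<alpha> i k"] ex by blast
  obtain \<tau>' where \<tau>': "\<And>i. i \<le> t \<Longrightarrow> ?K \<alpha>' i (\<tau>' i)" using choice[of "\<lambda>i k. i \<le> t \<longrightarrow> ?K \<alpha>' i k"] ex by blast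
  define T where "T i m = local_op ?Y (alice_qubits p i) (\<tau> i m)" for i m
  define T' where "T' i m = local_op ?Y (alice_qubits p i) (\<tau>' i m)" for i m
  define M where "M i = insert None (Some ` Pow (bob_qubits p i))" for i
  define S where "S i = bob_family n p i j" for i
  define S' where "S' i = bob_family n p i ?l" for i
  define A where "A i = controlled (alice_qubits p i) (\<lambda>y. alice_op p (Suc i) (?u @ y))" for i
  define A' where "A' i = controlled (alice_qubits p i) (\<lambda>y. alice_op p (Suc i) (?u' @ y))" for i
  define B where "B i = controlled (bob_qubits p i) (\<lambda>_. bob_op p (Suc i) j ?b (take (j - 1) w))" for i
  define B' where "B' i = controlled (bob_qubits p i) (\<lambda>_. bob_op p (Suc i) ?l c w)" for i
  have isoT: "isometries (M i) ?Y ?Q (T i) \<and> isometries (M i) ?Y ?Q (T' i)" if "i \<le> t" for i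
    unfolding T_def T'_def M_def
    using \<tau>[OF that] \<tau>'[OF that] finQ alice_qubits_subset[OF p that]
    by (auto intro!: isometry_local_op simp: canonical_kraus_def)
  let ?D = "\<lambda>i. if odd i then family_dist (M i) ?Y ?Q (T' i) (\<beta>' i) (T i) (\<beta> i)
                   else family_dist (bob_outcomes n p i) ?Y ?Q (S' i) (\<beta>' i) (S i) (\<alpha>' i)"
  let ?g = "\<lambda>i. if odd i then family_dist (M i) ?Y ?Q (T' i) (\<alpha>' i) (T i) (\<alpha> i)
                   else family_dist (bob_outcomes n p i) ?Y ?Q (S' i) (\<beta> i) (S i) (\<alpha> i)"
  have zero: "family_dist I ?Y ?Q F \<psi> F \<psi> = 0" for I :: "'z set" and F \<psi>
    by (simp add: family_dist_def family_norm_def L2_set_def)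
  have start: "slice n p k d v 0 = slice n p k' d' v' 0" if "length v = length v'" for k k' d d' v v'
    using that by (simp add: slice_def workspace_def)
  \<comment> \<open>Before any move the index has left no trace, so the hybrid argument starts at
    distance zero.\<close>
  have "bob_kraus n p 0 j = bob_kraus n p 0 ?l" by (simp add: bob_kraus_def run0_def)
  then have S0: "S' 0 = S 0" by (simp add: S_def S'_def bob_family_def)
  have "?D t \<le> (\<Sum>i<t. ?g i + ?g (Suc i))"
  proof (rule hybrid_bound[where A = A and A' = A' and B = B and B' = B'])
    have "\<beta>' 0 = \<alpha>' 0" "\<beta> 0 = \<alpha> 0" unfolding \<alpha>_def \<alpha>'_def \<beta>_def \<beta>'_def by (intro start; simp)+
    then show "?D 0 = 0" "?g 0 = 0" by (simp_all add: S0 zero)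
  next
    fix i assume i: "i < t" "even i"
    show "\<alpha> (Suc i) = A i (\<alpha> i) \<and> \<beta> (Suc i) = A i (\<beta> i) \<and> \<alpha>' (Suc i) = A' i (\<alpha>' i) \<and> \<beta>' (Suc i) = A' i (\<beta>' i) \<and>
       isometries {()} ?Y ?Q (\<lambda>_. A i) \<and> isometries {()} ?Y ?Q (\<lambda>_. A' i)"
      using isometry_alice[OF p i, of ?u] isometry_alice[OF p i, of ?u'] w
      by (simp add: \<alpha>_def \<alpha>'_def \<beta>_def \<beta>'_def A_def A'_def slice_alice[OF i(2)])
  next
    fix i assume i: "i < t" "odd i"
    have l: "?l \<in> {1..n}" and jn: "j \<in> {1..n}" using w j by auto
    \<comment> \<open>What Bob reads with index \<open>j\<close> ends before position
      \<open>length w\<close>, so it is the same for \<open>u\<close> and \<open>u'\<close>.\<close>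
    have tk: "take (j - 1) (w @ v) = take (j - 1) w" for v using j by simp
    show "\<alpha> (Suc i) = B i (\<alpha> i) \<and> \<alpha>' (Suc i) = B i (\<alpha>' i) \<and> \<beta> (Suc i) = B' i (\<beta> i) \<and> \<beta>' (Suc i) = B' i (\<beta>' i) \<and>
       isometries {()} ?Y ?Q (\<lambda>_. B i) \<and> isometries {()} ?Y ?Q (\<lambda>_. B' i)"
      using isometry_bob[OF p i l, of w] isometry_bob[OF p i jn, of w] j
      by (auto simp: \<alpha>_def \<alpha>'_def \<beta>_def \<beta>'_def B_def B'_def slice_bob[OF i(2)] tk)
  next
    fix i assume "i \<le> t" "odd i"
    then show "isometries (M i) ?Y ?Q (T i) \<and> isometries (M i) ?Y ?Q (T' i)" by (intro isoT)
  next
    fix i assume "i \<le> t" "even i"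
    then show "isometries (bob_outcomes n p i) ?Y ?Q (S i) \<and> isometries (bob_outcomes n p i) ?Y ?Q (S' i)"
      unfolding S_def S'_def using isometric_bob_family[OF p] by blast
  next
    fix i X Z m and \<psi> :: joint_state
    assume "X \<in> {S i, S' i}" "Z \<in> {A i, A' i}"
    moreover have "alice_qubits p i \<inter> bob_qubits p i = {}" by (auto simp: bob_qubits_def)
    ultimately show "X m (Z \<psi>) = Z (X m \<psi>)"
      by (auto simp: S_def S'_def A_def A'_def bob_family_def controlled_controlled_commute)
  next
    fix i X Z m and \<psi> :: joint_state
    assume "X \<in> {T i, T' i}" "Z \<in> {B i, B' i}"
    moreover have "alice_qubits p i \<inter> bob_qubits p i = {}" by (auto simp: bob_qubits_def)
    ultimately show "X m (Z \<psi>) = Z (X m \<psi>)"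
      by (auto simp: T_def T'_def B_def B'_def local_op_controlled_commute)
  next
    fix i i' X Z m k and \<psi> :: joint_state
    assume "i' = Suc i \<or> i = Suc i'" "odd i" "X \<in> {T i, T' i}" "Z \<in> {S i', S' i'}"
    then show "X m (Z k \<psi>) = Z k (X m \<psi>)"
      using alice_bob_disjoint[of i i' p]
      by (auto simp: T_def T'_def S_def S'_def bob_family_def local_op_controlled_commute)
  qed
  also have "(\<Sum>i<t. ?g i + ?g (Suc i)) = (\<Sum>i<t. round_dist n p j w c i + round_dist n p j w c (Suc i))"
  proof -
    have g: "?g i = round_dist n p j w c i" if i: "i \<le> t" for i
    proof (cases "odd i")
      case True
      have Q: "qubits p - alice_qubits p i = bob_qubits p i" by (simp add: bob_qubits_def)
      have "(family_dist (M i) ?Y ?Q (T' i) (\<alpha>' i) (T i) (\<alpha> i))\<^sup>2 = prefix_dist2 n p j w c i"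
        unfolding M_def T_def T'_def prefix_dist2_def bob_state_def lY \<alpha>_def[symmetric] \<alpha>'_def[symmetric]
        using canonical_local_dist[of ?Y ?Q "alice_qubits p i", unfolded Q, OF _ finQ alice_qubits_subset[OF p i] a0 \<tau>[OF i] \<tau>'[OF i]] by simp
      then show ?thesis using True by (simp add: round_dist_def real_sqrt_unique)
    next
      case False
      have "j - 1 < length w" using j by auto
      then have "(w @ [c]) ! (j - 1) = w ! (j - 1)" by (simp add: nth_append)
      then show ?thesis using False by (simp add: round_dist_def bob_dist_def S_def S'_def \<alpha>_def \<beta>_def)
    qed
    show ?thesis by (intro sum.cong refl arg_cong2[where f = "(+)"]) (rule g, simp)+
  qed
  finally have fin: "?D t \<le> (\<Sum>i<t. round_dist n p j w c i + round_dist n p j w c (Suc i))" .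
  show ?thesis
  proof (intro exI conjI)
    show "isometries (M t) ?Y ?Q (T t)" "isometries (M t) ?Y ?Q (T' t)" using isoT[of t] by auto
    show "\<forall>m. \<exists>k. T t m = local_op ?Y (alice_qubits p t) k" "\<forall>m. \<exists>k. T' t m = local_op ?Y (alice_qubits p t) k"
      by (auto simp: T_def T'_def)
  qed (rule fin[unfolded S_def S'_def \<alpha>'_def \<beta>_def \<beta>'_def])
qed

section \<open>Errors and averaging\<close>

lemma output_form:
  assumes R: "R \<subseteq> qubits p" and x: "x \<in> bitstrings n"
  shows "otrace (Pow R) (oprod (Pow R) E (ptrace_fst (bitstrings n) (reduced p R (run p k (\<lambda>_. b) (\<lambda>y. of_bool (y = x)) t))))
    = (\<Sum>S\<in>Pow (qubits p - R). \<Sum>a\<in>Pow R. \<Sum>b'\<in>Pow R.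
         cnj (workspace p k b x t (S \<union> a)) * E a b' * workspace p k b x t (S \<union> b'))"
proof -
  let ?\<rho> = "ptrace_fst (bitstrings n) (reduced p R (run p k (\<lambda>_. b) (\<lambda>y. of_bool (y = x)) t))"
  have "?\<rho> b' a
      = (\<Sum>S\<in>Pow (qubits p - R). workspace p k b x t (S \<union> b') * cnj (workspace p k b x t (S \<union> a)))" for a b'
  proof -
    have "?\<rho> b' a
      = (\<Sum>y\<in>bitstrings n. of_bool (y = x) * (\<Sum>S\<in>Pow (qubits p - R). workspace p k b y t (b' \<union> S) * cnj (workspace p k b y t (a \<union> S))))"
      by (simp add: ptrace_fst_def reduced_marginal marginal_def run_workspace sum_distrib_left) (intro sum.cong refl, simp)
    then show ?thesis using x by (simp add: Un_commute)
  qed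
  then have "otrace (Pow R) (oprod (Pow R) E (?\<rho>))
    = (\<Sum>a\<in>Pow R. \<Sum>b'\<in>Pow R. \<Sum>S\<in>Pow (qubits p - R).
         cnj (workspace p k b x t (S \<union> a)) * E a b' * workspace p k b x t (S \<union> b'))"
    by (simp add: otrace_def oprod_def sum_distrib_left mult_ac)
  also have "\<dots> = (\<Sum>S\<in>Pow (qubits p - R). \<Sum>a\<in>Pow R. \<Sum>b'\<in>Pow R.
         cnj (workspace p k b x t (S \<union> a)) * E a b' * workspace p k b x t (S \<union> b'))"
    by (rule sum_rotate)
  finally show ?thesis .
qed

definition output_qubits :: "nat \<Rightarrow> protocol \<Rightarrow> nat set" where
  "output_qubits t p = (if odd t then bob_qubits p t else alice_qubits p t)"

definition output_meas :: "nat \<Rightarrow> protocol \<Rightarrow> nat \<Rightarrow> bool \<Rightarrow> bool list \<Rightarrow> bool \<Rightarrow> nat set oper" where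
  "output_meas t p k b x = (if odd t then bob_meas p k b (take (k - 1) x) else alice_meas p x)"

lemma output_qubits_subset: "protocol_for n t p \<Longrightarrow> output_qubits t p \<subseteq> qubits p"
  using alice_qubits_subset[of n t p t] bob_qubits_subset[of p t] by (simp add: output_qubits_def)

lemma output_povm:
  assumes "protocol_for n t p" "k \<in> {1..n}" "x \<in> bitstrings n"
  shows "povm_on (Pow (output_qubits t p)) (output_meas t p k b x)"
proof -
  have "take (k - 1) x \<in> bitstrings (k - 1)" using assms(2,3) by (auto simp: bitstrings_def)
  then show ?thesis using assms unfolding protocol_for_def output_qubits_def output_meas_def
    by (simp split: if_splits)
qed

definition slice_output :: "nat \<Rightarrow> nat \<Rightarrow> protocol \<Rightarrow> bool list \<Rightarrow> nat \<Rightarrow> bool \<Rightarrow> bool \<Rightarrow> real" where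
  "slice_output n t p u k b c =
     (\<Sum>y\<in>bitstrings (n - length u). output_prob n t p (u @ y) k b c) / 2 ^ (n - length u)"

lemma slice_output_inner:
  assumes p: "protocol_for n t p" and u: "length u \<le> n"
  shows "slice_output n t p u k b c = Re (inner_on (bitstrings (n - length u)) (qubits p) (slice n p k b u t)
      (controlled (output_qubits t p) (\<lambda>y. output_meas t p k b (u @ y) c) (slice n p k b u t)))"
proof -
  let ?R = "output_qubits t p"
  let ?f = "\<lambda>x. \<Sum>S\<in>Pow (qubits p - ?R). \<Sum>a\<in>Pow ?R. \<Sum>b'\<in>Pow ?R.
         cnj (workspace p k b x t (S \<union> a)) * output_meas t p k b x c a b' * workspace p k b x t (S \<union> b')"
  define q where "q = complex_of_real (1 / sqrt (2 ^ (n - length u)))"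
  have q: "cnj q = q" "q * q = complex_of_real (1 / 2 ^ (n - length u))"
    unfolding q_def of_real_mult[symmetric] by simp_all
  have o: "output_prob n t p (u @ y) k b c = Re (?f (u @ y))" if "y \<in> bitstrings (n - length u)" for y
  proof -
    have "output_prob n t p x k b c = Re (otrace (Pow ?R) (oprod (Pow ?R) (output_meas t p k b x c)
        (ptrace_fst (bitstrings n) (reduced p ?R (run p k (\<lambda>_. b) (\<lambda>y. of_bool (y = x)) t)))))" for x
      by (simp only: output_prob_def output_qubits_def output_meas_def Let_def)
    moreover have "u @ y \<in> bitstrings n" using that u by (simp add: bitstrings_def)
    ultimately show ?thesis by (simp only: output_form[OF output_qubits_subset[OF p]])
  qed
  have sl: "slice n p k b u t (y, S) = q * workspace p k b (u @ y) t S" for y S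
    by (simp only: slice_def q_def prod.case)
  have re: "Re (complex_of_real r * (\<Sum>y\<in>Y. F y)) = r * (\<Sum>y\<in>Y. Re (F y))" for r Y and F :: "bool list \<Rightarrow> complex"
    by simp
  have m: "cnj (q * x) * e * (q * z) = (q * q) * (cnj x * e * z)" for x e z
    by (simp add: q(1))
  have "inner_on (bitstrings (n - length u)) (qubits p) (slice n p k b u t)
      (controlled ?R (\<lambda>y. output_meas t p k b (u @ y) c) (slice n p k b u t))
    = (\<Sum>y\<in>bitstrings (n - length u). of_real (1 / 2 ^ (n - length u)) * ?f (u @ y))"
    unfolding inner_on_controlled[OF output_qubits_subset[OF p]] sl m
    by (simp only: sum_distrib_left q(2))
  then have A: "inner_on (bitstrings (n - length u)) (qubits p) (slice n p k b u t)
      (controlled ?R (\<lambda>y. output_meas t p k b (u @ y) c) (slice n p k b u t))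
    = of_real (1 / 2 ^ (n - length u)) * (\<Sum>y\<in>bitstrings (n - length u). ?f (u @ y))"
    unfolding sum_distrib_left[of "complex_of_real (1 / 2 ^ (n - length u))" _ "bitstrings (n - length u)"] .
  have C: "(\<Sum>y\<in>bitstrings (n - length u). Re (?f (u @ y))) = (\<Sum>y\<in>bitstrings (n - length u). output_prob n t p (u @ y) k b c)"
    by (rule sum.cong[OF refl], rule o[symmetric])
  show ?thesis
    unfolding A re C slice_output_def by (simp only: times_divide_eq_left mult_1_left)
qed

lemma output_prob_nonneg:
  assumes p: "protocol_for n t p" and k: "k \<in> {1..n}" and x: "x \<in> bitstrings n"
  shows "0 \<le> output_prob n t p x k b c"
proof -
  have lx: "length x = n" using x by (simp add: bitstrings_def)
  have "slice_output n t p x k b c = output_prob n t p x k b c" by (simp add: slice_output_def lx)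
  moreover have "0 \<le> slice_output n t p x k b c"
    unfolding slice_output_inner[OF p eq_imp_le[OF lx]]
    by (rule inner_on_povm(1)[where K = "\<lambda>y. output_meas t p k b (x @ y)"])
       (use p output_qubits_subset[OF p] output_povm[OF p k] lx in \<open>auto simp: protocol_for_def bitstrings_def\<close>)
  ultimately show ?thesis by simp
qed

text \<open>The output \<open>False\<close> is wrong on \<open>\<beta>'\<close> and
  \<open>True\<close> is wrong on the run compared with it, so both being rare forces large
  distances. The compared run shares the input of the player who measures: \<open>\<beta>\<close> if
  Bob does, \<open>\<alpha>'\<close> if Alice does.\<close>

lemma error_gap:
  assumes p: "protocol_for n t p" and j: "j \<in> {1..length w}" and w: "length w < n"
  shows "1 \<le> slice_output n t p (w @ [\<not> c]) (Suc (length w)) c False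
      + (if odd t then slice_output n t p (w @ [c]) (Suc (length w)) c True
         else slice_output n t p (w @ [\<not> c]) j (w ! (j - 1)) True)
      + (\<Sum>i<t. round_dist n p j w c i + round_dist n p j w c (Suc i))"
proof -
  let ?l = "Suc (length w)" and ?u = "w @ [c]" and ?u' = "w @ [\<not> c]" and ?b = "w ! (j - 1)"
  let ?Y = "bitstrings (n - ?l)" and ?Q = "qubits p" and ?R = "output_qubits t p"
  let ?ip = "inner_on ?Y ?Q" and ?\<alpha>' = "slice n p j ?b ?u' t"
    and ?\<beta> = "slice n p ?l c ?u t" and ?\<beta>' = "slice n p ?l c ?u' t"
  obtain M :: "nat set option set" and \<Theta> \<Theta>' where \<Theta>: "isometries M ?Y ?Q \<Theta>" "isometries M ?Y ?Q \<Theta>'"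
      "\<forall>m. \<exists>k. \<Theta> m = local_op ?Y (alice_qubits p t) k" "\<forall>m. \<exists>k. \<Theta>' m = local_op ?Y (alice_qubits p t) k"
    and D: "(if odd t then family_dist M ?Y ?Q \<Theta>' (?\<beta>') \<Theta> (?\<beta>)
       else family_dist (bob_outcomes n p t) ?Y ?Q (bob_family n p t ?l) (?\<beta>')
           (bob_family n p t j) (?\<alpha>'))
      \<le> (\<Sum>i<t. round_dist n p j w c i + round_dist n p j w c (Suc i))"
    using hybrid_slices[OF p j w, of c] by blast
  have finQ: "finite ?Q" using p by (simp add: protocol_for_def)
  have l: "?l \<in> {1..n}" and jn: "j \<in> {1..n}" using w j by auto
  have unit: "?ip (?\<beta>') (?\<beta>') = 1"
    "?ip (?\<beta>) (?\<beta>) = 1"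
    "?ip (?\<alpha>') (?\<alpha>') = 1"
    using slice_unit[OF p l, of ?u' t c] slice_unit[OF p l, of ?u t c] slice_unit[OF p jn, of ?u' t ?b] w j by auto
  have disj: "alice_qubits p t \<inter> bob_qubits p t = {}" by (auto simp: bob_qubits_def)
  have so: "slice_output n t p v k b o' = Re (?ip (slice n p k b v t) (controlled ?R (\<lambda>y. output_meas t p k b (v @ y) o') (slice n p k b v t)))"
    if "length v = ?l" for v k b o'
    using slice_output_inner[OF p, of v k b o'] that w by simp
  show ?thesis
  proof (cases "odd t")
    case True
    have m: "output_meas t p ?l c (v @ y) = bob_meas p ?l c w" if "v \<in> {?u, ?u'}" for v y
      using that True by (auto simp: output_meas_def)
    have R: "?R = bob_qubits p t" using True by (simp add: output_qubits_def)
    have "1 \<le> Re (?ip (?\<beta>') (controlled ?R (\<lambda>y. bob_meas p ?l c w False) (?\<beta>')))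
      + Re (?ip (?\<beta>) (controlled ?R (\<lambda>y. bob_meas p ?l c w True) (?\<beta>)))
      + family_dist M ?Y ?Q \<Theta>' (?\<beta>') \<Theta> (?\<beta>)"
    proof (rule measurement_bias[OF finQ output_qubits_subset[OF p] _ \<Theta>(1,2)])
      fix y assume "y \<in> ?Y"
      then have "?u @ y \<in> bitstrings n" using w by (simp add: bitstrings_def)
      from output_povm[OF p l this, of c] show "povm_on (Pow ?R) (bob_meas p ?l c w)" using m[of ?u y] by simp
    next
      fix m c' and \<psi> :: joint_state
      obtain k k' where k: "\<Theta> m = local_op ?Y (alice_qubits p t) k" "\<Theta>' m = local_op ?Y (alice_qubits p t) k'" using \<Theta> by blast
      show "\<Theta> m (controlled ?R (\<lambda>y. bob_meas p ?l c w c') \<psi>) = controlled ?R (\<lambda>y. bob_meas p ?l c w c') (\<Theta> m \<psi>)"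
        "\<Theta>' m (controlled ?R (\<lambda>y. bob_meas p ?l c w c') \<psi>) = controlled ?R (\<lambda>y. bob_meas p ?l c w c') (\<Theta>' m \<psi>)"
        unfolding k R by (rule local_op_controlled_commute[OF disj])+
    qed (use unit in auto)
    then show ?thesis using D True by (simp add: so m del: append_assoc)
  next
    case False
    have m: "output_meas t p k b (?u' @ y) = alice_meas p (?u' @ y)" for k b y
      using False by (simp add: output_meas_def)
    have R: "?R = alice_qubits p t" using False by (simp add: output_qubits_def)
    have "1 \<le> Re (?ip (?\<beta>') (controlled ?R (\<lambda>y. alice_meas p (?u' @ y) False) (?\<beta>')))
      + Re (?ip (?\<alpha>') (controlled ?R (\<lambda>y. alice_meas p (?u' @ y) True) (?\<alpha>')))
      + family_dist (bob_outcomes n p t) ?Y ?Q (bob_family n p t ?l) (?\<beta>') (bob_family n p t j) (?\<alpha>')"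
    proof (rule measurement_bias[OF finQ output_qubits_subset[OF p] _ isometric_bob_family[OF p order_refl] isometric_bob_family[OF p order_refl]])
      fix y assume "y \<in> ?Y"
      then have "?u' @ y \<in> bitstrings n" using w by (simp add: bitstrings_def)
      from output_povm[OF p l this, of c] show "povm_on (Pow ?R) (alice_meas p (?u' @ y))" unfolding m .
    next
      fix m c' and \<psi> :: joint_state
      show "bob_family n p t j m (controlled ?R (\<lambda>y. alice_meas p (?u' @ y) c') \<psi>) = controlled ?R (\<lambda>y. alice_meas p (?u' @ y) c') (bob_family n p t j m \<psi>)"
        "bob_family n p t ?l m (controlled ?R (\<lambda>y. alice_meas p (?u' @ y) c') \<psi>) = controlled ?R (\<lambda>y. alice_meas p (?u' @ y) c') (bob_family n p t ?l m \<psi>)"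
        unfolding R bob_family_def by (rule controlled_controlled_commute[OF disj, symmetric])+
    qed (use unit in auto)
    then show ?thesis using D False by (simp add: so m del: append_assoc)
  qed
qed

text \<open>Cauchy-Schwarz over the \<open>t\<close> rounds. As one of two neighbours is always
  zero, the square of each sum has no mixed term, and every \<open>(F i)^2\<close> is counted at
  most twice.\<close>

lemma alternating_sum_bound:
  fixes F :: "nat \<Rightarrow> real"
  assumes nn: "\<And>i. 0 \<le> F i" and F0: "F 0 = 0" and alt: "\<And>i. F i * F (Suc i) = 0"
  shows "(\<Sum>i<t. F i + F (Suc i)) \<le> sqrt (2 * real t * (\<Sum>i=1..t. (F i)\<^sup>2))"
proof -
  have "(\<Sum>i<t. F i + F (Suc i)) \<le> L2_set (\<lambda>_. 1) {..<t} * L2_set (\<lambda>i. F i + F (Suc i)) {..<t}"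
    using L2_set_mult_ineq[of "\<lambda>_. 1" "\<lambda>i. F i + F (Suc i)" "{..<t}"] nn by simp
  also have "\<dots> = sqrt (real t * (\<Sum>i<t. (F i + F (Suc i))\<^sup>2))"
    by (simp add: L2_set_def real_sqrt_mult)
  also have "\<dots> \<le> sqrt (real t * (2 * (\<Sum>i=1..t. (F i)\<^sup>2)))"
  proof (intro real_sqrt_le_mono mult_left_mono)
    have "(\<Sum>i<t. (F i + F (Suc i))\<^sup>2) = (\<Sum>i<t. (F i)\<^sup>2) + (\<Sum>i<t. (F (Suc i))\<^sup>2)"
      unfolding sum.distrib[symmetric]
    proof (rule sum.cong[OF refl])
      fix i
      show "(F i + F (Suc i))\<^sup>2 = (F i)\<^sup>2 + (F (Suc i))\<^sup>2" using alt[of i] by (auto simp: power2_sum)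
    qed
    also have "(\<Sum>i<t. (F (Suc i))\<^sup>2) = (\<Sum>i=1..t. (F i)\<^sup>2)"
      by (rule sum.reindex_bij_witness[of _ "\<lambda>i. i - 1" Suc]) auto
    also have "(\<Sum>i<t. (F i)\<^sup>2) \<le> (\<Sum>i\<in>insert 0 {1..t}. (F i)\<^sup>2)"
      by (rule sum_mono2) auto
    also have "\<dots> = (\<Sum>i=1..t. (F i)\<^sup>2)" using F0 by simp
    finally show "(\<Sum>i<t. (F i + F (Suc i))\<^sup>2) \<le> 2 * (\<Sum>i=1..t. (F i)\<^sup>2)" by simp
  qed simp
  finally show ?thesis by (simp add: mult_ac)
qed

lemma weighted_mean_power2_le:
  fixes wt g :: "'i \<Rightarrow> real"
  assumes fin: "finite I" and wt: "\<And>x. x \<in> I \<Longrightarrow> 0 \<le> wt x" "(\<Sum>x\<in>I. wt x) = 1"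
  shows "(\<Sum>x\<in>I. wt x * g x)\<^sup>2 \<le> (\<Sum>x\<in>I. wt x * (g x)\<^sup>2)"
proof -
  let ?m = "\<Sum>x\<in>I. wt x * g x"
  have "0 \<le> (\<Sum>x\<in>I. wt x * (g x - ?m)\<^sup>2)" using wt by (intro sum_nonneg) simp
  also have "\<dots> = (\<Sum>x\<in>I. wt x * (g x)\<^sup>2 - (2 * ?m) * (wt x * g x) + ?m\<^sup>2 * wt x)"
    by (intro sum.cong refl) (simp add: power2_diff algebra_simps)
  also have "\<dots> = (\<Sum>x\<in>I. wt x * (g x)\<^sup>2) - (2 * ?m) * ?m + ?m\<^sup>2 * (\<Sum>x\<in>I. wt x)"
    by (simp only: sum.distrib sum_subtractf sum_distrib_left)
  finally show ?thesis using wt by (simp add: power2_eq_square)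
qed

text \<open>Averaging comes first, so that Jensen's inequality can turn the means of distances into
  the bounds on squares. Separating odd from even rounds yields the two square roots of the final
  inequality and the alternation that \<open>alternating_sum_bound\<close> requires.\<close>

lemma weighted_rounds:
  fixes wt :: "'i \<Rightarrow> real" and g :: "'i \<Rightarrow> nat \<Rightarrow> real"
  assumes fin: "finite I" and wt: "\<And>x. x \<in> I \<Longrightarrow> 0 \<le> wt x" "(\<Sum>x\<in>I. wt x) = 1"
    and g: "\<And>x i. 0 \<le> g x i" "\<And>x. x \<in> I \<Longrightarrow> g x 0 = 0"
    and odd_bound: "\<And>i. i \<in> {1..t} \<Longrightarrow> odd i \<Longrightarrow> (\<Sum>x\<in>I. wt x * (g x i)\<^sup>2) \<le> VA i"
    and even_bound: "\<And>i. i \<in> {1..t} \<Longrightarrow> even i \<Longrightarrow> (\<Sum>x\<in>I. wt x * (g x i)\<^sup>2) \<le> VB i"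
  shows "(\<Sum>x\<in>I. wt x * (\<Sum>i<t. g x i + g x (Suc i)))
      \<le> sqrt (2 * real t * (\<Sum>i | i \<in> {1..t} \<and> odd i. VA i)) + sqrt (2 * real t * (\<Sum>i | i \<in> {1..t} \<and> even i. VB i))"
proof -
  define G where "G i = (\<Sum>x\<in>I. wt x * g x i)" for i
  define Go where "Go i = (if odd i then G i else 0)" for i
  define Ge where "Ge i = (if even i then G i else 0)" for i
  have G0: "0 \<le> G i" for i unfolding G_def using wt g by (intro sum_nonneg) simp
  have Gz: "G 0 = 0" unfolding G_def using g by simp
  have "(\<Sum>x\<in>I. wt x * (\<Sum>i<t. g x i + g x (Suc i))) = (\<Sum>i<t. G i + G (Suc i))"
    unfolding sum_distrib_left G_def sum.distrib[symmetric]
    by (subst sum.swap) (simp add: distrib_left)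
  also have "\<dots> = (\<Sum>i<t. Go i + Go (Suc i)) + (\<Sum>i<t. Ge i + Ge (Suc i))"
    unfolding sum.distrib[symmetric] by (intro sum.cong refl) (simp add: Go_def Ge_def)
  also have "(\<Sum>i<t. Go i + Go (Suc i)) \<le> sqrt (2 * real t * (\<Sum>i=1..t. (Go i)\<^sup>2))"
    by (rule alternating_sum_bound) (use G0 in \<open>auto simp: Go_def\<close>)
  also have "(\<Sum>i<t. Ge i + Ge (Suc i)) \<le> sqrt (2 * real t * (\<Sum>i=1..t. (Ge i)\<^sup>2))"
    by (rule alternating_sum_bound) (use G0 Gz in \<open>auto simp: Ge_def\<close>)
  also have "(\<Sum>i=1..t. (Go i)\<^sup>2) = (\<Sum>i | i \<in> {1..t} \<and> odd i. (G i)\<^sup>2)"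
    by (rule sum.mono_neutral_cong_right) (auto simp: Go_def)
  also have "(\<Sum>i=1..t. (Ge i)\<^sup>2) = (\<Sum>i | i \<in> {1..t} \<and> even i. (G i)\<^sup>2)"
    by (rule sum.mono_neutral_cong_right) (auto simp: Ge_def)
  also have "sqrt (2 * real t * (\<Sum>i | i \<in> {1..t} \<and> odd i. (G i)\<^sup>2)) \<le> sqrt (2 * real t * (\<Sum>i | i \<in> {1..t} \<and> odd i. VA i))"
    by (intro real_sqrt_le_mono mult_left_mono sum_mono)
       (auto simp: G_def intro: order_trans[OF weighted_mean_power2_le[OF fin wt] odd_bound])
  also have "sqrt (2 * real t * (\<Sum>i | i \<in> {1..t} \<and> even i. (G i)\<^sup>2)) \<le> sqrt (2 * real t * (\<Sum>i | i \<in> {1..t} \<and> even i. VB i))"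
    by (intro real_sqrt_le_mono mult_left_mono sum_mono)
       (auto simp: G_def intro: order_trans[OF weighted_mean_power2_le[OF fin wt] even_bound])
  finally show ?thesis by simp
qed

section \<open>Averages of the error over slices\<close>

lemma sum_bitstrings_flip:
  assumes "m < n"
  shows "(\<Sum>w\<in>bitstrings m. \<Sum>c\<in>UNIV. \<Sum>y\<in>bitstrings (n - Suc m). f ((w @ [\<not> c]) @ y)) = (\<Sum>x\<in>bitstrings n. f x)"
    and "(\<Sum>w\<in>bitstrings m. \<Sum>c\<in>UNIV. \<Sum>y\<in>bitstrings (n - Suc m). f ((w @ [c]) @ y)) = (\<Sum>x\<in>bitstrings n. f x)"
  using assms unfolding sum_bitstrings_append[OF Suc_leI[OF assms], of f] sum_bitstrings_snoc
  by (simp_all add: UNIV_bool add.commute)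

definition zero_input_error :: "nat \<Rightarrow> nat \<Rightarrow> protocol \<Rightarrow> nat \<Rightarrow> real" where
  "zero_input_error n t p k = (\<Sum>x\<in>bitstrings n. output_prob n t p x k (x ! (k - 1)) True) / 2 ^ n"

definition one_input_error :: "nat \<Rightarrow> nat \<Rightarrow> protocol \<Rightarrow> nat \<Rightarrow> real" where
  "one_input_error n t p k = (\<Sum>x\<in>bitstrings n. output_prob n t p x k (\<not> x ! (k - 1)) False) / 2 ^ n"

lemma error_prob_split:
  "error_prob n t p = (\<Sum>k=1..n. zero_input_error n t p k + one_input_error n t p k) / (2 * real n)"
proof -
  let ?e = "\<lambda>x k. output_prob n t p x k (x ! (k - 1)) True + output_prob n t p x k (\<not> x ! (k - 1)) False"
  have "error_prob n t p = (\<Sum>x\<in>bitstrings n. \<Sum>k=1..n.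
      ?e x k / (2 ^ n * real n * 2))"
    unfolding error_prob_def
  proof (intro sum.cong refl)
    fix x k
    show "(\<Sum>b\<in>UNIV. output_prob n t p x k b (\<not> aug_index x k b) / (2 ^ n * real n * 2))
      = ?e x k / (2 ^ n * real n * 2)"
      by (cases "x ! (k - 1)") (simp_all add: UNIV_bool aug_index_def add_divide_distrib)
  qed
  also have "\<dots> = (\<Sum>k=1..n. \<Sum>x\<in>bitstrings n.
      ?e x k / (2 ^ n * real n * 2))"
    by (rule sum.swap)
  also have "\<dots> = (\<Sum>k=1..n. (zero_input_error n t p k + one_input_error n t p k) / (2 * real n))"
    by (intro sum.cong refl)
       (simp add: zero_input_error_def one_input_error_def sum.distrib add_divide_distrib mult_ac flip: sum_divide_distrib)
  finally show ?thesis by (simp add: sum_divide_distrib)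
qed

text \<open>With \<open>w\<close>, \<open>c\<close> and the remaining bits uniform, the whole input
  is uniform, flipped or not. \<open>\<beta>'\<close> recovers Bob's bit from that input, so
  averages over slices become averages over inputs.\<close>

lemma sum_slice_output:
  assumes m: "m < n" and \<sigma>: "\<sigma> = Not \<or> \<sigma> = (\<lambda>c. c)"
    and \<beta>: "\<And>w c y. w \<in> bitstrings m \<Longrightarrow> \<beta>' ((w @ [\<sigma> c]) @ y) = \<beta> w c"
  shows "(\<Sum>w\<in>bitstrings m. \<Sum>c\<in>UNIV. slice_output n t p (w @ [\<sigma> c]) k (\<beta> w c) r) / 2 ^ Suc m
    = (\<Sum>x\<in>bitstrings n. output_prob n t p x k (\<beta>' x) r) / 2 ^ n"
proof -
  let ?F = "\<lambda>x. output_prob n t p x k (\<beta>' x) r"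
  have pw: "(2::real) ^ (n - Suc m) * 2 ^ Suc m = 2 ^ n" using m by (simp only: flip: power_add) simp
  have "(\<Sum>w\<in>bitstrings m. \<Sum>c\<in>UNIV. slice_output n t p (w @ [\<sigma> c]) k (\<beta> w c) r)
      = (\<Sum>w\<in>bitstrings m. \<Sum>c\<in>UNIV. \<Sum>y\<in>bitstrings (n - Suc m). ?F ((w @ [\<sigma> c]) @ y)) / 2 ^ (n - Suc m)"
    unfolding sum_divide_distrib slice_output_def
  proof (rule sum.cong[OF refl], rule sum.cong[OF refl])
    fix w c assume w: "w \<in> bitstrings m"
    then have "length (w @ [\<sigma> c]) = Suc m" by (simp add: bitstrings_def)
    then show "(\<Sum>y\<in>bitstrings (n - length (w @ [\<sigma> c])). output_prob n t p ((w @ [\<sigma> c]) @ y) k (\<beta> w c) r / 2 ^ (n - length (w @ [\<sigma> c])))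
      = (\<Sum>y\<in>bitstrings (n - Suc m). ?F ((w @ [\<sigma> c]) @ y) / 2 ^ (n - Suc m))"
      by (simp only: \<beta>[OF w])
  qed
  also have "(\<Sum>w\<in>bitstrings m. \<Sum>c\<in>UNIV. \<Sum>y\<in>bitstrings (n - Suc m). ?F ((w @ [\<sigma> c]) @ y)) = (\<Sum>x\<in>bitstrings n. ?F x)"
    using \<sigma> sum_bitstrings_flip[OF m, of ?F] by (elim disjE) (simp_all only:)
  finally show ?thesis by (simp only: divide_divide_eq_left pw)
qed

lemma mean_slice_output:
  assumes m: "m < n"
  shows "(\<Sum>w\<in>bitstrings m. \<Sum>c\<in>UNIV. slice_output n t p (w @ [\<not> c]) (Suc m) c False) / 2 ^ Suc m = one_input_error n t p (Suc m)"
    and "(\<Sum>w\<in>bitstrings m. \<Sum>c\<in>UNIV. slice_output n t p (w @ [c]) (Suc m) c True) / 2 ^ Suc m = zero_input_error n t p (Suc m)"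
    and "j \<in> {1..m} \<Longrightarrow> (\<Sum>w\<in>bitstrings m. \<Sum>c\<in>UNIV. slice_output n t p (w @ [\<not> c]) j (w ! (j - 1)) True) / 2 ^ Suc m = zero_input_error n t p j"
  unfolding one_input_error_def zero_input_error_def
  by (rule sum_slice_output[OF m]; force simp: bitstrings_def nth_append)+

section \<open>The trade-off\<close>

lemma round_dist_nonneg: "0 \<le> round_dist n p j w c i"
  by (simp add: round_dist_def prefix_dist2_def hs_dist2_nonneg bob_dist_def)

lemma round_dist_0: "round_dist n p j w c 0 = 0"
proof -
  have "slice n p k d v 0 = slice n p k' d' v 0" for k k' d d' v
    by (simp add: slice_def workspace_def)
  moreover have "bob_kraus n p 0 k = bob_kraus n p 0 k'" for k k' by (simp add: bob_kraus_def run0_def)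
  ultimately have "bob_family n p 0 k \<mu> (slice n p k d v 0) = bob_family n p 0 k' \<mu> (slice n p k' d' v 0)" for k k' d d' v \<mu>
    unfolding bob_family_def by metis
  then have "(\<lambda>\<mu> \<omega>. bob_family n p 0 k \<mu> (slice n p k d v 0) \<omega> - bob_family n p 0 k' \<mu> (slice n p k' d' v 0) \<omega>) = (\<lambda>\<mu> \<omega>. 0)" for k k' d d' v
    by (metis (no_types, lifting) diff_self)
  then have "family_dist (bob_outcomes n p 0) Y Q (bob_family n p 0 k) (slice n p k d v 0) (bob_family n p 0 k') (slice n p k' d' v 0) = 0" for Y Q k k' d d' v
    by (simp add: family_dist_def family_norm_def L2_set_def)
  then show ?thesis by (simp add: round_dist_def bob_dist_def)
qed

text \<open>For each \<open>j\<close> the drops of entropy telescope over the upper half to the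
  information about the bits after \<open>h\<close> given the first \<open>h\<close>. Since
  \<open>j \<le> h\<close>, this is at most the information about all bits after \<open>j\<close>;
  extending the sum to all \<open>j\<close> adds nonnegative terms.\<close>

lemma odd_round_bound:
  assumes p: "protocol_for n t p" and i: "i \<le> t" "odd i" and h: "h \<le> n"
  shows "(\<Sum>j=1..h. \<Sum>m=h..<n. (\<Sum>w\<in>bitstrings m. \<Sum>c\<in>UNIV. (round_dist n p j w c i)\<^sup>2) / 2 ^ Suc m)
    \<le> 4 * ln 2 * (real n * alice_info n p i)"
proof -
  let ?G = "\<lambda>j m. (\<Sum>w\<in>bitstrings m. \<Sum>c\<in>UNIV. (round_dist n p j w c i)\<^sup>2) / 2 ^ Suc m"
  let ?E = "\<lambda>j m. prefix_entropy n p j i m"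
  have one: "(\<Sum>m=h..<n. ?G j m) \<le> 4 * ln 2 * (?E j j - ?E j n)"
    if j: "j \<in> {1..h}" for j
  proof -
    have "(\<Sum>m=h..<n. ?G j m)
        \<le> (\<Sum>m=h..<n. 4 * ln 2 * (?E j m - ?E j (Suc m)))"
    proof (rule sum_mono)
      fix m assume m: "m \<in> {h..<n}"
      have "(round_dist n p j w c i)\<^sup>2 = prefix_dist2 n p j w c i" for w c
        using i(2) by (simp add: round_dist_def prefix_dist2_def hs_dist2_nonneg)
      then show "?G j m \<le> 4 * ln 2 * (?E j m - ?E j (Suc m))"
        using prefix_entropy_step[OF p _ _ i(1), of j m] j m by (simp only: prefix_dist2_def) auto
    qed
    also have "\<dots> = 4 * ln 2 * (?E j h - ?E j n)"
      using sum_Suc_diff'[OF h, of "\<lambda>m. - ?E j m"] by (simp flip: sum_distrib_left)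
    also have "\<dots> \<le> 4 * ln 2 * (?E j j - ?E j n)"
      using prefix_entropy_antimono[OF p _ _ h i(1), of j j] j by simp
    finally show ?thesis .
  qed
  have "(\<Sum>j=1..h. \<Sum>m=h..<n. ?G j m)
      \<le> (\<Sum>j=1..h. 4 * ln 2 * (?E j j - ?E j n))" by (rule sum_mono) (rule one)
  also have "\<dots> \<le> (\<Sum>j=1..n. 4 * ln 2 * (?E j j - ?E j n))"
    by (rule sum_mono2) (use h prefix_entropy_antimono[OF p _ _ _ i(1)] in auto)
  also have "\<dots> = 4 * ln 2 * (real n * alice_info n p i)"
    by (cases "n = 0") (simp_all add: alice_info_def flip: sum_distrib_left)
  finally show ?thesis .
qed

text \<open>Each pair is compared through the common midpoint \<open>Z\<close> at a factor 2, and
  every index in \<open>{1..n}\<close> belongs to exactly \<open>h\<close> pairs, whence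
  \<open>2 * real h\<close>.\<close>

lemma even_round_bound:
  assumes p: "protocol_for n t p" and i: "i \<le> t" "even i" and h: "h > 0" "n = 2 * h"
  shows "(\<Sum>j=1..h. \<Sum>m=h..<n. (\<Sum>w\<in>bitstrings m. \<Sum>c\<in>UNIV. (round_dist n p j w c i)\<^sup>2) / 2 ^ Suc m)
    \<le> 2 * real h * (real n * ln 2 * bob_info n p i)"
proof -
  let ?G = "\<lambda>j m. (\<Sum>w\<in>bitstrings m. \<Sum>c\<in>UNIV. (round_dist n p j w c i)\<^sup>2) / 2 ^ Suc m"
  let ?B = "alice_labels n p i"
  let ?R = "\<lambda>k. osqrt ?B (alice_state n p k i)"
  obtain Z where Z: "(\<Sum>k=1..n. hs_dist2 ?B (?R k) Z) \<le> real n * ln 2 * bob_info n p i"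
    using bob_info_bound[OF p _ i(1)] h by auto
  let ?H = "\<lambda>k. hs_dist2 ?B (?R k) Z"
  have "(\<Sum>j=1..h. \<Sum>m=h..<n. ?G j m)
      \<le> (\<Sum>j=1..h. \<Sum>m=h..<n. 2 * (?H (Suc m) + ?H j))"
  proof (intro sum_mono)
    fix j m assume j: "j \<in> {1..h}" and m: "m \<in> {h..<n}"
    have "(\<Sum>w\<in>bitstrings m. \<Sum>c\<in>UNIV. (round_dist n p j w c i)\<^sup>2)
        = (\<Sum>w\<in>bitstrings m. \<Sum>c\<in>UNIV. (bob_dist n p j (Suc m) (w @ [c]) i)\<^sup>2)"
      using i(2) by (intro sum.cong refl) (simp add: round_dist_def bitstrings_def)
    also have "\<dots> = (\<Sum>u\<in>bitstrings (Suc m). (bob_dist n p j (Suc m) u i)\<^sup>2)"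
      unfolding sum_bitstrings_snoc by (simp add: UNIV_bool add.commute)
    finally have "?G j m = hs_dist2 ?B (?R (Suc m)) (?R j)"
      using sum_bob_dist[OF p i(1), of j "Suc m" "Suc m"] j m by simp
    then show "?G j m \<le> 2 * (?H (Suc m) + ?H j)"
      using hs_dist2_triangle[of ?B "?R (Suc m)" "?R j" Z] by simp
  qed
  also have "\<dots> = 2 * real h * ((\<Sum>m=h..<n. ?H (Suc m)) + (\<Sum>j=1..h. ?H j))"
    using h by (simp add: sum.distrib algebra_simps flip: sum_distrib_left)
  also have "(\<Sum>m=h..<n. ?H (Suc m)) = (\<Sum>k\<in>{Suc h..n}. ?H k)"
    by (rule sum.reindex_bij_witness[of _ "\<lambda>i. i - 1" Suc]) auto
  also have "(\<Sum>k\<in>{Suc h..n}. ?H k) + (\<Sum>j=1..h. ?H j) = (\<Sum>k=1..n. ?H k)"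
  proof -
    have "{1..n} = {Suc h..n} \<union> {1..h}" using h by auto
    then show ?thesis by (simp add: sum.union_disjoint)
  qed
  also have "2 * real h * (\<Sum>k=1..n. ?H k) \<le> 2 * real h * (real n * ln 2 * bob_info n p i)"
    using Z by (rule mult_left_mono) simp
  finally show ?thesis .
qed

text \<open>Each error term ranges over one half of the indices only and is bounded by its sum over
  all of them. Restricting the index to half of its range costs 2, and conditioning on the function
  value costs another 2.\<close>

lemma error_bound:
  assumes p: "protocol_for n t p" and h: "h > 0" "n = 2 * h"
  shows "(\<Sum>j=1..h. \<Sum>m=h..<n. (\<Sum>w\<in>bitstrings m. \<Sum>c\<in>UNIV. slice_output n t p (w @ [\<not> c]) (Suc m) c False
      + (if odd t then slice_output n t p (w @ [c]) (Suc m) c True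
         else slice_output n t p (w @ [\<not> c]) j (w ! (j - 1)) True)) / 2 ^ Suc m)
    \<le> (real h)\<^sup>2 * (4 * error_prob n t p)"
proof -
  let ?G = "\<lambda>j m. (\<Sum>w\<in>bitstrings m. \<Sum>c\<in>UNIV. slice_output n t p (w @ [\<not> c]) (Suc m) c False
      + (if odd t then slice_output n t p (w @ [c]) (Suc m) c True
         else slice_output n t p (w @ [\<not> c]) j (w ! (j - 1)) True)) / 2 ^ Suc m"
  let ?e1 = "one_input_error n t p" and ?e0 = "zero_input_error n t p"
  have e1: "0 \<le> ?e1 k" and e0: "0 \<le> ?e0 k" if "k \<in> {1..n}" for k
    unfolding one_input_error_def zero_input_error_def
    using output_prob_nonneg[OF p that] by (auto intro!: divide_nonneg_nonneg sum_nonneg)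
  have shift: "(\<Sum>m=h..<n. F (Suc m)) = (\<Sum>k\<in>{Suc h..n}. F k)" for F :: "nat \<Rightarrow> real"
    by (rule sum.reindex_bij_witness[of _ "\<lambda>i. i - 1" Suc]) auto
  have "(\<Sum>j=1..h. \<Sum>m=h..<n. ?G j m)
    = (\<Sum>j=1..h. \<Sum>m=h..<n. ?e1 (Suc m) + (if odd t then ?e0 (Suc m) else ?e0 j))"
  proof (rule sum.cong[OF refl], rule sum.cong[OF refl])
    fix j m assume "j \<in> {1..h}" "m \<in> {h..<n}"
    then have "m < n" "j \<in> {1..m}" by auto
    then show "?G j m = ?e1 (Suc m) + (if odd t then ?e0 (Suc m) else ?e0 j)"
      using mean_slice_output[OF \<open>m < n\<close>] by (simp only: sum.distrib add_divide_distrib) (simp split: if_splits)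
  qed
  also have "\<dots> = real h * (\<Sum>k\<in>{Suc h..n}. ?e1 k) + real h * (\<Sum>k\<in>(if odd t then {Suc h..n} else {1..h}). ?e0 k)"
    using shift[of ?e1] shift[of ?e0] h by (simp add: sum.distrib flip: sum_distrib_left)
  also have "\<dots> \<le> real h * (\<Sum>k=1..n. ?e1 k) + real h * (\<Sum>k=1..n. ?e0 k)"
    by (intro add_mono mult_left_mono sum_mono2) (use e1 e0 h in auto)
  also have "\<dots> = (real h)\<^sup>2 * (4 * error_prob n t p)"
    unfolding error_prob_split sum.distrib using h by (simp add: power2_eq_square field_simps)
  finally show ?thesis .
qed

theorem theorem4p7:
  fixes n t :: nat and \<epsilon> :: real and p :: protocol
  assumes "even n" and "n > 0" and "t \<ge> 1"
    and "0 \<le> \<epsilon>" and "\<epsilon> \<le> 1/4"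
    and "protocol_for n t p"
    and "error_prob n t p \<le> \<epsilon>"
  shows "2 * sqrt (QIC_A n t p / real n) + sqrt (2 * QIC_B n t p)
           \<ge> (1 - 4 * \<epsilon>) / (4 * sqrt (kappa * real t))"
proof -
  note p = assms(6)
  obtain h where n: "n = 2 * h" using assms(1) by blast
  have h: "h > 0" using assms(2) n by simp
  define I where "I = {1..h} \<times> (SIGMA m:{h..<n}. bitstrings m \<times> (UNIV :: bool set))"
  \<comment> \<open>Uniform over the \<open>h^2\<close> pairs, where \<open>m = l - 1\<close>, and
    then over the \<open>2^(m+1)\<close> strings formed by \<open>w\<close> and
    \<open>c\<close>.\<close>
  define wt where "wt = (\<lambda>(j :: nat, m :: nat, w :: bool list, c :: bool). 1 / ((real h)\<^sup>2 * 2 ^ Suc m))"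
  define g where "g = (\<lambda>(j, m :: nat, w, c). round_dist n p j w c)"
  define err where "err = (\<lambda>(j, m, w, c). slice_output n t p (w @ [\<not> c]) (Suc m) c False
      + (if odd t then slice_output n t p (w @ [c]) (Suc m) c True
         else slice_output n t p (w @ [\<not> c]) j (w ! (j - 1)) True))"
  have finI: "finite I" by (simp add: I_def)
  have sumI: "(\<Sum>x\<in>I. wt x * F x)
      = (\<Sum>j=1..h. \<Sum>m=h..<n. (\<Sum>w\<in>bitstrings m. \<Sum>c\<in>UNIV. F (j, m, w, c)) / 2 ^ Suc m) / (real h)\<^sup>2" for F
  proof -
    have "(\<Sum>x\<in>I. wt x * F x) = (\<Sum>j=1..h. \<Sum>z\<in>(SIGMA m:{h..<n}. bitstrings m \<times> UNIV). wt (j, z) * F (j, z))"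
      unfolding I_def by (rule sum.cartesian_product')
    also have "\<dots> = (\<Sum>j=1..h. \<Sum>m=h..<n. \<Sum>v\<in>bitstrings m \<times> UNIV. wt (j, m, v) * F (j, m, v))"
      by (intro sum.cong refl) (subst sum.Sigma; simp add: case_prod_unfold)
    also have "\<dots> = (\<Sum>j=1..h. \<Sum>m=h..<n. \<Sum>w\<in>bitstrings m. \<Sum>c\<in>UNIV. F (j, m, w, c) / 2 ^ Suc m / (real h)\<^sup>2)"
      by (intro sum.cong refl) (simp add: sum.cartesian_product' wt_def mult.commute)
    finally show ?thesis by (simp only: sum_divide_distrib)
  qed
  have wt0: "0 \<le> wt x" for x by (auto simp: wt_def split: prod.split)
  have wt1: "(\<Sum>x\<in>I. wt x) = 1"
  proof -
    have "(\<Sum>x\<in>I. wt x) = (\<Sum>j=1..h. \<Sum>m=h..<n. (1::real)) / (real h)\<^sup>2"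
      using sumI[of "\<lambda>_. 1"] by (simp add: card_bitstrings)
    then show ?thesis using h n by (simp add: power2_eq_square)
  qed
  have err_le: "(\<Sum>x\<in>I. wt x * err x) \<le> 4 * error_prob n t p"
    using error_bound[OF p h n] h unfolding sumI by (simp add: err_def divide_le_eq mult.commute)
  have gap: "1 - err x \<le> (\<Sum>i<t. g x i + g x (Suc i))" if "x \<in> I" for x
  proof -
    obtain j m w c where x: "x = (j, m, w, c)" by (cases x) auto
    then have *: "j \<in> {1..length w}" "length w < n" "m = length w"
      using that by (auto simp: I_def bitstrings_def)
    show ?thesis using error_gap[OF p *(1,2), of c] by (simp add: x err_def g_def *(3))
  qed
  have "1 - 4 * \<epsilon> \<le> (\<Sum>x\<in>I. wt x * (1 - err x))"
    using err_le wt1 assms(7) by (simp add: right_diff_distrib sum_subtractf)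
  also have "\<dots> \<le> (\<Sum>x\<in>I. wt x * (\<Sum>i<t. g x i + g x (Suc i)))"
    by (intro sum_mono mult_left_mono gap wt0)
  \<comment> \<open>With \<open>n = 2 * h\<close>, dividing the bounds for odd and even rounds by
    \<open>h^2\<close> turns \<open>4 * ln 2 * n\<close> into \<open>16 * ln 2 / n\<close> and
    \<open>2 * h * n * ln 2\<close> into \<open>4 * ln 2\<close>.\<close>
  also have "\<dots> \<le> sqrt (2 * real t * (\<Sum>i | i \<in> {1..t} \<and> odd i. 16 * ln 2 / real n * alice_info n p i))
      + sqrt (2 * real t * (\<Sum>i | i \<in> {1..t} \<and> even i. 4 * ln 2 * bob_info n p i))"
  proof (rule weighted_rounds[OF finI wt0 wt1])
    show "0 \<le> g x i" for x i by (auto simp: g_def round_dist_nonneg split: prod.split)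
    show "g x 0 = 0" for x by (auto simp: g_def round_dist_0 split: prod.split)
    fix i assume i: "i \<in> {1..t}"
    have s: "(\<Sum>x\<in>I. wt x * (g x i)\<^sup>2)
      = (\<Sum>j=1..h. \<Sum>m=h..<n. (\<Sum>w\<in>bitstrings m. \<Sum>c\<in>UNIV. (round_dist n p j w c i)\<^sup>2) / 2 ^ Suc m) / (real h)\<^sup>2"
      unfolding sumI by (simp add: g_def)
    {
      assume "odd i"
      then show "(\<Sum>x\<in>I. wt x * (g x i)\<^sup>2) \<le> 16 * ln 2 / real n * alice_info n p i"
        using divide_right_mono[OF odd_round_bound[OF p, of i h], of "(real h)\<^sup>2"] i n h
        unfolding s by (simp add: power2_eq_square)
    next
      assume "even i"
      then show "(\<Sum>x\<in>I. wt x * (g x i)\<^sup>2) \<le> 4 * ln 2 * bob_info n p i"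
        using divide_right_mono[OF even_round_bound[OF p _ _ h n, of i], of "(real h)\<^sup>2"] i n h
        unfolding s by (simp add: power2_eq_square)
    }
  qed
  also have "(\<Sum>i | i \<in> {1..t} \<and> odd i. 16 * ln 2 / real n * alice_info n p i) = 16 * ln 2 * (QIC_A n t p / real n)"
    unfolding QIC_A_alice_info[OF p] sum_distrib_left[symmetric] by simp
  also have "(\<Sum>i | i \<in> {1..t} \<and> even i. 4 * ln 2 * bob_info n p i) = 4 * ln 2 * QIC_B n t p"
    unfolding QIC_B_def by (simp add: bob_info_def flip: sum_distrib_left)
  \<comment> \<open>Here and in the next equation \<open>ln 2\<close> is \<open>2 * kappa\<close>;
    64 and 16 then leave the square roots as 8 and 4.\<close>
  also have "2 * real t * (16 * ln 2 * (QIC_A n t p / real n)) = 64 * (kappa * real t) * (QIC_A n t p / real n)"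
    by (simp add: kappa_def)
  also have "2 * real t * (4 * ln 2 * QIC_B n t p) = 16 * (kappa * real t) * QIC_B n t p"
    by (simp add: kappa_def)
  finally have main: "1 - 4 * \<epsilon> \<le> sqrt (64 * (kappa * real t) * (QIC_A n t p / real n)) + sqrt (16 * (kappa * real t) * QIC_B n t p)" .
  have s64: "sqrt 64 = (8::real)" "sqrt 16 = (4::real)" by (rule real_sqrt_unique; simp)+
  \<comment> \<open>Since \<open>sqrt\<close> is an odd function on the reals, passing from
    \<open>QIC_B\<close> to \<open>2 * QIC_B\<close> under the root requires nonnegativity. It
    follows because the Holevo bound places a sum of squares below each summand.\<close>
  have QB: "0 \<le> QIC_B n t p"
    unfolding QIC_B_def bob_info_def[symmetric]
  proof (rule sum_nonneg)
    fix i assume "i \<in> {i. i \<in> {1..t} \<and> even i}"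
    then obtain Z where "(\<Sum>k=1..n. hs_dist2 (alice_labels n p i)
        (osqrt (alice_labels n p i) (alice_state n p k i)) Z) \<le> real n * ln 2 * bob_info n p i"
      using bob_info_bound[OF p assms(2), of i] by auto
    then have "0 \<le> real n * ln 2 * bob_info n p i"
      by (rule order_trans[rotated]) (simp add: sum_nonneg hs_dist2_nonneg)
    moreover have "0 < real n * ln 2" using assms(2) by simp
    ultimately show "0 \<le> bob_info n p i"
      using mult_le_cancel_left_pos[of "real n * ln 2" 0 "bob_info n p i"] by simp
  qed
  have kt: "0 < sqrt (kappa * real t)" using assms(3) by (simp add: kappa_def)
  have "1 - 4 * \<epsilon> \<le> 4 * sqrt (kappa * real t) * (2 * sqrt (QIC_A n t p / real n)) + 4 * sqrt (kappa * real t) * sqrt (QIC_B n t p)"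
    using main by (simp only: real_sqrt_mult s64)
  also have "\<dots> \<le> 4 * sqrt (kappa * real t) * (2 * sqrt (QIC_A n t p / real n)) + 4 * sqrt (kappa * real t) * sqrt (2 * QIC_B n t p)"
    using QB kt by (intro add_left_mono mult_left_mono real_sqrt_le_mono) auto
  also have "\<dots> = (2 * sqrt (QIC_A n t p / real n) + sqrt (2 * QIC_B n t p)) * (4 * sqrt (kappa * real t))"
    by (simp only: distrib_left distrib_right mult.commute)
  finally show ?thesis using kt by (simp add: pos_divide_le_eq)
qed

end
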